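(* Let $k\ge 0$. For any bounded Lipschitz function $\psi:\mathbb{R}^{k+1}\to\mathbb{R}$, the cavity iterates $w^{[0]},\dots,w^{[k]}\in\mathbb{R}^n$ (defined in the context for $n\ge k+1$) satisfy, in probability, $$\lim_{n\to\infty}\frac1n\sum_{i=1}^n\psi\bigl(w_i^{[k]},w_i^{[k-1]},\ldots,w_i^{[0]}\bigr)=\mathbb{E}\,\psi\bigl(W_k,W_{k-1},\ldots,W_0\bigr),$$ where $(W_k,\ldots,W_1)$ is a jointly centered Gaussian vector, independent of $W_0$, with covariance structure determined recursively by $$\mathbb{E}\,W_{a+1}W_{b+1}=\mathbb{E}\,f_a(W_a)f_b(W_b)\qquad\text{for all }0\le a,b\le k-1 .$$
   Context: Setting. Write $[n]=\{1,\dots,n\}$. For each $n$, $A_n=(a_{ij})_{i,j\in[n]}$ is a random symmetric matrix with $a_{ii}=0$ and $(a_{ij})_{i<j}$ i.i.d. standard Gaussian. $\|x\|:=(n^{-1}\sum_{i=1}^n x_i^2)^{1/2}$ for $x\in\mathbb{R}^n$. For each $n$, $u=u^n$ is a random vector in $\mathbb{R}^n$, independent of $A_n$, with $\|u^n\|\le 1$, and the empirical distribution of the coordinates of $u^n$ converges as $n\to\infty$ to the law of a random variable $W_0$ (i.e. $n^{-1}\sum_i\varphi(u^n_i)\to\mathbb{E}\varphi(W_0)$ in probability for every bounded continuous $\varphi$). $(f_k)_{k\ge0}$ is a sequence of bounded smooth functions on $\mathbb{R}$ with bounded derivatives of all orders. Cavity iteration. For $0\le k\le n-1$ let $[n]_k=\{S\subseteq[n]: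 |S|\le n-(k+1)\}$. For $S\in[n]_0$ set $w_{S,i}^{[0]}=u_i$ for $i\in[n]\setminus S$. For $0\le k\le n-2$ and $S\in[n]_{k+1}$ define iteratively $$w_{S,i}^{[k+1]}=\frac{1}{\sqrt n}\sum_{j\in[n]\setminus(S\cup\{i\})}a_{ij}f_k\bigl(w_{S\cup\{i\},j}^{[k]}\bigr),\qquad i\in[n]\setminus S.$$ For $S=\emptyset$ write $w^{[k]}=w^{[k]}_\emptyset\in\mathbb{R}^n$ and $w_i^{[k]}=w_{\emptyset,i}^{[k]}$. *)

theory Defs
  imports "HOL-Probability.Probability"
begin

text \<open>
  For a set \<open>S\<close> with at most \<open>n - (k + 1)\<close> elements and an index \<open>i\<close> in \<open>{1..n} - S\<close>,
  \<open>cavity f n a u k S i\<close> is the cavity iterate of order \<open>k\<close> with removed set \<open>S\<close>, for the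
  matrix \<open>a\<close> and the vector \<open>u\<close>. The recursion stays in this domain when started there;
  outside it the values of this total function carry no meaning.
\<close>

fun cavity :: "(nat \<Rightarrow> real \<Rightarrow> real) \<Rightarrow> nat \<Rightarrow> (nat \<Rightarrow> nat \<Rightarrow> real) \<Rightarrow> (nat \<Rightarrow> real)
    \<Rightarrow> nat \<Rightarrow> nat set \<Rightarrow> nat \<Rightarrow> real" where
  "cavity f n a u 0 S i = u i"
| "cavity f n a u (Suc k) S i =
     1 / sqrt (real n) *
       (\<Sum>j\<in>{1..n} - (S \<union> {i}). a i j * f k (cavity f n a u k (S \<union> {i}) j))"

definition bounded_smooth :: "(real \<Rightarrow> real) \<Rightarrow> bool" where
  "bounded_smooth g \<longleftrightarrow>
     (\<forall>m. (\<forall>x. (deriv ^^ m) g differentiable at x) \<and> bounded (range ((deriv ^^ m) g)))"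

text \<open>
  \<open>\<real>\<^sup>k\<^sup>+\<^sup>1\<close> is represented by the extensional functions on \<open>{..k}\<close>, and \<open>L2_set\<close> gives its
  Euclidean norm.
\<close>

definition bounded_Lipschitz :: "nat \<Rightarrow> ((nat \<Rightarrow> real) \<Rightarrow> real) \<Rightarrow> bool" where
  "bounded_Lipschitz k \<psi> \<longleftrightarrow>
     bounded (\<psi> ` ({..k} \<rightarrow>\<^sub>E UNIV)) \<and>
     (\<exists>L. \<forall>x \<in> {..k} \<rightarrow>\<^sub>E UNIV. \<forall>y \<in> {..k} \<rightarrow>\<^sub>E UNIV.
        \<bar>\<psi> x - \<psi> y\<bar> \<le> L * L2_set (\<lambda>a. x a - y a) {..k})"

text \<open>
  Convergence in probability to a constant. The variables \<open>X n\<close> may live on different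
  probability spaces.
\<close>

definition tendsto_in_prob :: "(nat \<Rightarrow> 'a measure) \<Rightarrow> (nat \<Rightarrow> 'a \<Rightarrow> real) \<Rightarrow> real \<Rightarrow> bool" where
  "tendsto_in_prob M X c \<longleftrightarrow>
     (\<forall>\<epsilon>>0. (\<lambda>n. measure (M n) {\<omega> \<in> space (M n). \<bar>X n \<omega> - c\<bar> > \<epsilon>}) \<longlonglongrightarrow> 0)"

text \<open>
  \<open>prob_space.indep_var\<close> requires both random variables to take values in the same type; here
  the types may differ.
\<close>

definition independent_rvs ::
    "'c measure \<Rightarrow> 'd measure \<Rightarrow> ('c \<Rightarrow> 'd) \<Rightarrow> 'e measure \<Rightarrow> ('c \<Rightarrow> 'e) \<Rightarrow> bool" where
  "independent_rvs P S X T Y \<longleftrightarrow>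
     X \<in> measurable P S \<and> Y \<in> measurable P T \<and>
     (\<forall>A \<in> sets S. \<forall>B \<in> sets T.
        measure P {\<omega> \<in> space P. X \<omega> \<in> A \<and> Y \<omega> \<in> B} =
        measure P {\<omega> \<in> space P. X \<omega> \<in> A} * measure P {\<omega> \<in> space P. Y \<omega> \<in> B})"

text \<open>The centered normal distributions include the degenerate one of variance 0.\<close>

definition centered_gaussian :: "'b measure \<Rightarrow> ('b \<Rightarrow> real) \<Rightarrow> bool" where
  "centered_gaussian N X \<longleftrightarrow>
     X \<in> borel_measurable N \<and>
     ((AE \<omega> in N. X \<omega> = 0) \<or> (\<exists>\<sigma>>0. distributed N lborel X (normal_density 0 \<sigma>)))"

definition jointly_centered_gaussian ::
    "'b measure \<Rightarrow> nat set \<Rightarrow> (nat \<Rightarrow> 'b \<Rightarrow> real) \<Rightarrow> bool" where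
  "jointly_centered_gaussian N I W \<longleftrightarrow>
     (\<forall>c :: nat \<Rightarrow> real. centered_gaussian N (\<lambda>\<omega>. \<Sum>a\<in>I. c a * W a \<omega>))"

end

theory Submission
  imports Defs
begin

text \<open>
  Since \<open>w\<^bsub>S\<union>{i},j\<^esub>\<close> does not depend on row \<open>i\<close> of the matrix, the
  vector \<open>(w\<^bsub>S,i\<^esub>\<^bsup>[1]\<^esup>, \<dots>, w\<^bsub>S,i\<^esub>\<^bsup>[m]\<^esup>)\<close> is centered Gaussian
  conditionally on the other rows, with the empirical covariances of the \<open>f\<^sub>a(w\<^bsub>S\<union>{i},j\<^esub>)\<close>;
  by induction on \<open>m\<close> these converge to the covariances of \<open>W\<close>. Integrating the row out turns
  \<open>cos (\<theta> + \<Sum>\<^sub>a t\<^sub>a w\<^bsub>S,i\<^esub>\<^bsup>[a]\<^esup>)\<close> into \<open>\<kappa> cos (\<theta> + t\<^sub>0 u\<^sub>i)\<close> up to a small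
  error, where \<open>\<kappa>\<close> is the Gaussian factor of the limit. The differences of the two are nearly
  uncorrelated for distinct \<open>i\<close> and \<open>l\<close>, because adding \<open>i\<close> to the removed set changes
  \<open>w\<^bsub>S,l\<^esub>\<close> only by \<open>O(n\<^bsup>-1/2\<^esup>)\<close> in \<open>L\<^sup>2\<close>. A second moment bound gives the law of large
  numbers for cosines, uniformly over removed sets of bounded size. Trigonometric sums approximate
  bounded Lipschitz functions up to an error controlled by second moments.
\<close>

section \<open>Approximation by trigonometric sums\<close>

text \<open>The iterates at different indices share the whole matrix, so an average over indices has
  no conditional independence to exploit; decorrelating a pair costs one more removed index. The
  variances met at one level therefore belong to removed sets one larger than those in the claim,
  which forces every limit to be asserted for all sizes of removed sets at once. Cosines with a free
  phase are the real form of characters. Integrating out a Gaussian summand multiplies such a cosine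
  by a number in [0,1] and leaves the phase alone, so the initial coordinate, whose law is
  arbitrary, can stay in the phase throughout. Limits are taken in mean, because the errors of
  successive replacements then simply add; probability returns at the end by Markov's inequality.
  The estimates live on a canonical product space, where each matrix entry is a coordinate of its
  own and Fubini can integrate it separately.\<close>

inductive_set trig_sums :: "nat \<Rightarrow> ((nat \<Rightarrow> real) \<Rightarrow> real) set" for m where
  wave: "(\<lambda>x. cos (\<theta> + (\<Sum>a\<le>m. t a * x a))) \<in> trig_sums m"
| add: "p \<in> trig_sums m \<Longrightarrow> q \<in> trig_sums m \<Longrightarrow> (\<lambda>x. p x + q x) \<in> trig_sums m"
| scale: "p \<in> trig_sums m \<Longrightarrow> (\<lambda>x. c * p x) \<in> trig_sums m"

lemma trig_sums_const: "(\<lambda>_. c) \<in> trig_sums m"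
  using trig_sums.scale[OF trig_sums.wave[of 0 "\<lambda>_. 0" m], of c] by simp

lemma trig_sums_coordinate:
  assumes "a \<le> m"
  shows "(\<lambda>x. cos (\<theta> + r * x a)) \<in> trig_sums m"
proof -
  have "(\<Sum>b\<le>m. (if b = a then r else 0) * x b) = r * x a" for x :: "nat \<Rightarrow> real"
    using assms by (simp add: if_distrib[of "\<lambda>z. z * _"] cong: if_cong)
  then show ?thesis
    using trig_sums.wave[of \<theta> "\<lambda>b. if b = a then r else 0" m] by simp
qed

text \<open>The product-to-sum formula settles two waves. Linearity in the second factor is this
  induction, linearity in the first the next one.\<close>

lemma trig_sums_mult_wave:
  assumes "q \<in> trig_sums m"
  shows "(\<lambda>x. cos (\<theta> + (\<Sum>a\<le>m. t a * x a)) * q x) \<in> trig_sums m"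
  using assms
proof induction
  case (wave \<theta>' t')
  have eq: "cos (\<theta> + (\<Sum>a\<le>m. t a * x a)) * cos (\<theta>' + (\<Sum>a\<le>m. t' a * x a)) =
     (1/2) * cos ((\<theta> - \<theta>') + (\<Sum>a\<le>m. (t a - t' a) * x a)) + (1/2) * cos ((\<theta> + \<theta>') + (\<Sum>a\<le>m. (t a + t' a) * x a))" for x
    unfolding cos_times_cos
    by (simp add: left_diff_distrib distrib_right sum_subtractf sum.distrib algebra_simps add_divide_distrib)
  show ?case unfolding eq
    by (intro trig_sums.intros)
next
  case (add p q)
  then show ?case using trig_sums.add by (simp add: distrib_left)
next
  case (scale p c)
  then show ?case using trig_sums.scale[of _ m c] by (simp add: mult.left_commute)
qed

lemma trig_sums_mult:
  assumes "p \<in> trig_sums m" "q \<in> trig_sums m"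
  shows "(\<lambda>x. p x * q x) \<in> trig_sums m"
  using assms(1)
proof induction
  case (wave \<theta> t)
  then show ?case using assms(2) by (rule trig_sums_mult_wave)
next
  case (add p q)
  then show ?case using trig_sums.add by (simp add: distrib_right)
next
  case (scale p c)
  then show ?case using trig_sums.scale[of _ m c] by (simp add: mult.assoc)
qed

lemma trig_sums_measurable:
  assumes "p \<in> trig_sums m"
  shows "p \<in> borel_measurable (\<Pi>\<^sub>M a\<in>{..m}. borel)"
  using assms
proof induction
  case (scale p c)
  show ?case by (intro borel_measurable_times[OF borel_measurable_const] scale.IH)
qed measurable

lemma trig_sums_bounded:
  assumes "p \<in> trig_sums m"
  shows "\<exists>B. \<forall>x. \<bar>p x\<bar> \<le> B"
  using assms
proof induction
  case (wave \<theta> t)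
  show ?case by (rule exI[of _ 1]) simp
next
  case (add p q)
  then show ?case by (meson abs_triangle_ineq add_mono order_trans)
next
  case (scale p c)
  then obtain B where "\<And>x. \<bar>p x\<bar> \<le> B" by auto
  then have "\<bar>c * p x\<bar> \<le> \<bar>c\<bar> * B" for x
    by (simp add: abs_mult mult_left_mono)
  then show ?case by blast
qed

text \<open>An extensional function has the fixed value \<open>undefined\<close> outside
  \<open>{..m}\<close>, so the cube is a full product over \<open>nat\<close> with singleton factors
  there, and Tychonoff's theorem applies.\<close>

lemma compact_cube: "compact ({..m} \<rightarrow>\<^sub>E {-1..1::real})"
proof -
  have eq: "({..m} \<rightarrow>\<^sub>E {-1..1::real}) = (\<Pi>\<^sub>E a\<in>UNIV. if a \<le> m then {-1..1} else {undefined})"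
    by (auto simp: PiE_def Pi_def extensional_def split: if_splits)
  show ?thesis
    unfolding eq compactin_euclidean_iff[symmetric] euclidean_product_topology[symmetric]
    by (subst compactin_PiE) auto
qed

lemma L2_set_tendsto_zero:
  assumes "\<And>a. a \<in> I \<Longrightarrow> ((\<lambda>s. g s a) \<longlongrightarrow> 0) F"
  shows "((\<lambda>s. L2_set (g s) I) \<longlongrightarrow> 0) F"
proof -
  have "((\<lambda>s. sqrt (\<Sum>a\<in>I. (g s a)\<^sup>2)) \<longlongrightarrow> sqrt (\<Sum>a\<in>I. 0\<^sup>2)) F"
    by (intro tendsto_intros assms)
  then show ?thesis by (simp add: L2_set_def)
qed

text \<open>
  The substitution \<open>s a = sin (x a / r)\<close> turns \<open>\<psi>\<close> on the box of radius \<open>r\<close> into a continuous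
  function of \<open>s\<close> on a cube. Stone-Weierstrass applied there gives an approximation that is
  uniform on the box and stays bounded outside of it.
\<close>

lemma trig_sums_approx_box:
  assumes psi: "bounded_Lipschitz m \<psi>" and r: "r > 0" and e: "e > 0"
  obtains p where "p \<in> trig_sums m"
    and "\<And>x. \<bar>\<psi> (\<lambda>a\<in>{..m}. r * arcsin (sin (x a / r))) - p x\<bar> < e"
proof -
  define S where "S = ({..m} \<rightarrow>\<^sub>E {-1..1::real})"
  define h where "h s = \<psi> (\<lambda>a\<in>{..m}. r * arcsin (s a))" for s
  define sn where "sn x = (\<lambda>a\<in>{..m}. sin (x a / r))" for x :: "nat \<Rightarrow> real"
  define R where "R = {g. continuous_on S g \<and> (\<lambda>x. g (sn x)) \<in> trig_sums m}"
  obtain L where L: "\<And>x y. x \<in> {..m} \<rightarrow>\<^sub>E UNIV \<Longrightarrow> y \<in> {..m} \<rightarrow>\<^sub>E UNIV \<Longrightarrow>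
      \<bar>\<psi> x - \<psi> y\<bar> \<le> L * L2_set (\<lambda>a. x a - y a) {..m}"
    using psi unfolding bounded_Lipschitz_def by blast
  have coord: "continuous_on S (\<lambda>s. s a)" for a
    by (rule continuous_on_subset[OF continuous_on_product_coordinates]) simp
  have cont: "continuous_on S h"
    unfolding continuous_on_def
  proof
    fix s assume s: "s \<in> S"
    have "((\<lambda>s'. L * L2_set (\<lambda>a. (\<lambda>a\<in>{..m}. r * arcsin (s' a)) a - (\<lambda>a\<in>{..m}. r * arcsin (s a)) a) {..m}) \<longlongrightarrow> 0) (at s within S)"
    proof (intro tendsto_mult_right_zero L2_set_tendsto_zero)
      fix a assume a: "a \<in> {..m}"
      have "continuous_on S (\<lambda>s. r * arcsin (s a))"
        using a by (intro continuous_intros coord) (auto simp: S_def PiE_def Pi_def)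
      then have "((\<lambda>s'. r * arcsin (s' a) - r * arcsin (s a)) \<longlongrightarrow> r * arcsin (s a) - r * arcsin (s a)) (at s within S)"
        using s unfolding continuous_on_def by (intro tendsto_diff tendsto_const) blast
      then show "((\<lambda>s'. (\<lambda>a\<in>{..m}. r * arcsin (s' a)) a - (\<lambda>a\<in>{..m}. r * arcsin (s a)) a) \<longlongrightarrow> 0) (at s within S)"
        using a by simp
    qed
    then have "((\<lambda>s'. h s' - h s) \<longlongrightarrow> 0) (at s within S)"
      by (rule Lim_null_comparison[rotated]) (simp add: h_def L del: restrict_apply)
    then show "(h \<longlongrightarrow> h s) (at s within S)"
      by (simp add: LIM_zero_iff)
  qed
  interpret function_ring_on R S
  proof
    show "compact S" unfolding S_def by (rule compact_cube)
    show "\<And>f. f \<in> R \<Longrightarrow> continuous_on S f" by (simp add: R_def)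
    show "\<And>f g. f \<in> R \<Longrightarrow> g \<in> R \<Longrightarrow> (\<lambda>x. f x + g x) \<in> R"
      by (auto simp: R_def intro: continuous_on_add trig_sums.add)
    show "\<And>f g. f \<in> R \<Longrightarrow> g \<in> R \<Longrightarrow> (\<lambda>x. f x * g x) \<in> R"
      by (auto simp: R_def intro: continuous_on_mult trig_sums_mult)
    show "\<And>c. (\<lambda>_. c) \<in> R"
      by (auto simp: R_def trig_sums_const)
    fix s s' assume ss: "s \<in> S" "s' \<in> S" "s \<noteq> s'"
    then obtain a where a: "a \<le> m" "s a \<noteq> s' a"
      unfolding S_def by (metis PiE_ext atMost_iff)
    \<comment> \<open>A sine is a cosine with phase -pi/2, so each coordinate of the cube pulls back
      to a wave; the coordinates separate points.\<close>
    have "(\<lambda>x. sn x a) = (\<lambda>x. cos (-(pi/2) + (1/r) * x a))"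
      using a by (simp add: sn_def cos_diff)
    then have "(\<lambda>s. s a) \<in> R"
      using coord[of a] trig_sums_coordinate[of a m "-(pi/2)" "1/r"] a by (simp add: R_def)
    then show "\<exists>f\<in>R. f s \<noteq> f s'" using a by (intro bexI[of _ "\<lambda>s. s a"])
  qed
  obtain g where g: "g \<in> R" "\<And>s. s \<in> S \<Longrightarrow> \<bar>h s - g s\<bar> < e"
    using Stone_Weierstrass_basic[OF cont e] by auto
  show ?thesis
  proof
    show "(\<lambda>x. g (sn x)) \<in> trig_sums m" using g by (simp add: R_def)
    fix x :: "nat \<Rightarrow> real"
    have "sn x \<in> S" by (auto simp: sn_def S_def)
    moreover have "h (sn x) = \<psi> (\<lambda>a\<in>{..m}. r * arcsin (sin (x a / r)))"
      unfolding h_def sn_def by (rule arg_cong[of _ _ \<psi>]) auto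
    ultimately show "\<bar>\<psi> (\<lambda>a\<in>{..m}. r * arcsin (sin (x a / r))) - g (sn x)\<bar> < e"
      using g(2) by metis
  qed
qed

text \<open>Inside the box of radius \<open>r\<close> the map
  \<open>r * arcsin (sin (x / r))\<close> is the identity, because \<open>1 \<le> pi / 2\<close>.
  Outside it all terms are bounded and the quadratic weight pays for the error. Degree two is
  affordable because the iterates have bounded second moments on average.\<close>

lemma bounded_Lipschitz_trig_approx:
  assumes psi: "bounded_Lipschitz m \<psi>" and e: "e > 0"
  obtains p where "p \<in> trig_sums m"
    and "\<And>x. \<bar>\<psi> (restrict x {..m}) - p x\<bar> \<le> e * (1 + (\<Sum>a\<le>m. (x a)\<^sup>2))"
proof -
  obtain B where B: "\<And>x. x \<in> {..m} \<rightarrow>\<^sub>E UNIV \<Longrightarrow> \<bar>\<psi> x\<bar> \<le> B"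
    using psi unfolding bounded_Lipschitz_def bounded_iff by auto
  have B0: "B \<ge> 0" using B[of "\<lambda>a\<in>{..m}. 0"] by (auto intro: order_trans[OF abs_ge_zero])
  \<comment> \<open>Chosen so that \<open>e * r\<^sup>2 = 2 * B + e\<close>, the trivial bound for
    the error off the box: \<open>B\<close> for each of two values of \<open>\<psi>\<close> and
    \<open>e\<close> for the approximation.\<close>
  define r where "r = sqrt ((2 * B + e) / e)"
  have r: "r > 0" "r\<^sup>2 = (2 * B + e) / e"
    using e B0 by (auto simp: r_def)
  obtain p where p: "p \<in> trig_sums m"
    and pe: "\<And>x. \<bar>\<psi> (\<lambda>a\<in>{..m}. r * arcsin (sin (x a / r))) - p x\<bar> < e"
    using trig_sums_approx_box[OF psi r(1) e] by metis
  show ?thesis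
  proof
    show "p \<in> trig_sums m" by fact
    fix x :: "nat \<Rightarrow> real"
    show "\<bar>\<psi> (restrict x {..m}) - p x\<bar> \<le> e * (1 + (\<Sum>a\<le>m. (x a)\<^sup>2))"
    proof (cases "\<forall>a\<le>m. \<bar>x a\<bar> \<le> r")
      case True
      have "r * arcsin (sin (x a / r)) = x a" if "a \<le> m" for a
      proof -
        have "\<bar>x a / r\<bar> \<le> 1" using True that r by (simp add: divide_simps)
        then have "\<bar>x a / r\<bar> \<le> pi / 2" using pi_ge_two by linarith
        then have "arcsin (sin (x a / r)) = x a / r" by (intro arcsin_sin) linarith+
        then show ?thesis using r by simp
      qed
      then have "(\<lambda>a\<in>{..m}. r * arcsin (sin (x a / r))) = restrict x {..m}"
        by (auto simp: restrict_def)
      then have "\<bar>\<psi> (restrict x {..m}) - p x\<bar> \<le> e" using pe[of x] by simp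
      also have "\<dots> \<le> e * (1 + (\<Sum>a\<le>m. (x a)\<^sup>2))" using e by (simp add: sum_nonneg)
      finally show ?thesis .
    next
      case False
      then obtain a where a: "a \<le> m" "\<bar>x a\<bar> > r" by auto
      have "r\<^sup>2 \<le> \<bar>x a\<bar>\<^sup>2" using a r by (intro power_mono) auto
      also have "\<dots> \<le> (\<Sum>a\<le>m. (x a)\<^sup>2)"
        using a by (simp add: member_le_sum[of a "{..m}" "\<lambda>a. (x a)\<^sup>2"])
      finally have "2 * B + e \<le> e * (\<Sum>a\<le>m. (x a)\<^sup>2)"
        using r e by (simp add: field_simps)
      moreover have "\<bar>\<psi> (restrict x {..m})\<bar> \<le> B" "\<bar>\<psi> (\<lambda>a\<in>{..m}. r * arcsin (sin (x a / r)))\<bar> \<le> B"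
        by (intro B restrict_PiE; simp)+
      ultimately show ?thesis using pe[of x] e by (simp add: distrib_left)
    qed
  qed
qed

text \<open>The approximations with \<open>e = 1 / (j + 1)\<close> converge pointwise, and each is
  measurable for the product sigma-algebra.\<close>

lemma bounded_Lipschitz_measurable:
  assumes psi: "bounded_Lipschitz m \<psi>"
  shows "\<psi> \<in> borel_measurable (\<Pi>\<^sub>M a\<in>{..m}. borel)"
proof -
  have "\<exists>p. p \<in> trig_sums m \<and>
      (\<forall>x. \<bar>\<psi> (restrict x {..m}) - p x\<bar> \<le> inverse (real (Suc j)) * (1 + (\<Sum>a\<le>m. (x a)\<^sup>2)))" for j
    by (rule bounded_Lipschitz_trig_approx[OF psi, of "inverse (real (Suc j))"]) auto
  then obtain p where p: "\<And>j. p j \<in> trig_sums m"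
    "\<And>j x. \<bar>\<psi> (restrict x {..m}) - p j x\<bar> \<le> inverse (real (Suc j)) * (1 + (\<Sum>a\<le>m. (x a)\<^sup>2))"
    by metis
  show ?thesis
  proof (rule borel_measurable_LIMSEQ_real)
    show "p j \<in> borel_measurable (\<Pi>\<^sub>M a\<in>{..m}. borel)" for j
      by (rule trig_sums_measurable[OF p(1)])
    fix x :: "nat \<Rightarrow> real" assume "x \<in> space (\<Pi>\<^sub>M a\<in>{..m}. borel)"
    then have x: "restrict x {..m} = x" by (simp add: space_PiM PiE_restrict)
    have "(\<lambda>j. inverse (real (Suc j)) * (1 + (\<Sum>a\<le>m. (x a)\<^sup>2))) \<longlonglongrightarrow> 0"
      by (intro tendsto_mult_left_zero LIMSEQ_inverse_real_of_nat)
    then have "(\<lambda>j. \<psi> x - p j x) \<longlonglongrightarrow> 0"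
      by (rule Lim_null_comparison[rotated]) (use p(2)[of x] x in auto)
    then have "(\<lambda>j. \<psi> x - (\<psi> x - p j x)) \<longlonglongrightarrow> \<psi> x - 0"
      by (intro tendsto_intros)
    then show "(\<lambda>j. p j x) \<longlonglongrightarrow> \<psi> x" by simp
  qed
qed

section \<open>Integrating out Gaussian entries\<close>

definition edges :: "nat \<Rightarrow> (nat \<times> nat) set" where
  "edges n = {(i, j). 1 \<le> i \<and> i < j \<and> j \<le> n}"

definition edge :: "nat \<Rightarrow> nat \<Rightarrow> nat \<times> nat" where
  "edge i j = (min i j, max i j)"

text \<open>The sample space has one coordinate for each unordered pair, so entries can be redrawn
  freely: changing one coordinate changes the matrix in both symmetric places.\<close>

definition sym_mat :: "(nat \<times> nat \<Rightarrow> real) \<Rightarrow> nat \<Rightarrow> nat \<Rightarrow> real" where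
  "sym_mat a i j = (if i = j then 0 else a (edge i j))"

definition data_law :: "nat \<Rightarrow> (nat \<Rightarrow> real) measure \<Rightarrow> ((nat \<times> nat \<Rightarrow> real) \<times> (nat \<Rightarrow> real)) measure" where
  "data_law n \<mu> = (\<Pi>\<^sub>M p\<in>edges n. std_normal_distribution) \<Otimes>\<^sub>M \<mu>"

text \<open>Independence of row and column \<open>i\<close>, phrased by single-entry updates so that
  it applies while entries are integrated out one at a time.\<close>

definition row_free :: "nat \<Rightarrow> ((nat \<times> nat \<Rightarrow> real) \<times> (nat \<Rightarrow> real) \<Rightarrow> 'c) \<Rightarrow> bool" where
  "row_free i G \<longleftrightarrow> (\<forall>a x j r. j \<noteq> i \<longrightarrow> G (a(edge i j := r), x) = G (a, x))"

lemma finite_edges: "finite (edges n)"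
  by (rule finite_subset[of _ "{1..n} \<times> {1..n}"]) (auto simp: edges_def)

lemma edge_in_edges: "i \<in> {1..n} \<Longrightarrow> j \<in> {1..n} \<Longrightarrow> i \<noteq> j \<Longrightarrow> edge i j \<in> edges n"
  by (auto simp: edges_def edge_def)

lemma edge_eq_iff: "edge i j = edge p q \<longleftrightarrow> (i = p \<and> j = q) \<or> (i = q \<and> j = p)"
  by (auto simp: edge_def min_def max_def)

lemma sym_mat_update_other:
  "edge p q \<noteq> edge i j \<Longrightarrow> sym_mat (a(edge i j := r)) p q = sym_mat a p q"
  by (simp add: sym_mat_def)

lemma prob_space_std_normal: "prob_space std_normal_distribution"
  by (rule prob_space_normal_density) simp

text \<open>The characteristic function of the standard normal law is real, so the sine term of the
  addition formula drops out and the phase \<open>\<alpha>\<close> survives.\<close>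

lemma integral_cos_std_normal:
  "(\<integral>r. cos (\<alpha> + r * y) \<partial>std_normal_distribution) = cos \<alpha> * exp (- (y\<^sup>2 / 2))"
proof -
  interpret prob_space std_normal_distribution by (rule prob_space_std_normal)
  have int: "integrable std_normal_distribution (\<lambda>r. iexp (y * r))"
    by (intro integrable_const_bound[of _ 1]) auto
  have ch: "(CLINT r|std_normal_distribution. iexp (y * r)) = complex_of_real (exp (- (y\<^sup>2) / 2))"
    using char_std_normal_distribution unfolding char_def by (auto dest: fun_cong[of _ _ y])
  have re: "(\<integral>r. cos (y * r) \<partial>std_normal_distribution) = exp (- (y\<^sup>2) / 2)"
    using integral_Re[OF int] unfolding ch by (simp add: Re_exp)
  have im: "(\<integral>r. sin (y * r) \<partial>std_normal_distribution) = 0"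
    using integral_Im[OF int] unfolding ch by (simp add: Im_exp)
  have i1: "integrable std_normal_distribution (\<lambda>r. cos (y * r))"
    and i2: "integrable std_normal_distribution (\<lambda>r. sin (y * r))"
    by (intro integrable_const_bound[of _ 1]; simp)+
  have "(\<integral>r. cos (\<alpha> + r * y) \<partial>std_normal_distribution) =
      (\<integral>r. cos \<alpha> * cos (y * r) - sin \<alpha> * sin (y * r) \<partial>std_normal_distribution)"
    by (simp add: cos_add mult.commute)
  also have "\<dots> = cos \<alpha> * exp (- (y\<^sup>2) / 2) - sin \<alpha> * 0"
    using i1 i2 by (simp add: re im)
  finally show ?thesis by simp
qed

text \<open>The cross term has mean 0. The nonnegative integral spares integrability conditions when
  this is iterated over a row.\<close>

lemma nn_integral_affine_sq_std_normal:
  "(\<integral>\<^sup>+r. ennreal ((\<alpha> + r * y)\<^sup>2) \<partial>std_normal_distribution) = ennreal (\<alpha>\<^sup>2 + y\<^sup>2)"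
proof -
  interpret prob_space std_normal_distribution by (rule prob_space_std_normal)
  have i1: "integrable std_normal_distribution (\<lambda>r. r)"
    using integrable_std_normal_distribution_moment[of 1] by simp
  have i2: "integrable std_normal_distribution (\<lambda>r. r\<^sup>2)"
    using integrable_std_normal_distribution_moment[of 2] by simp
  have m1: "(\<integral>r. r \<partial>std_normal_distribution) = 0"
    using integral_std_normal_distribution_moment_odd[of 1] by simp
  have m2: "(\<integral>r. r\<^sup>2 \<partial>std_normal_distribution) = 1"
    using std_normal_distribution_even_moments(1)[of 1] by (simp add: fact_numeral)
  have eq: "(\<lambda>r. (\<alpha> + r * y)\<^sup>2) = (\<lambda>r. \<alpha>\<^sup>2 + (2 * \<alpha> * y * r + y\<^sup>2 * r\<^sup>2))"
    by (auto simp: power2_eq_square algebra_simps)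
  have "integrable std_normal_distribution (\<lambda>r. (\<alpha> + r * y)\<^sup>2)"
    unfolding eq using i1 i2 by simp
  then have "(\<integral>\<^sup>+r. ennreal ((\<alpha> + r * y)\<^sup>2) \<partial>std_normal_distribution) =
     ennreal (\<integral>r. (\<alpha> + r * y)\<^sup>2 \<partial>std_normal_distribution)"
    by (rule nn_integral_eq_integral) simp
  also have "(\<integral>r. (\<alpha> + r * y)\<^sup>2 \<partial>std_normal_distribution) = \<alpha>\<^sup>2 + y\<^sup>2"
    unfolding eq using i1 i2 prob_space by (simp add: m1 m2)
  finally show ?thesis .
qed

section \<open>Resampling of matrix entries on the canonical space\<close>

locale data_space =
  fixes n :: nat and \<mu> :: "(nat \<Rightarrow> real) measure"
  assumes prob_mu: "prob_space \<mu>"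
    and sets_mu: "sets \<mu> = sets (\<Pi>\<^sub>M i\<in>{1..n}. borel)"
    and second_moment_mu: "(\<integral>\<^sup>+x. ennreal (\<Sum>i=1..n. (x i)\<^sup>2) \<partial>\<mu>) \<le> ennreal (real n)"
begin

abbreviation "D \<equiv> data_law n \<mu>"

sublocale prob_space D
proof -
  show "prob_space D" unfolding data_law_def
    by (intro prob_space_pair prob_space_PiM prob_space_std_normal prob_mu)
qed

lemma sets_D: "sets D = sets ((\<Pi>\<^sub>M p\<in>edges n. borel) \<Otimes>\<^sub>M (\<Pi>\<^sub>M i\<in>{1..n}. borel))"
  unfolding data_law_def by (intro sets_pair_measure_cong sets_mu sets_PiM_cong) auto

lemma measurable_D: "measurable D M' = measurable ((\<Pi>\<^sub>M p\<in>edges n. borel) \<Otimes>\<^sub>M (\<Pi>\<^sub>M i\<in>{1..n}. borel)) M'"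
  by (rule measurable_cong_sets[OF sets_D refl])

lemma entry_measurable:
  "i \<in> {1..n} \<Longrightarrow> j \<in> {1..n} \<Longrightarrow> (\<lambda>d. sym_mat (fst d) i j) \<in> borel_measurable D"
  unfolding measurable_D sym_mat_def
  by (cases "i = j") (auto intro!: measurable_compose[OF measurable_fst] measurable_component_singleton edge_in_edges)

lemma coord_measurable:
  "i \<in> {1..n} \<Longrightarrow> (\<lambda>d. snd d i) \<in> borel_measurable D"
  unfolding measurable_D
  by (auto intro!: measurable_compose[OF measurable_snd] measurable_component_singleton)

lemma resample_measurable:
  assumes p: "p \<in> edges n"
  shows "(\<lambda>(d, r). ((fst d)(p := r), snd d)) \<in> measurable (D \<Otimes>\<^sub>M std_normal_distribution) D"
proof -
  have "sets (D \<Otimes>\<^sub>M std_normal_distribution) =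
      sets (((\<Pi>\<^sub>M p\<in>edges n. borel) \<Otimes>\<^sub>M (\<Pi>\<^sub>M i\<in>{1..n}. borel)) \<Otimes>\<^sub>M (borel :: real measure))"
    by (intro sets_pair_measure_cong sets_D) simp
  moreover have "(\<lambda>(d, r). ((fst d)(p := r), snd d)) \<in> measurable
     (((\<Pi>\<^sub>M p\<in>edges n. borel) \<Otimes>\<^sub>M (\<Pi>\<^sub>M i\<in>{1..n}. borel)) \<Otimes>\<^sub>M (borel :: real measure))
     ((\<Pi>\<^sub>M p\<in>edges n. borel) \<Otimes>\<^sub>M (\<Pi>\<^sub>M i\<in>{1..n}. borel))"
    unfolding split_beta'
  proof (intro measurable_Pair)
    show "(\<lambda>x. (fst (fst x))(p := snd x)) \<in> measurable
      (((\<Pi>\<^sub>M p\<in>edges n. borel) \<Otimes>\<^sub>M (\<Pi>\<^sub>M i\<in>{1..n}. borel)) \<Otimes>\<^sub>M (borel :: real measure)) (\<Pi>\<^sub>M p\<in>edges n. borel)"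
      by (rule measurable_fun_upd[of "edges n" "edges n" p]) (use p in auto)
  qed measurable
  ultimately show ?thesis
    using measurable_cong_sets[of "D \<Otimes>\<^sub>M std_normal_distribution" _ D, OF _ sets_D] by blast
qed

text \<open>Fubini for the single coordinate \<open>p\<close> of the product measure: redrawing one
  entry leaves the law unchanged.\<close>

lemma nn_integral_resample:
  assumes p: "p \<in> edges n" and G: "G \<in> borel_measurable D"
  shows "(\<integral>\<^sup>+d. G d \<partial>D) = (\<integral>\<^sup>+d. (\<integral>\<^sup>+r. G ((fst d)(p := r), snd d) \<partial>std_normal_distribution) \<partial>D)"
proof -
  interpret m: prob_space \<mu> by (rule prob_mu)
  interpret N: prob_space std_normal_distribution by (rule prob_space_std_normal)
  interpret p: product_prob_space "\<lambda>_ :: nat \<times> nat. std_normal_distribution" "edges n"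
    by (intro product_prob_spaceI prob_space_std_normal)
  let ?N = std_normal_distribution
  let ?P = "\<lambda>I. \<Pi>\<^sub>M p\<in>I. ?N"
  interpret pp: pair_prob_space "?P (edges n)" \<mu> ..
  define I where "I = edges n - {p}"
  have I: "edges n = insert p I" "p \<notin> I" "finite I"
    using p finite_edges by (auto simp: I_def)
  define H where "H d = (\<integral>\<^sup>+r. G ((fst d)(p := r), snd d) \<partial>?N)" for d
  have "(\<lambda>x. G (case x of (d, r) \<Rightarrow> ((fst d)(p := r), snd d))) \<in> borel_measurable (D \<Otimes>\<^sub>M ?N)"
    by (rule measurable_compose[OF resample_measurable[OF p] G])
  then have H: "H \<in> borel_measurable D"
    unfolding H_def
    using N.borel_measurable_nn_integral[of "\<lambda>d r. G ((fst d)(p := r), snd d)" D]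
    by (simp add: split_beta')
  have GP: "G \<in> borel_measurable (?P (edges n) \<Otimes>\<^sub>M \<mu>)" and HP: "H \<in> borel_measurable (?P (edges n) \<Otimes>\<^sub>M \<mu>)"
    using G H by (simp_all add: data_law_def)
  \<comment> \<open>\<open>H\<close> does not depend on coordinate \<open>p\<close>, so integrating
    it over that coordinate only multiplies by the total mass 1. Splitting off \<open>p\<close>
    makes both sides the same integral over \<open>I\<close>.\<close>
  have inner: "(\<integral>\<^sup>+a. G (a, x) \<partial>?P (edges n)) = (\<integral>\<^sup>+a. H (a, x) \<partial>?P (edges n))" if x: "x \<in> space \<mu>" for x
  proof -
    have "(\<lambda>a. G (a, x)) \<in> borel_measurable (?P (insert p I))" "(\<lambda>a. H (a, x)) \<in> borel_measurable (?P (insert p I))"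
      using x GP HP I(1) by simp_all
    then show ?thesis
      unfolding I(1) using I(2,3)
      by (simp add: p.product_nn_integral_insert H_def N.emeasure_space_1[simplified])
  qed
  have "(\<integral>\<^sup>+d. G d \<partial>D) = (\<integral>\<^sup>+x. \<integral>\<^sup>+a. G (a, x) \<partial>?P (edges n) \<partial>\<mu>)"
    unfolding data_law_def by (rule pp.nn_integral_snd[OF GP, symmetric])
  also have "\<dots> = (\<integral>\<^sup>+x. \<integral>\<^sup>+a. H (a, x) \<partial>?P (edges n) \<partial>\<mu>)"
    by (intro nn_integral_cong inner)
  also have "\<dots> = (\<integral>\<^sup>+d. H d \<partial>D)"
    unfolding data_law_def by (rule pp.nn_integral_snd[OF HP])
  finally show ?thesis by (simp add: H_def)
qed

text \<open>Applied to indicators, the nonnegative version says that the resampling map carries the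
  product of \<open>D\<close> with a standard normal law to \<open>D\<close>. Change of variables
  and Fubini then cover bounded real functions.\<close>

lemma integral_resample:
  fixes G :: "_ \<Rightarrow> real"
  assumes p: "p \<in> edges n" and G: "G \<in> borel_measurable D" and B: "\<And>d. \<bar>G d\<bar> \<le> B"
  shows "(\<integral>d. G d \<partial>D) = (\<integral>d. (\<integral>r. G ((fst d)(p := r), snd d) \<partial>std_normal_distribution) \<partial>D)"
proof -
  let ?N = std_normal_distribution
  interpret N: prob_space ?N by (rule prob_space_std_normal)
  interpret DN: pair_prob_space D ?N ..
  let ?T = "\<lambda>(d, r). ((fst d)(p := r), snd d)"
  have T: "distr (D \<Otimes>\<^sub>M ?N) D ?T = D"
  proof (rule measure_eqI)
    fix A assume "A \<in> sets (distr (D \<Otimes>\<^sub>M ?N) D ?T)"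
    then have A: "A \<in> sets D" by simp
    have m: "(\<lambda>x. indicator A (?T x) :: ennreal) \<in> borel_measurable (D \<Otimes>\<^sub>M ?N)"
      using A by (intro measurable_compose[OF resample_measurable[OF p]]) auto
    have "emeasure (distr (D \<Otimes>\<^sub>M ?N) D ?T) A = (\<integral>\<^sup>+d. indicator A d \<partial>distr (D \<Otimes>\<^sub>M ?N) D ?T)"
      using A by simp
    also have "\<dots> = (\<integral>\<^sup>+x. indicator A (?T x) \<partial>(D \<Otimes>\<^sub>M ?N))"
      using A by (intro nn_integral_distr resample_measurable p) auto
    also have "\<dots> = (\<integral>\<^sup>+d. \<integral>\<^sup>+r. indicator A (?T (d, r)) \<partial>?N \<partial>D)"
      by (rule N.nn_integral_fst[OF m, symmetric])
    also have "\<dots> = (\<integral>\<^sup>+d. indicator A d \<partial>D)"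
      using nn_integral_resample[OF p, of "indicator A"] A by simp
    finally show "emeasure (distr (D \<Otimes>\<^sub>M ?N) D ?T) A = emeasure D A"
      using A by simp
  qed simp
  have int: "integrable (D \<Otimes>\<^sub>M ?N) (\<lambda>x. G (?T x))"
    by (intro DN.integrable_const_bound[of _ B] measurable_compose[OF resample_measurable[OF p] G]) (simp add: B)
  have "(\<integral>d. G d \<partial>D) = (\<integral>d. G d \<partial>distr (D \<Otimes>\<^sub>M ?N) D ?T)" by (simp add: T)
  also have "\<dots> = (\<integral>x. G (?T x) \<partial>(D \<Otimes>\<^sub>M ?N))"
    by (rule integral_distr[OF resample_measurable[OF p] G])
  also have "\<dots> = (\<integral>d. (\<integral>r. G (?T (d, r)) \<partial>?N) \<partial>D)"
    by (rule DN.integral_fst'[OF int, symmetric])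
  finally show ?thesis by simp
qed

lemma expectation_cos_entry:
  fixes \<alpha> Y Z :: "_ \<Rightarrow> real"
  assumes p: "p \<in> edges n"
    and m: "\<alpha> \<in> borel_measurable D" "Y \<in> borel_measurable D" "Z \<in> borel_measurable D"
    and B: "\<And>d. \<bar>Z d\<bar> \<le> B"
    and free: "\<And>a x r. \<alpha> (a(p := r), x) = \<alpha> (a, x)" "\<And>a x r. Y (a(p := r), x) = Y (a, x)"
      "\<And>a x r. Z (a(p := r), x) = Z (a, x)"
  shows "(\<integral>d. cos (\<alpha> d + fst d p * Y d) * Z d \<partial>D) = (\<integral>d. cos (\<alpha> d) * (exp (- ((Y d)\<^sup>2 / 2)) * Z d) \<partial>D)"
proof -
  note [measurable] = m
  have [measurable]: "(\<lambda>d. fst d p) \<in> borel_measurable D"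
    unfolding measurable_D using p
    by (auto intro!: measurable_compose[OF measurable_fst] measurable_component_singleton)
  have bd: "\<bar>cos (\<alpha> d + fst d p * Y d) * Z d\<bar> \<le> 1 * B" for d
    unfolding abs_mult by (intro mult_mono B) auto
  have "(\<integral>d. cos (\<alpha> d + fst d p * Y d) * Z d \<partial>D) =
     (\<integral>d. (\<integral>r. cos (\<alpha> d + r * Y d) * Z d \<partial>std_normal_distribution) \<partial>D)"
    by (subst integral_resample[OF p _ bd]) (simp_all add: free)
  also have "\<dots> = (\<integral>d. cos (\<alpha> d) * (exp (- ((Y d)\<^sup>2 / 2)) * Z d) \<partial>D)"
    by (simp add: integral_cos_std_normal mult.assoc)
  finally show ?thesis .
qed

lemma row_freeD: "row_free i G \<Longrightarrow> j \<noteq> i \<Longrightarrow> G (a(edge i j := r), x) = G (a, x)"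
  by (auto simp: row_free_def)

text \<open>Each entry of row \<open>i\<close> integrates to a factor
  \<open>exp (- (Y j d)\<^sup>2 / 2)\<close>. The bounded multiplier \<open>Z\<close> stores these
  factors during the induction, and later holds the cosine at another index when correlations are
  computed.\<close>

lemma expectation_cos_row:
  fixes \<alpha> Z :: "_ \<Rightarrow> real" and Y :: "nat \<Rightarrow> _ \<Rightarrow> real"
  assumes i: "i \<in> {1..n}" and J: "finite J" "J \<subseteq> {1..n} - {i}"
    and m: "\<alpha> \<in> borel_measurable D" "\<And>j. j \<in> J \<Longrightarrow> Y j \<in> borel_measurable D" "Z \<in> borel_measurable D"
    and B: "\<And>d. \<bar>Z d\<bar> \<le> B"
    and free: "row_free i \<alpha>" "\<And>j. j \<in> J \<Longrightarrow> row_free i (Y j)" "row_free i Z"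
  shows "(\<integral>d. cos (\<alpha> d + (\<Sum>j\<in>J. sym_mat (fst d) i j * Y j d)) * Z d \<partial>D) =
    (\<integral>d. cos (\<alpha> d) * (exp (- (\<Sum>j\<in>J. (Y j d)\<^sup>2) / 2) * Z d) \<partial>D)"
  using J m B free
proof (induction J arbitrary: Z rule: finite_induct)
  case empty
  then show ?case by simp
next
  case (insert l J)
  have l: "l \<in> {1..n}" "l \<noteq> i" using insert.prems by auto
  note [measurable] = entry_measurable coord_measurable insert.prems
  \<comment> \<open>The factor from entry \<open>l\<close> moves into the multiplier. It is at most
    1 and free of row \<open>i\<close>, so \<open>Z'\<close> meets the conditions on
    \<open>Z\<close>.\<close>
  define Z' where "Z' d = exp (- ((Y l d)\<^sup>2 / 2)) * Z d" for d
  have Z': "row_free i Z'"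
    using insert.prems(7)[of l] insert.prems(8) unfolding row_free_def Z'_def by simp
  have Zb: "\<bar>Z' d\<bar> \<le> B" for d
  proof -
    have "\<bar>Z' d\<bar> \<le> 1 * \<bar>Z d\<bar>"
      unfolding Z'_def abs_mult by (intro mult_right_mono) auto
    then show ?thesis using insert.prems(5)[of d] by simp
  qed
  define \<alpha>' where "\<alpha>' d = \<alpha> d + (\<Sum>j\<in>J. sym_mat (fst d) i j * Y j d)" for d
  have sm: "sym_mat (fst d) i l = fst d (edge i l)" for d using l by (simp add: sym_mat_def)
  have m2: "(\<lambda>d. \<Sum>j\<in>J. sym_mat (fst d) i j * Y j d) \<in> borel_measurable D"
    using insert.prems i by (intro borel_measurable_sum borel_measurable_times entry_measurable) auto
  have "(\<integral>d. cos (\<alpha> d + (\<Sum>j\<in>insert l J. sym_mat (fst d) i j * Y j d)) * Z d \<partial>D) =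
      (\<integral>d. cos (\<alpha>' d + fst d (edge i l) * Y l d) * Z d \<partial>D)"
    using insert.hyps by (simp add: \<alpha>'_def sm algebra_simps)
  also have "\<dots> = (\<integral>d. cos (\<alpha>' d) * (exp (- ((Y l d)\<^sup>2 / 2)) * Z d) \<partial>D)"
  proof (rule expectation_cos_entry)
    show "edge i l \<in> edges n" using i l by (intro edge_in_edges) auto
    show "\<alpha>' \<in> borel_measurable D" unfolding \<alpha>'_def using m2 insert.prems by measurable
    show "Y l \<in> borel_measurable D" "Z \<in> borel_measurable D" "\<And>d. \<bar>Z d\<bar> \<le> B" using insert.prems by auto
    fix a x r
    have "sym_mat (a(edge i l := r)) i j = sym_mat a i j" if "j \<in> J" for j
      by (rule sym_mat_update_other) (use that insert.hyps l in \<open>auto simp: edge_eq_iff\<close>)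
    then show "\<alpha>' (a(edge i l := r), x) = \<alpha>' (a, x)"
      using insert.prems(6,7) l unfolding \<alpha>'_def by (simp add: row_free_def cong: sum.cong)
    show "Y l (a(edge i l := r), x) = Y l (a, x)" "Z (a(edge i l := r), x) = Z (a, x)"
      using insert.prems l by (auto intro: row_freeD)
  qed
  also have "\<dots> = (\<integral>d. cos (\<alpha> d + (\<Sum>j\<in>J. sym_mat (fst d) i j * Y j d)) * Z' d \<partial>D)"
    by (simp add: \<alpha>'_def Z'_def)
  also have "\<dots> = (\<integral>d. cos (\<alpha> d) * (exp (- (\<Sum>j\<in>J. (Y j d)\<^sup>2) / 2) * Z' d) \<partial>D)"
  proof (rule insert.IH)
    show "Z' \<in> borel_measurable D" unfolding Z'_def using insert.prems by measurable
  qed (use insert.prems Z' Zb in auto)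
  also have "\<dots> = (\<integral>d. cos (\<alpha> d) * (exp (- (\<Sum>j\<in>insert l J. (Y j d)\<^sup>2) / 2) * Z d) \<partial>D)"
  proof (intro Bochner_Integration.integral_cong refl)
    fix d
    have "- (\<Sum>j\<in>insert l J. (Y j d)\<^sup>2) / 2 = - (\<Sum>j\<in>J. (Y j d)\<^sup>2) / 2 + - ((Y l d)\<^sup>2 / 2)"
      using insert.hyps by (simp add: add_divide_distrib)
    then show "cos (\<alpha> d) * (exp (- (\<Sum>j\<in>J. (Y j d)\<^sup>2) / 2) * Z' d) =
        cos (\<alpha> d) * (exp (- (\<Sum>j\<in>insert l J. (Y j d)\<^sup>2) / 2) * Z d)"
      by (simp only: Z'_def exp_add mult.assoc)
  qed
  finally show ?case .
qed

text \<open>The entries of the row are centered with variance 1, independent of each other and of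
  the coefficients; peeling them off one at a time leaves the sum of squares.\<close>

lemma nn_integral_row_sq:
  fixes Y :: "nat \<Rightarrow> _ \<Rightarrow> real"
  assumes i: "i \<in> {1..n}" and J: "finite J" "J \<subseteq> {1..n} - {i}"
    and m: "\<And>j. j \<in> J \<Longrightarrow> Y j \<in> borel_measurable D"
    and free: "\<And>j. j \<in> J \<Longrightarrow> row_free i (Y j)"
  shows "(\<integral>\<^sup>+d. ennreal ((\<Sum>j\<in>J. sym_mat (fst d) i j * Y j d)\<^sup>2) \<partial>D) =
    (\<integral>\<^sup>+d. ennreal (\<Sum>j\<in>J. (Y j d)\<^sup>2) \<partial>D)"
  using J m free
proof (induction J rule: finite_induct)
  case empty
  then show ?case by simp
next
  case (insert l J)
  have l: "l \<in> {1..n}" "l \<noteq> i" using insert.prems by auto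
  have p: "edge i l \<in> edges n" using i l by (intro edge_in_edges) auto
  define \<alpha> where "\<alpha> d = (\<Sum>j\<in>J. sym_mat (fst d) i j * Y j d)" for d
  have [measurable]: "\<alpha> \<in> borel_measurable D" unfolding \<alpha>_def
    using insert.prems i by (intro borel_measurable_sum borel_measurable_times entry_measurable) auto
  have [measurable]: "Y l \<in> borel_measurable D" using insert.prems by simp
  have [measurable]: "(\<lambda>d. fst d (edge i l)) \<in> borel_measurable D"
    using entry_measurable[OF i l(1)] l by (simp add: sym_mat_def)
  have [measurable]: "(\<lambda>d. \<Sum>j\<in>J. (Y j d)\<^sup>2) \<in> borel_measurable D"
    using insert.prems by (intro borel_measurable_sum borel_measurable_power) auto
  have af: "\<alpha> (a(edge i l := r), x) = \<alpha> (a, x)" for a x r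
  proof -
    have "sym_mat (a(edge i l := r)) i j = sym_mat a i j" if "j \<in> J" for j
      by (rule sym_mat_update_other) (use that insert.hyps l in \<open>auto simp: edge_eq_iff\<close>)
    then show ?thesis
      using insert.prems(3) l unfolding \<alpha>_def by (simp add: row_free_def cong: sum.cong)
  qed
  have yf: "Y l (a(edge i l := r), x) = Y l (a, x)" for a x r
    using insert.prems l by (auto intro: row_freeD)
  have "(\<integral>\<^sup>+d. ennreal ((\<Sum>j\<in>insert l J. sym_mat (fst d) i j * Y j d)\<^sup>2) \<partial>D) =
      (\<integral>\<^sup>+d. ennreal ((\<alpha> d + fst d (edge i l) * Y l d)\<^sup>2) \<partial>D)"
    using insert.hyps l by (simp add: \<alpha>_def sym_mat_def add.commute)
  also have "\<dots> = (\<integral>\<^sup>+d. (\<integral>\<^sup>+r. ennreal ((\<alpha> d + r * Y l d)\<^sup>2) \<partial>std_normal_distribution) \<partial>D)"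
    by (subst nn_integral_resample[OF p]) (simp_all add: af yf)
  also have "\<dots> = (\<integral>\<^sup>+d. ennreal ((\<alpha> d)\<^sup>2) + ennreal ((Y l d)\<^sup>2) \<partial>D)"
    by (simp add: nn_integral_affine_sq_std_normal)
  also have "\<dots> = (\<integral>\<^sup>+d. ennreal ((\<alpha> d)\<^sup>2) \<partial>D) + (\<integral>\<^sup>+d. ennreal ((Y l d)\<^sup>2) \<partial>D)"
    by (rule nn_integral_add) auto
  also have "(\<integral>\<^sup>+d. ennreal ((\<alpha> d)\<^sup>2) \<partial>D) = (\<integral>\<^sup>+d. ennreal (\<Sum>j\<in>J. (Y j d)\<^sup>2) \<partial>D)"
    unfolding \<alpha>_def using insert.prems by (intro insert.IH) auto
  also have "\<dots> + (\<integral>\<^sup>+d. ennreal ((Y l d)\<^sup>2) \<partial>D) = (\<integral>\<^sup>+d. ennreal (\<Sum>j\<in>J. (Y j d)\<^sup>2) + ennreal ((Y l d)\<^sup>2) \<partial>D)"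
    by (rule nn_integral_add[symmetric]) auto
  also have "\<dots> = (\<integral>\<^sup>+d. ennreal (\<Sum>j\<in>insert l J. (Y j d)\<^sup>2) \<partial>D)"
    using insert.hyps by (intro nn_integral_cong, subst ennreal_plus[symmetric]) (simp_all add: sum_nonneg add.commute)
  finally show ?case .
qed

lemma nn_integral_snd: "h \<in> borel_measurable \<mu> \<Longrightarrow> (\<integral>\<^sup>+d. h (snd d) \<partial>D) = (\<integral>\<^sup>+x. h x \<partial>\<mu>)"
proof -
  assume h: "h \<in> borel_measurable \<mu>"
  interpret m: prob_space \<mu> by (rule prob_mu)
  interpret P: prob_space "\<Pi>\<^sub>M p\<in>edges n. std_normal_distribution"
    by (intro prob_space_PiM prob_space_std_normal)
  interpret pp: pair_prob_space "\<Pi>\<^sub>M p\<in>edges n. std_normal_distribution" \<mu> ..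
  show ?thesis unfolding data_law_def
    using pp.nn_integral_snd[of "\<lambda>d. h (snd d)"] h by (simp add: P.emeasure_space_1)
qed

lemma coord_measurable_mu: "i \<in> {1..n} \<Longrightarrow> (\<lambda>x. x i) \<in> borel_measurable \<mu>"
  unfolding measurable_cong_sets[OF sets_mu refl] by (rule measurable_component_singleton)

lemma expectation_snd:
  assumes h: "h \<in> borel_measurable \<mu>" and nonneg: "\<And>x. h x \<ge> (0::real)"
  shows "expectation (\<lambda>d. h (snd d)) = (\<integral>x. h x \<partial>\<mu>)"
proof -
  have "(\<lambda>d. h (snd d)) \<in> borel_measurable D"
    unfolding data_law_def by (rule measurable_compose[OF measurable_snd h])
  then have "expectation (\<lambda>d. h (snd d)) = enn2real (\<integral>\<^sup>+d. ennreal (h (snd d)) \<partial>D)"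
    using nonneg by (intro integral_eq_nn_integral) auto
  also have "(\<integral>\<^sup>+d. ennreal (h (snd d)) \<partial>D) = (\<integral>\<^sup>+x. ennreal (h x) \<partial>\<mu>)"
    using h by (intro nn_integral_snd) auto
  also have "enn2real \<dots> = (\<integral>x. h x \<partial>\<mu>)"
    using h nonneg by (intro integral_eq_nn_integral[symmetric]) auto
  finally show ?thesis .
qed

end

section \<open>Moment bounds and elementary inequalities\<close>

lemma (in prob_space) bounded_integrable:
  fixes X :: "'a \<Rightarrow> real"
  assumes "X \<in> borel_measurable M" "\<And>x. \<bar>X x\<bar> \<le> C"
  shows "integrable M X"
  using assms by (intro integrable_const_bound[of _ C]) auto

lemma (in prob_space) square_integrable_bound:
  fixes X :: "'a \<Rightarrow> real"
  assumes X: "X \<in> borel_measurable M" and c: "(\<integral>\<^sup>+x. ennreal ((X x)\<^sup>2) \<partial>M) \<le> ennreal c" "c \<ge> 0"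
  shows "integrable M (\<lambda>x. (X x)\<^sup>2)" "integrable M X" "expectation (\<lambda>x. (X x)\<^sup>2) \<le> c"
proof -
  have fin: "(\<integral>\<^sup>+x. ennreal ((X x)\<^sup>2) \<partial>M) < \<infinity>"
    using c(1) by (rule order_le_less_trans) simp
  show int: "integrable M (\<lambda>x. (X x)\<^sup>2)"
    using X fin by (intro integrableI_nonneg) auto
  show "integrable M X"
    using X int by (rule square_integrable_imp_integrable)
  have "ennreal (expectation (\<lambda>x. (X x)\<^sup>2)) \<le> ennreal c"
    using nn_integral_eq_integral[OF int] c(1) by simp
  then show "expectation (\<lambda>x. (X x)\<^sup>2) \<le> c" using c(2) by simp
qed

text \<open>A pointwise inequality in place of Cauchy-Schwarz; it gives the right order once
  \<open>\<delta>\<close> is of the size of the root mean square.\<close>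

lemma (in prob_space) expectation_abs_le_second_moment:
  fixes X :: "'a \<Rightarrow> real"
  assumes "integrable M X" "integrable M (\<lambda>x. (X x)\<^sup>2)" "\<delta> > 0"
  shows "expectation (\<lambda>x. \<bar>X x\<bar>) \<le> \<delta> + expectation (\<lambda>x. (X x)\<^sup>2) / \<delta>"
proof -
  have le: "\<bar>X x\<bar> \<le> \<delta> + (X x)\<^sup>2 / \<delta>" for x
  proof (cases "\<bar>X x\<bar> \<le> \<delta>")
    case False
    then have "\<delta> * \<bar>X x\<bar> \<le> \<bar>X x\<bar> * \<bar>X x\<bar>" by (intro mult_right_mono) auto
    then have "\<bar>X x\<bar> \<le> (X x)\<^sup>2 / \<delta>"
      using assms(3) by (simp add: field_simps power2_eq_square flip: abs_mult)
    then show ?thesis using assms(3) by simp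
  qed (use assms(3) in \<open>simp add: add_increasing2\<close>)
  have "expectation (\<lambda>x. \<bar>X x\<bar>) \<le> expectation (\<lambda>x. \<delta> + (X x)\<^sup>2 / \<delta>)"
    using assms le by (intro integral_mono) auto
  also have "\<dots> = \<delta> + expectation (\<lambda>x. (X x)\<^sup>2) / \<delta>"
    using assms prob_space by simp
  finally show ?thesis .
qed

lemma abs_cos_diff_le: "\<bar>cos x - cos y\<bar> \<le> \<bar>x - y\<bar>" for x y :: real
proof -
  have "\<bar>cos x - cos y\<bar> = 2 * \<bar>sin ((x + y) / 2)\<bar> * \<bar>sin ((y - x) / 2)\<bar>"
    by (simp add: cos_diff_cos abs_mult)
  also have "\<dots> \<le> 2 * 1 * \<bar>(y - x) / 2\<bar>"
    by (intro mult_mono abs_sin_x_le_abs_x) auto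
  finally show ?thesis by simp
qed

lemma abs_exp_minus_diff_le:
  fixes x y :: real
  assumes "x \<ge> 0" "y \<ge> 0"
  shows "\<bar>exp (- x) - exp (- y)\<bar> \<le> \<bar>x - y\<bar>"
proof -
  have *: "exp (- x) - exp (- y) \<le> y - x" if "0 \<le> x" "x \<le> y" for x y :: real
  proof -
    have "exp (- x) - exp (- y) = exp (- x) * (1 - exp (- (y - x)))"
      by (simp add: right_diff_distrib flip: exp_add)
    also have "\<dots> \<le> 1 * (y - x)"
    proof (rule mult_mono)
      show "1 - exp (- (y - x)) \<le> y - x" using exp_ge_add_one_self[of "-(y - x)"] by linarith
    qed (use that in auto)
    finally show ?thesis by simp
  qed
  show ?thesis
    using *[of x y] *[of y x] assms by (cases "x \<le> y") (auto simp: abs_if)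
qed

section \<open>Stability of the cavity iterates\<close>

text \<open>\<open>cavity_gap B L k / n\<close> bounds the mean square effect of removing one more index.\<close>

fun cavity_gap :: "(nat \<Rightarrow> real) \<Rightarrow> (nat \<Rightarrow> real) \<Rightarrow> nat \<Rightarrow> real" where
  "cavity_gap B L 0 = 0"
| "cavity_gap B L (Suc k) = (B k)\<^sup>2 + (L k)\<^sup>2 * cavity_gap B L k"

lemma cavity_gap_nonneg: "cavity_gap B L k \<ge> 0"
  by (induction k) auto

locale cavity_space = data_space +
  fixes f :: "nat \<Rightarrow> real \<Rightarrow> real" and B L :: "nat \<Rightarrow> real"
  assumes f_bound: "\<bar>f k x\<bar> \<le> B k"
    and f_Lipschitz: "\<bar>f k x - f k y\<bar> \<le> L k * \<bar>x - y\<bar>"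
begin

definition cav :: "nat \<Rightarrow> nat set \<Rightarrow> nat \<Rightarrow> (nat \<times> nat \<Rightarrow> real) \<times> (nat \<Rightarrow> real) \<Rightarrow> real" where
  "cav k S i d = cavity f n (sym_mat (fst d)) (snd d) k S i"

lemma cav_0: "cav 0 S i d = snd d i"
  by (simp add: cav_def)

text \<open>The factor \<open>1 / sqrt n\<close> sits next to \<open>f k\<close> so that the sum
  reads row entry times coefficient, the shape handled by the row lemmas.\<close>

lemma cav_Suc:
  "cav (Suc k) S i d = (\<Sum>j\<in>{1..n} - insert i S. sym_mat (fst d) i j * (1 / sqrt n * f k (cav k (insert i S) j d)))"
  by (simp add: cav_def sum_distrib_left mult.left_commute)

lemma f_measurable [measurable]: "f k \<in> borel_measurable borel"
proof -
  have "isCont (f k) x" for x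
    unfolding isCont_def
  proof (rule LIM_zero_cancel, rule Lim_null_comparison)
    show "\<forall>\<^sub>F y in at x. norm (f k y - f k x) \<le> L k * \<bar>y - x\<bar>"
      by (simp add: f_Lipschitz)
    have "((\<lambda>y. L k * \<bar>y - x\<bar>) \<longlongrightarrow> L k * \<bar>x - x\<bar>) (at x)" by (intro tendsto_intros)
    then show "((\<lambda>y. L k * \<bar>y - x\<bar>) \<longlongrightarrow> 0) (at x)" by simp
  qed
  then show ?thesis by (intro borel_measurable_continuous_onI continuous_at_imp_continuous_on) auto
qed

lemma cav_measurable: "i \<in> {1..n} \<Longrightarrow> cav k S i \<in> borel_measurable D"
proof (induction k arbitrary: S i)
  case 0
  then show ?case using coord_measurable[OF 0] by (simp add: cav_0[abs_def])
next
  case (Suc k)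
  show ?case unfolding cav_Suc[abs_def]
    using Suc by (intro borel_measurable_sum borel_measurable_times entry_measurable
        borel_measurable_const measurable_compose[OF _ f_measurable]) auto
qed

text \<open>An iterate at an index outside \<open>S\<close> uses only entries between indices
  outside \<open>S\<close>: the summation avoids \<open>S\<close>, and the removed sets of inner
  iterates only grow. So an index \<open>i\<close> in \<open>S\<close> never occurs.\<close>

lemma cav_row_free: "i \<in> S \<Longrightarrow> j \<notin> S \<Longrightarrow> row_free i (cav k S j)"
proof (induction k arbitrary: S j)
  case 0
  then show ?case by (simp add: row_free_def cav_0)
next
  case (Suc k)
  show ?case unfolding row_free_def
  proof (intro allI impI)
    fix a x q r assume q: "q \<noteq> i"
    have "sym_mat (a(edge i q := r)) j p * (1 / sqrt n * f k (cav k (insert j S) p (a(edge i q := r), x))) =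
        sym_mat a j p * (1 / sqrt n * f k (cav k (insert j S) p (a, x)))" if "p \<in> {1..n} - insert j S" for p
    proof -
      have "sym_mat (a(edge i q := r)) j p = sym_mat a j p"
        using Suc.prems that by (intro sym_mat_update_other) (auto simp: edge_eq_iff)
      moreover have "cav k (insert j S) p (a(edge i q := r), x) = cav k (insert j S) p (a, x)"
        using Suc.IH[of "insert j S" p] Suc.prems that q by (auto intro: row_freeD)
      ultimately show ?thesis by simp
    qed
    then show "cav (Suc k) S j (a(edge i q := r), x) = cav (Suc k) S j (a, x)"
      unfolding cav_Suc fst_conv by (intro sum.cong refl)
  qed
qed

lemma B_nonneg: "B k \<ge> 0"
  using f_bound[of k 0] by linarith

text \<open>Row \<open>i\<close> is independent of its coefficients, so the second moment is the
  mean of at most \<open>n\<close> squared coefficients of size at most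
  \<open>(B k)\<^sup>2 / n\<close>.\<close>

lemma nn_integral_cav_sq_le:
  assumes i: "i \<in> {1..n}"
  shows "(\<integral>\<^sup>+d. ennreal ((cav (Suc k) S i d)\<^sup>2) \<partial>D) \<le> ennreal ((B k)\<^sup>2)"
proof -
  let ?J = "{1..n} - insert i S"
  define Y where "Y j d = 1 / sqrt n * f k (cav k (insert i S) j d)" for j d
  have n: "n > 0" using i by auto
  have "(\<integral>\<^sup>+d. ennreal ((cav (Suc k) S i d)\<^sup>2) \<partial>D) = (\<integral>\<^sup>+d. ennreal (\<Sum>j\<in>?J. (Y j d)\<^sup>2) \<partial>D)"
    unfolding cav_Suc Y_def[symmetric]
  proof (rule nn_integral_row_sq[OF i])
    show "Y j \<in> borel_measurable D" if "j \<in> ?J" for j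
      unfolding Y_def using that
      by (intro borel_measurable_times borel_measurable_const measurable_compose[OF _ f_measurable] cav_measurable) auto
    show "row_free i (Y j)" if "j \<in> ?J" for j
      using cav_row_free[of i "insert i S" j k] that by (simp add: Y_def row_free_def)
  qed auto
  also have "\<dots> \<le> (\<integral>\<^sup>+d. ennreal ((B k)\<^sup>2) \<partial>D)"
  proof (intro nn_integral_mono ennreal_leI)
    fix d
    have "(Y j d)\<^sup>2 \<le> (B k)\<^sup>2 / n" for j
      unfolding Y_def power_mult_distrib
      using n f_bound[of k] by (simp add: divide_simps power2_le_iff_abs_le B_nonneg)
    then have "(\<Sum>j\<in>?J. (Y j d)\<^sup>2) \<le> real (card ?J) * ((B k)\<^sup>2 / n)"
      by (intro sum_bounded_above) auto
    also have "\<dots> \<le> real n * ((B k)\<^sup>2 / n)"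
    proof (rule mult_right_mono)
      have "card ?J \<le> card {1..n}" by (intro card_mono) auto
      then show "real (card ?J) \<le> real n" by simp
    qed simp
    finally show "(\<Sum>j\<in>?J. (Y j d)\<^sup>2) \<le> (B k)\<^sup>2" using n by simp
  qed
  also have "\<dots> = ennreal ((B k)\<^sup>2)" by (simp add: emeasure_space_1)
  finally show ?thesis .
qed

text \<open>Both iterates at \<open>i\<close> use the same row, so their difference is again a row
  sum. Its coefficient at \<open>l\<close> is a whole term, at most \<open>B k / sqrt n\<close>;
  every other one is at most \<open>L k / sqrt n\<close> times the difference one level down. These
  are the two summands in the recursion of \<open>cavity_gap\<close>.\<close>

lemma nn_integral_cav_diff_sq_le:
  assumes "i \<in> {1..n}" "l \<in> {1..n}" "l \<notin> S" "l \<noteq> i"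
  shows "(\<integral>\<^sup>+d. ennreal ((cav k S i d - cav k (insert l S) i d)\<^sup>2) \<partial>D) \<le> ennreal (cavity_gap B L k / n)"
  using assms
proof (induction k arbitrary: S i)
  case 0
  then show ?case by (simp add: cav_0)
next
  case (Suc k)
  note i = Suc.prems(1)
  let ?J = "{1..n} - insert i S"
  have n: "n > 0" using i by auto
  have lJ: "l \<in> ?J" using Suc.prems by auto
  define \<Delta> where "\<Delta> j d = cav k (insert i S) j d - cav k (insert l (insert i S)) j d" for j d
  \<comment> \<open>The 0 at \<open>j = l\<close> stands for the summand missing from the iterate
    with \<open>l\<close> removed.\<close>
  define Y where "Y j d = 1 / sqrt n * (f k (cav k (insert i S) j d) -
      (if j = l then 0 else f k (cav k (insert l (insert i S)) j d)))" for j d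
  have \<Delta>_meas: "\<Delta> j \<in> borel_measurable D" if "j \<in> ?J" for j
    unfolding \<Delta>_def using that by (intro borel_measurable_diff cav_measurable) auto
  have diff: "cav (Suc k) S i d - cav (Suc k) (insert l S) i d = (\<Sum>j\<in>?J. sym_mat (fst d) i j * Y j d)" for d
  proof -
    have J: "?J = insert l ({1..n} - insert i (insert l S))" using lJ by auto
    have "(\<Sum>j\<in>?J. sym_mat (fst d) i j * (1 / sqrt n * (if j = l then 0 else f k (cav k (insert l (insert i S)) j d)))) =
       cav (Suc k) (insert l S) i d"
      unfolding J cav_Suc by (subst sum.insert) (auto simp: insert_commute intro!: sum.cong)
    then show ?thesis
      by (simp add: cav_Suc Y_def right_diff_distrib sum_subtractf)
  qed
  have "(\<integral>\<^sup>+d. ennreal ((cav (Suc k) S i d - cav (Suc k) (insert l S) i d)\<^sup>2) \<partial>D) =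
      (\<integral>\<^sup>+d. ennreal (\<Sum>j\<in>?J. (Y j d)\<^sup>2) \<partial>D)"
    unfolding diff
  proof (rule nn_integral_row_sq[OF i])
    show "Y j \<in> borel_measurable D" if "j \<in> ?J" for j
      unfolding Y_def using that
      by (cases "j = l") (auto intro!: borel_measurable_divide borel_measurable_const borel_measurable_diff
          measurable_compose[OF _ f_measurable] cav_measurable)
    show "row_free i (Y j)" if "j \<in> ?J" for j
      using cav_row_free[of i "insert i S" j k] cav_row_free[of i "insert l (insert i S)" j k] that
      by (simp add: Y_def row_free_def)
  qed auto
  also have "\<dots> \<le> (\<integral>\<^sup>+d. ennreal ((B k)\<^sup>2 / n) + (\<Sum>j\<in>?J - {l}. ennreal ((L k)\<^sup>2 / n) * ennreal ((\<Delta> j d)\<^sup>2)) \<partial>D)"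
  proof (intro nn_integral_mono)
    fix d
    have l1: "(Y l d)\<^sup>2 \<le> (B k)\<^sup>2 / n"
      unfolding Y_def power_mult_distrib
      using n f_bound[of k] by (simp add: divide_simps power2_le_iff_abs_le B_nonneg)
    have l2: "(Y j d)\<^sup>2 \<le> (L k)\<^sup>2 / n * (\<Delta> j d)\<^sup>2" if "j \<in> ?J - {l}" for j
    proof -
      have "(f k (cav k (insert i S) j d) - f k (cav k (insert l (insert i S)) j d))\<^sup>2 \<le> (L k * \<bar>\<Delta> j d\<bar>)\<^sup>2"
        unfolding \<Delta>_def using f_Lipschitz by (meson abs_le_square_iff abs_ge_self order_trans)
      then show ?thesis
        using that n by (simp add: Y_def power_mult_distrib divide_simps)
    qed
    have "(\<Sum>j\<in>?J. (Y j d)\<^sup>2) = (Y l d)\<^sup>2 + (\<Sum>j\<in>?J - {l}. (Y j d)\<^sup>2)"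
      using lJ by (intro sum.remove) auto
    also have "\<dots> \<le> (B k)\<^sup>2 / n + (\<Sum>j\<in>?J - {l}. (L k)\<^sup>2 / n * (\<Delta> j d)\<^sup>2)"
      by (intro add_mono l1 sum_mono l2)
    finally show "ennreal (\<Sum>j\<in>?J. (Y j d)\<^sup>2) \<le> ennreal ((B k)\<^sup>2 / n) +
        (\<Sum>j\<in>?J - {l}. ennreal ((L k)\<^sup>2 / n) * ennreal ((\<Delta> j d)\<^sup>2))"
      by (simp add: ennreal_mult[symmetric] sum_nonneg flip: ennreal_plus)
  qed
  also have "\<dots> = ennreal ((B k)\<^sup>2 / n) + (\<Sum>j\<in>?J - {l}. ennreal ((L k)\<^sup>2 / n) * (\<integral>\<^sup>+d. ennreal ((\<Delta> j d)\<^sup>2) \<partial>D))"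
  proof -
    have m: "(\<lambda>d. ennreal ((\<Delta> j d)\<^sup>2)) \<in> borel_measurable D" if "j \<in> ?J - {l}" for j
      using \<Delta>_meas that by simp
    have m': "(\<lambda>d. ennreal ((L k)\<^sup>2 / n) * ennreal ((\<Delta> j d)\<^sup>2)) \<in> borel_measurable D" if "j \<in> ?J - {l}" for j
      by (intro borel_measurable_times_ennreal borel_measurable_const m that)
    show ?thesis
      by (simp add: nn_integral_add nn_integral_sum[OF m'] nn_integral_cmult[OF m] borel_measurable_sum[OF m']
          emeasure_space_1 del: atLeastAtMost_iff Diff_iff cong: sum.cong)
  qed
  also have "\<dots> \<le> ennreal ((B k)\<^sup>2 / n) + (\<Sum>j\<in>?J - {l}. ennreal ((L k)\<^sup>2 / n) * ennreal (cavity_gap B L k / n))"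
    unfolding \<Delta>_def using Suc.prems
    by (intro add_left_mono sum_mono mult_left_mono Suc.IH) auto
  also have "\<dots> \<le> ennreal ((B k)\<^sup>2 / n + (L k)\<^sup>2 / n * cavity_gap B L k)"
  proof -
    \<comment> \<open>At most \<open>n\<close> terms of order \<open>1 / n\<^sup>2\<close> add up to
      order \<open>1 / n\<close>, so the rate is not lost from one level to the next.\<close>
    have "real (card (?J - {l})) * ((L k)\<^sup>2 / n * (cavity_gap B L k / n)) \<le> real n * ((L k)\<^sup>2 / n * (cavity_gap B L k / n))"
    proof (rule mult_right_mono)
      have "card (?J - {l}) \<le> card {1..n}" by (intro card_mono) auto
      then show "real (card (?J - {l})) \<le> real n" by simp
    qed (simp add: cavity_gap_nonneg)
    also have "\<dots> = (L k)\<^sup>2 / n * cavity_gap B L k" using n by simp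
    finally have "real (card (?J - {l})) * ((L k)\<^sup>2 / n * (cavity_gap B L k / n)) \<le> (L k)\<^sup>2 / n * cavity_gap B L k" .
    then show ?thesis
      using cavity_gap_nonneg[of B L k]
      by (simp add: ennreal_mult[symmetric] ennreal_of_nat_eq_real_of_nat del: times_divide_eq_right flip: ennreal_plus)
  qed
  also have "\<dots> = ennreal (cavity_gap B L (Suc k) / n)"
    by (simp add: add_divide_distrib)
  finally show ?case .
qed

lemma expectation_cav_diff_le:
  assumes "i \<in> {1..n}" "l \<in> {1..n}" "l \<notin> S" "l \<noteq> i"
  shows "integrable D (\<lambda>d. cav k S i d - cav k (insert l S) i d)"
    and "expectation (\<lambda>d. \<bar>cav k S i d - cav k (insert l S) i d\<bar>) \<le> (1 + cavity_gap B L k) / sqrt n"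
proof -
  have n: "n > 0" using assms by auto
  have m: "(\<lambda>d. cav k S i d - cav k (insert l S) i d) \<in> borel_measurable D"
    using assms by (intro borel_measurable_diff cav_measurable)
  note sq = square_integrable_bound[OF m nn_integral_cav_diff_sq_le[OF assms]]
  have g0: "cavity_gap B L k / n \<ge> 0" by (simp add: cavity_gap_nonneg)
  show "integrable D (\<lambda>d. cav k S i d - cav k (insert l S) i d)" using sq(2) g0 by simp
  \<comment> \<open>The second moment has order \<open>1 / n\<close>, so
    \<open>\<delta> = 1 / sqrt n\<close> balances the two terms.\<close>
  have "expectation (\<lambda>d. \<bar>cav k S i d - cav k (insert l S) i d\<bar>) \<le>
     1 / sqrt n + expectation (\<lambda>d. (cav k S i d - cav k (insert l S) i d)\<^sup>2) / (1 / sqrt n)"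
    using n g0 by (intro expectation_abs_le_second_moment sq) auto
  also have "\<dots> \<le> 1 / sqrt n + (cavity_gap B L k / n) / (1 / sqrt n)"
    using sq(3)[OF g0] by (intro add_left_mono divide_right_mono) auto
  also have "\<dots> = (1 + cavity_gap B L k) / sqrt n"
    using n real_sqrt_mult_self[of "real n"] by (simp add: field_simps)
  finally show "expectation (\<lambda>d. \<bar>cav k S i d - cav k (insert l S) i d\<bar>) \<le> (1 + cavity_gap B L k) / sqrt n" .
qed

end

section \<open>Cosines of the iterates\<close>

context cavity_space
begin

definition wave :: "real \<Rightarrow> (nat \<Rightarrow> real) \<Rightarrow> nat \<Rightarrow> nat set \<Rightarrow> nat \<Rightarrow> _ \<Rightarrow> real" where
  "wave \<theta> t m S i d = cos (\<theta> + (\<Sum>a\<le>m. t a * cav a S i d))"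

text \<open>At \<open>insert i S\<close> this is the conditional variance, given u and the other
  rows, of the levels 1 to \<open>m\<close> inside \<open>wave \<theta> t m S i\<close>. Level
  \<open>Suc a\<close> is built from \<open>f a\<close>, whence the shift in
  \<open>t\<close>.\<close>

definition row_var :: "(nat \<Rightarrow> real) \<Rightarrow> nat \<Rightarrow> nat set \<Rightarrow> _ \<Rightarrow> real" where
  "row_var t m S d = 1 / n * (\<Sum>j\<in>{1..n} - S. (\<Sum>a<m. t (Suc a) * f a (cav a S j d))\<^sup>2)"

lemma wave_measurable: "i \<in> {1..n} \<Longrightarrow> wave \<theta> t m S i \<in> borel_measurable D"
  unfolding wave_def[abs_def] using cav_measurable
  by (intro measurable_compose[OF _ borel_measurable_cos] borel_measurable_add borel_measurable_sum
      borel_measurable_times borel_measurable_const) auto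

lemma wave_abs_le: "\<bar>wave \<theta> t m S i d\<bar> \<le> 1"
  by (simp add: wave_def)

lemma wave_0: "wave \<theta> t 0 S i d = cos (\<theta> + t 0 * snd d i)"
  by (simp add: wave_def cav_0)

lemma wave_row_free: "i \<in> S \<Longrightarrow> l \<notin> S \<Longrightarrow> row_free i (wave \<theta> t m S l)"
  unfolding row_free_def wave_def using row_freeD[OF cav_row_free] by simp

lemma row_var_nonneg: "row_var t m S d \<ge> 0"
  by (simp add: row_var_def sum_nonneg)

lemma row_var_measurable: "row_var t m S \<in> borel_measurable D"
  unfolding row_var_def[abs_def] using cav_measurable
  by (intro borel_measurable_times borel_measurable_const borel_measurable_sum borel_measurable_power
      measurable_compose[OF _ f_measurable]) auto

lemma row_var_le: "row_var t m S d \<le> (\<Sum>a<m. \<bar>t (Suc a)\<bar> * B a)\<^sup>2"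
proof (cases "n = 0")
  case False
  have "(\<Sum>a<m. t (Suc a) * f a (cav a S j d))\<^sup>2 \<le> (\<Sum>a<m. \<bar>t (Suc a)\<bar> * B a)\<^sup>2" for j
  proof (rule power2_le_iff_abs_le[THEN iffD2])
    have "\<bar>\<Sum>a<m. t (Suc a) * f a (cav a S j d)\<bar> \<le> (\<Sum>a<m. \<bar>t (Suc a) * f a (cav a S j d)\<bar>)"
      by (rule sum_abs)
    also have "\<dots> \<le> (\<Sum>a<m. \<bar>t (Suc a)\<bar> * B a)"
      unfolding abs_mult by (intro sum_mono mult_left_mono f_bound) auto
    finally show "\<bar>\<Sum>a<m. t (Suc a) * f a (cav a S j d)\<bar> \<le> (\<Sum>a<m. \<bar>t (Suc a)\<bar> * B a)" .
  qed (simp add: sum_nonneg B_nonneg)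
  then have "(\<Sum>j\<in>{1..n} - S. (\<Sum>a<m. t (Suc a) * f a (cav a S j d))\<^sup>2)
      \<le> real (card ({1..n} - S)) * (\<Sum>a<m. \<bar>t (Suc a)\<bar> * B a)\<^sup>2"
    by (intro sum_bounded_above) auto
  also have "\<dots> \<le> real n * (\<Sum>a<m. \<bar>t (Suc a)\<bar> * B a)\<^sup>2"
  proof (rule mult_right_mono)
    have "card ({1..n} - S) \<le> card {1..n}" by (intro card_mono) auto
    then show "real (card ({1..n} - S)) \<le> real n" by simp
  qed simp
  finally show ?thesis using False by (simp add: row_var_def field_simps)
next
  case True
  have "row_var t m S d = 0" unfolding row_var_def using True by simp
  then show ?thesis by simp
qed

lemma row_var_integrable: "integrable D (row_var t m S)"
  by (rule bounded_integrable[OF row_var_measurable])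
    (subst abs_of_nonneg[OF row_var_nonneg], rule row_var_le)

text \<open>All levels from 1 on at index \<open>i\<close> are sums over the same row, so their
  combination is a single row sum with coefficients free of row \<open>i\<close>. Level 0 contains
  no matrix entry and joins the phase. The identity is exact; its variance is still random.\<close>

lemma expectation_wave:
  assumes i: "i \<in> {1..n}" and Z: "Z \<in> borel_measurable D" "row_free i Z" "\<And>d. \<bar>Z d\<bar> \<le> C"
  shows "(\<integral>d. wave \<theta> t m S i d * Z d \<partial>D) =
    (\<integral>d. wave \<theta> t 0 S i d * (exp (- row_var t m (insert i S) d / 2) * Z d) \<partial>D)"
proof -
  let ?J = "{1..n} - insert i S"
  have n: "n > 0" using i by auto
  define \<alpha> where "\<alpha> d = \<theta> + t 0 * snd d i" for d :: "(nat \<times> nat \<Rightarrow> real) \<times> (nat \<Rightarrow> real)"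
  define Y where "Y j d = 1 / sqrt n * (\<Sum>a<m. t (Suc a) * f a (cav a (insert i S) j d))" for j d
  have wave: "wave \<theta> t m S i d = cos (\<alpha> d + (\<Sum>j\<in>?J. sym_mat (fst d) i j * Y j d))" for d
  proof -
    have "(\<Sum>j\<in>?J. sym_mat (fst d) i j * Y j d) =
        (\<Sum>a<m. \<Sum>j\<in>?J. sym_mat (fst d) i j * (1 / sqrt n * (t (Suc a) * f a (cav a (insert i S) j d))))"
      unfolding Y_def sum_distrib_left by (rule sum.swap)
    also have "\<dots> = (\<Sum>a<m. t (Suc a) * cav (Suc a) S i d)"
      unfolding cav_Suc sum_distrib_left by (intro sum.cong refl) (simp add: mult_ac)
    finally have "(\<Sum>a\<le>m. t a * cav a S i d) = t 0 * snd d i + (\<Sum>j\<in>?J. sym_mat (fst d) i j * Y j d)"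
      by (simp add: lessThan_Suc_atMost[symmetric] sum.lessThan_Suc_shift cav_0 del: sum.lessThan_Suc)
    then show ?thesis by (simp add: wave_def \<alpha>_def add.assoc)
  qed
  have var: "(\<Sum>j\<in>?J. (Y j d)\<^sup>2) = row_var t m (insert i S) d" for d
  proof -
    have "(Y j d)\<^sup>2 = 1 / n * (\<Sum>a<m. t (Suc a) * f a (cav a (insert i S) j d))\<^sup>2" for j
      unfolding Y_def power_mult_distrib by (simp add: power_divide)
    then show ?thesis by (simp add: row_var_def sum_distrib_left)
  qed
  have "(\<integral>d. wave \<theta> t m S i d * Z d \<partial>D) =
     (\<integral>d. cos (\<alpha> d) * (exp (- (\<Sum>j\<in>?J. (Y j d)\<^sup>2) / 2) * Z d) \<partial>D)"
    unfolding wave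
  proof (rule expectation_cos_row[OF i])
    show "\<alpha> \<in> borel_measurable D" unfolding \<alpha>_def
      using coord_measurable[OF i] by measurable
    show "Y j \<in> borel_measurable D" if "j \<in> ?J" for j
      unfolding Y_def using that
      by (intro borel_measurable_times borel_measurable_const borel_measurable_sum
          measurable_compose[OF _ f_measurable] cav_measurable) auto
    show "row_free i \<alpha>" by (simp add: row_free_def \<alpha>_def)
    show "row_free i (Y j)" if "j \<in> ?J" for j
      using row_freeD[OF cav_row_free[of i "insert i S" j]] that by (simp add: row_free_def Y_def)
  qed (use Z in auto)
  then show ?thesis by (simp only: var wave_0 \<alpha>_def)
qed

lemma expectation_wave_diff_le:
  assumes "i \<in> {1..n}" "l \<in> {1..n}" "l \<notin> S" "l \<noteq> i"
  shows "expectation (\<lambda>d. \<bar>wave \<theta> t m S i d - wave \<theta> t m (insert l S) i d\<bar>) \<le>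
     (\<Sum>a\<le>m. \<bar>t a\<bar> * (1 + cavity_gap B L a)) / sqrt n"
proof -
  have int: "integrable D (\<lambda>d. \<bar>t a\<bar> * \<bar>cav a S i d - cav a (insert l S) i d\<bar>)" for a
    using expectation_cav_diff_le(1)[OF assms] by auto
  have "expectation (\<lambda>d. \<bar>wave \<theta> t m S i d - wave \<theta> t m (insert l S) i d\<bar>) \<le>
     expectation (\<lambda>d. \<Sum>a\<le>m. \<bar>t a\<bar> * \<bar>cav a S i d - cav a (insert l S) i d\<bar>)"
  proof (rule integral_mono)
    show "integrable D (\<lambda>d. \<bar>wave \<theta> t m S i d - wave \<theta> t m (insert l S) i d\<bar>)"
      using assms by (intro integrable_abs Bochner_Integration.integrable_diff bounded_integrable[OF _ wave_abs_le] wave_measurable)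
    show "integrable D (\<lambda>d. \<Sum>a\<le>m. \<bar>t a\<bar> * \<bar>cav a S i d - cav a (insert l S) i d\<bar>)"
      using int by (intro Bochner_Integration.integrable_sum)
    fix d
    have "\<bar>wave \<theta> t m S i d - wave \<theta> t m (insert l S) i d\<bar> \<le>
        \<bar>(\<theta> + (\<Sum>a\<le>m. t a * cav a S i d)) - (\<theta> + (\<Sum>a\<le>m. t a * cav a (insert l S) i d))\<bar>"
      unfolding wave_def by (rule abs_cos_diff_le)
    also have "\<dots> = \<bar>\<Sum>a\<le>m. t a * (cav a S i d - cav a (insert l S) i d)\<bar>"
      by (simp add: right_diff_distrib sum_subtractf)
    also have "\<dots> \<le> (\<Sum>a\<le>m. \<bar>t a * (cav a S i d - cav a (insert l S) i d)\<bar>)"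
      by (rule sum_abs)
    finally show "\<bar>wave \<theta> t m S i d - wave \<theta> t m (insert l S) i d\<bar> \<le> (\<Sum>a\<le>m. \<bar>t a\<bar> * \<bar>cav a S i d - cav a (insert l S) i d\<bar>)"
      by (simp add: abs_mult)
  qed
  also have "\<dots> = (\<Sum>a\<le>m. \<bar>t a\<bar> * expectation (\<lambda>d. \<bar>cav a S i d - cav a (insert l S) i d\<bar>))"
    using int by (subst Bochner_Integration.integral_sum) auto
  also have "\<dots> \<le> (\<Sum>a\<le>m. \<bar>t a\<bar> * ((1 + cavity_gap B L a) / sqrt n))"
    using expectation_cav_diff_le(2)[OF assms] by (intro sum_mono mult_left_mono) auto
  also have "\<dots> = (\<Sum>a\<le>m. \<bar>t a\<bar> * (1 + cavity_gap B L a)) / sqrt n"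
    by (simp add: sum_divide_distrib)
  finally show ?thesis .
qed

text \<open>Once the factor at \<open>l\<close> is free of row \<open>i\<close>, integrating that
  row out turns \<open>F i\<close> into \<open>wave \<theta> t 0 S i\<close> times the difference
  between the random Gaussian factor and \<open>\<kappa>\<close>. The first term of the bound is the
  price of making \<open>F l\<close> free of the row, the second the distance of the random variance
  from \<open>v\<close>.\<close>

lemma expectation_wave_cross_le:
  fixes \<theta> t m S and v :: real
  defines "\<kappa> \<equiv> exp (- v / 2)"
  defines "F \<equiv> \<lambda>i d. wave \<theta> t m S i d - \<kappa> * wave \<theta> t 0 S i d"
  assumes v: "v \<ge> 0" and il: "i \<in> {1..n} - S" "l \<in> {1..n} - S" "i \<noteq> l"
    and \<eta>: "expectation (\<lambda>d. \<bar>row_var t m (insert i S) d - v\<bar>) \<le> \<eta>"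
  shows "\<bar>expectation (\<lambda>d. F i d * F l d)\<bar> \<le>
     2 * (\<Sum>a\<le>m. \<bar>t a\<bar> * (1 + cavity_gap B L a)) / sqrt n + \<eta>"
proof -
  have i: "i \<in> {1..n}" and l: "l \<in> {1..n}" using il by auto
  have \<kappa>: "0 \<le> \<kappa>" "\<kappa> \<le> 1" using v by (auto simp: \<kappa>_def)
  define Z where "Z d = wave \<theta> t m (insert i S) l d - \<kappa> * wave \<theta> t 0 S l d" for d
  have two: "\<bar>wave \<theta> t m S' i' d - \<kappa> * wave \<theta> t 0 S i' d\<bar> \<le> 2" for S' i' d
  proof -
    have "\<bar>wave \<theta> t m S' i' d - \<kappa> * wave \<theta> t 0 S i' d\<bar> \<le> \<bar>wave \<theta> t m S' i' d\<bar> + \<bar>\<kappa> * wave \<theta> t 0 S i' d\<bar>"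
      by (rule abs_triangle_ineq4)
    also have "\<dots> \<le> 1 + 1 * 1"
      unfolding abs_mult using \<kappa> by (intro add_mono mult_mono wave_abs_le) auto
    finally show ?thesis by simp
  qed
  have Z2: "\<bar>Z d\<bar> \<le> 2" for d unfolding Z_def by (rule two)
  have Zm [measurable]: "Z \<in> borel_measurable D" unfolding Z_def
    using wave_measurable[OF l] by measurable
  have Fm: "F i' \<in> borel_measurable D" if "i' \<in> {1..n}" for i'
    unfolding F_def using wave_measurable[OF that] by measurable
  have F2: "\<bar>F i' d\<bar> \<le> 2" for i' d unfolding F_def by (rule two)
  txt \<open>Replacing \<open>F l\<close> by \<open>Z\<close>, which is free of row \<open>i\<close>, allows row \<open>i\<close> to be integrated out of \<open>F i\<close>.\<close>
  have Zfree: "row_free i Z"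
    using wave_row_free[of i "insert i S" l \<theta> t m] il by (simp add: row_free_def Z_def wave_0)
  note [measurable] = Fm[OF i] Fm[OF l] wave_measurable[OF i] wave_measurable[OF l] row_var_measurable
  let ?e = "\<lambda>d. exp (- row_var t m (insert i S) d / 2)"
  have e1: "\<bar>?e d\<bar> \<le> 1" for d using row_var_nonneg by simp
  have split: "F i d * F l d = F i d * Z d + F i d * (wave \<theta> t m S l d - wave \<theta> t m (insert i S) l d)" for d
    by (simp add: F_def Z_def algebra_simps)
  have b4: "\<bar>F i d * Z d\<bar> \<le> 2 * 2" for d
    unfolding abs_mult by (intro mult_mono F2 Z2) auto
  have int1: "integrable D (\<lambda>d. F i d * Z d)"
    by (rule bounded_integrable[OF _ b4]) measurable
  have int2: "integrable D (\<lambda>d. wave \<theta> t m S l d - wave \<theta> t m (insert i S) l d)"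
    using l by (intro Bochner_Integration.integrable_diff bounded_integrable[OF _ wave_abs_le] wave_measurable)
  have int3: "integrable D (\<lambda>d. F i d * (wave \<theta> t m S l d - wave \<theta> t m (insert i S) l d))"
    by (rule Bochner_Integration.integrable_bound[OF integrable_mult_right[OF integrable_abs[OF int2], of 2]])
      (auto simp: abs_mult intro!: mult_right_mono F2 wave_measurable l borel_measurable_times borel_measurable_diff Fm i)
  have p1: "\<bar>expectation (\<lambda>d. F i d * (wave \<theta> t m S l d - wave \<theta> t m (insert i S) l d))\<bar> \<le>
      2 * ((\<Sum>a\<le>m. \<bar>t a\<bar> * (1 + cavity_gap B L a)) / sqrt n)"
  proof -
    have "\<bar>expectation (\<lambda>d. F i d * (wave \<theta> t m S l d - wave \<theta> t m (insert i S) l d))\<bar> \<le>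
        expectation (\<lambda>d. \<bar>F i d * (wave \<theta> t m S l d - wave \<theta> t m (insert i S) l d)\<bar>)"
      by (rule integral_abs_bound)
    also have "\<dots> \<le> expectation (\<lambda>d. 2 * \<bar>wave \<theta> t m S l d - wave \<theta> t m (insert i S) l d\<bar>)"
      using int2 int3 by (intro integral_mono integrable_abs integrable_mult_right) (auto simp: abs_mult intro!: mult_right_mono F2)
    also have "\<dots> \<le> 2 * ((\<Sum>a\<le>m. \<bar>t a\<bar> * (1 + cavity_gap B L a)) / sqrt n)"
      using expectation_wave_diff_le[of l i S \<theta> t m] il by simp
    finally show ?thesis .
  qed
  have w1: "\<bar>wave \<theta> t m' S' i d * Z d\<bar> \<le> 1 * 2" for m' S' d
    unfolding abs_mult by (intro mult_mono wave_abs_le Z2) auto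
  have w2: "\<bar>wave \<theta> t 0 S i d * (?e d * Z d)\<bar> \<le> 1 * (1 * 2)" for d
    unfolding abs_mult by (intro mult_mono wave_abs_le Z2) (auto simp: row_var_nonneg)
  have i1: "integrable D (\<lambda>d. wave \<theta> t m' S' i d * Z d)" for m' S'
    by (rule bounded_integrable[OF _ w1]) (use wave_measurable[OF i] in measurable)
  have i2: "integrable D (\<lambda>d. wave \<theta> t 0 S i d * (?e d * Z d))"
    by (rule bounded_integrable[OF _ w2]) measurable
  have "expectation (\<lambda>d. F i d * Z d) =
      expectation (\<lambda>d. wave \<theta> t m S i d * Z d) - expectation (\<lambda>d. \<kappa> * (wave \<theta> t 0 S i d * Z d))"
    using i1 by (subst Bochner_Integration.integral_diff[symmetric]) (auto simp: F_def algebra_simps)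
  also have "\<dots> = expectation (\<lambda>d. wave \<theta> t 0 S i d * (?e d * Z d)) - expectation (\<lambda>d. \<kappa> * (wave \<theta> t 0 S i d * Z d))"
    by (simp only: expectation_wave[OF i Zm Zfree Z2])
  also have "\<dots> = expectation (\<lambda>d. wave \<theta> t 0 S i d * (?e d * Z d) - \<kappa> * (wave \<theta> t 0 S i d * Z d))"
    using i1 i2 by (subst Bochner_Integration.integral_diff) auto
  finally have FZ: "expectation (\<lambda>d. F i d * Z d) =
      expectation (\<lambda>d. wave \<theta> t 0 S i d * (?e d * Z d) - \<kappa> * (wave \<theta> t 0 S i d * Z d))" .
  have "\<bar>expectation (\<lambda>d. F i d * Z d)\<bar> \<le> expectation (\<lambda>d. \<bar>wave \<theta> t 0 S i d * (?e d * Z d) - \<kappa> * (wave \<theta> t 0 S i d * Z d)\<bar>)"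
    unfolding FZ by (rule integral_abs_bound)
  also have "\<dots> \<le> expectation (\<lambda>d. \<bar>row_var t m (insert i S) d - v\<bar>)"
  proof (rule integral_mono)
    show "integrable D (\<lambda>d. \<bar>wave \<theta> t 0 S i d * (?e d * Z d) - \<kappa> * (wave \<theta> t 0 S i d * Z d)\<bar>)"
      by (intro integrable_abs Bochner_Integration.integrable_diff integrable_mult_right i1 i2)
    show "integrable D (\<lambda>d. \<bar>row_var t m (insert i S) d - v\<bar>)"
      by (intro integrable_abs Bochner_Integration.integrable_diff integrable_const row_var_integrable)
    fix d
    have "\<bar>wave \<theta> t 0 S i d * (?e d * Z d) - \<kappa> * (wave \<theta> t 0 S i d * Z d)\<bar> = \<bar>wave \<theta> t 0 S i d * Z d\<bar> * \<bar>?e d - \<kappa>\<bar>"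
      unfolding abs_mult[symmetric] by (simp add: algebra_simps)
    \<comment> \<open>The bound 2 on \<open>Z\<close> cancels the halves in the exponents, and
      \<open>exp (- x)\<close> is 1-Lipschitz for nonnegative \<open>x\<close>.\<close>
    also have "\<dots> \<le> (1 * 2) * \<bar>row_var t m (insert i S) d / 2 - v / 2\<bar>"
    proof (intro mult_mono w1)
      show "\<bar>?e d - \<kappa>\<bar> \<le> \<bar>row_var t m (insert i S) d / 2 - v / 2\<bar>"
        unfolding \<kappa>_def using abs_exp_minus_diff_le[of "row_var t m (insert i S) d / 2" "v / 2"] row_var_nonneg v
        by simp
    qed auto
    finally show "\<bar>wave \<theta> t 0 S i d * (?e d * Z d) - \<kappa> * (wave \<theta> t 0 S i d * Z d)\<bar> \<le> \<bar>row_var t m (insert i S) d - v\<bar>"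
      by (simp add: abs_if field_simps split: if_splits)
  qed
  finally have p2: "\<bar>expectation (\<lambda>d. F i d * Z d)\<bar> \<le> \<eta>" using \<eta> by simp
  have "expectation (\<lambda>d. F i d * F l d) = expectation (\<lambda>d. F i d * Z d) +
      expectation (\<lambda>d. F i d * (wave \<theta> t m S l d - wave \<theta> t m (insert i S) l d))"
    unfolding split using int1 int3 by simp
  then show ?thesis using p1 p2 by simp
qed

text \<open>In the second moment of the average, at most \<open>n\<close> diagonal terms of size at
  most 4 contribute \<open>4 / n\<close>, and the at most \<open>n\<^sup>2\<close> cross terms
  contribute their uniform bound.\<close>

lemma expectation_wave_average_le:
  fixes \<theta> t m S and v :: real
  defines "\<kappa> \<equiv> exp (- v / 2)"
  defines "F \<equiv> \<lambda>i d. wave \<theta> t m S i d - \<kappa> * wave \<theta> t 0 S i d"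
  assumes v: "v \<ge> 0" and n: "n > 0" and \<delta>: "\<delta> > 0"
    and \<eta>: "\<And>i. i \<in> {1..n} - S \<Longrightarrow> expectation (\<lambda>d. \<bar>row_var t m (insert i S) d - v\<bar>) \<le> \<eta>" and \<eta>0: "\<eta> \<ge> 0"
  shows "expectation (\<lambda>d. \<bar>1 / n * (\<Sum>i\<in>{1..n} - S. F i d)\<bar>) \<le>
     \<delta> + (4 / n + 2 * (\<Sum>a\<le>m. \<bar>t a\<bar> * (1 + cavity_gap B L a)) / sqrt n + \<eta>) / \<delta>"
proof -
  let ?J = "{1..n} - S"
  define c where "c = 2 * (\<Sum>a\<le>m. \<bar>t a\<bar> * (1 + cavity_gap B L a)) / sqrt n + \<eta>"
  have c0: "c \<ge> 0" unfolding c_def using \<eta>0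
    by (intro add_nonneg_nonneg divide_nonneg_nonneg mult_nonneg_nonneg sum_nonneg) (auto simp: cavity_gap_nonneg)
  have \<kappa>: "0 \<le> \<kappa>" "\<kappa> \<le> 1" using v by (auto simp: \<kappa>_def)
  have F2: "\<bar>F i d\<bar> \<le> 2" for i d
  proof -
    have "\<bar>F i d\<bar> \<le> \<bar>wave \<theta> t m S i d\<bar> + \<bar>\<kappa> * wave \<theta> t 0 S i d\<bar>"
      unfolding F_def by (rule abs_triangle_ineq4)
    also have "\<dots> \<le> 1 + 1 * 1"
      unfolding abs_mult using \<kappa> by (intro add_mono mult_mono wave_abs_le) auto
    finally show ?thesis by simp
  qed
  have Fm: "F i \<in> borel_measurable D" if "i \<in> ?J" for i
    unfolding F_def using that by (intro borel_measurable_diff borel_measurable_times borel_measurable_const wave_measurable) auto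
  have FF: "\<bar>F i d * F l d\<bar> \<le> 2 * 2" for i l d
    unfolding abs_mult by (intro mult_mono F2) auto
  have int: "integrable D (\<lambda>d. F i d * F l d)" if "i \<in> ?J" "l \<in> ?J" for i l
    by (rule bounded_integrable[OF _ FF]) (intro borel_measurable_times Fm that)
  have sq: "(1 / n * (\<Sum>i\<in>?J. F i d))\<^sup>2 = (1 / n)\<^sup>2 * (\<Sum>i\<in>?J. \<Sum>l\<in>?J. F i d * F l d)" for d
    unfolding power_mult_distrib by (simp add: power2_eq_square sum_product)
  have card: "real (card ?J) \<le> real n"
  proof -
    have "card ?J \<le> card {1..n}" by (intro card_mono) auto
    then show ?thesis by simp
  qed
  have "expectation (\<lambda>d. (1 / n * (\<Sum>i\<in>?J. F i d))\<^sup>2) = (1 / n)\<^sup>2 * (\<Sum>i\<in>?J. \<Sum>l\<in>?J. expectation (\<lambda>d. F i d * F l d))"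
  proof -
    have "expectation (\<lambda>d. \<Sum>i\<in>?J. \<Sum>l\<in>?J. F i d * F l d) = (\<Sum>i\<in>?J. expectation (\<lambda>d. \<Sum>l\<in>?J. F i d * F l d))"
      by (intro Bochner_Integration.integral_sum Bochner_Integration.integrable_sum int)
    also have "\<dots> = (\<Sum>i\<in>?J. \<Sum>l\<in>?J. expectation (\<lambda>d. F i d * F l d))"
      by (intro sum.cong refl Bochner_Integration.integral_sum int)
    finally show ?thesis unfolding sq by simp
  qed
  also have "\<dots> \<le> (1 / n)\<^sup>2 * (\<Sum>i\<in>?J. \<Sum>l\<in>?J. (if l = i then 4 else 0) + c)"
  proof (intro mult_left_mono sum_mono)
    fix i l assume il: "i \<in> ?J" "l \<in> ?J"
    show "expectation (\<lambda>d. F i d * F l d) \<le> (if l = i then 4 else 0) + c"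
    proof (cases "l = i")
      case True
      have "expectation (\<lambda>d. F i d * F l d) \<le> expectation (\<lambda>d. 4)"
        using int[OF il] by (intro integral_mono) (use FF in \<open>auto intro: order_trans[OF abs_ge_self]\<close>)
      then show ?thesis using True c0 prob_space by simp
    next
      case False
      then have "\<bar>expectation (\<lambda>d. F i d * F l d)\<bar> \<le> c"
        unfolding F_def \<kappa>_def c_def using il by (intro expectation_wave_cross_le[OF v] \<eta>) auto
      then show ?thesis using False by simp
    qed
  qed auto
  also have "\<dots> = (1 / n)\<^sup>2 * (real (card ?J) * (4 + real (card ?J) * c))"
    by (simp add: sum.distrib)
  also have "\<dots> \<le> (1 / n)\<^sup>2 * (real n * (4 + real n * c))"
    using card c0 by (intro mult_left_mono mult_mono add_left_mono mult_right_mono) auto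
  also have "\<dots> = 4 / n + c"
    using n by (simp add: power2_eq_square field_simps)
  finally have second: "expectation (\<lambda>d. (1 / n * (\<Sum>i\<in>?J. F i d))\<^sup>2) \<le> 4 / n + c" .
  have Gm: "(\<lambda>d. 1 / n * (\<Sum>i\<in>?J. F i d)) \<in> borel_measurable D"
    by (intro borel_measurable_times borel_measurable_const borel_measurable_sum Fm)
  have G2: "\<bar>1 / n * (\<Sum>i\<in>?J. F i d)\<bar> \<le> 2" for d
  proof -
    have "\<bar>\<Sum>i\<in>?J. F i d\<bar> \<le> (\<Sum>i\<in>?J. \<bar>F i d\<bar>)" by (rule sum_abs)
    also have "\<dots> \<le> real (card ?J) * 2" by (intro sum_bounded_above F2)
    also have "\<dots> \<le> real n * 2" using card by simp
    finally show ?thesis using n by (simp add: abs_mult field_simps)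
  qed
  have "expectation (\<lambda>d. \<bar>1 / n * (\<Sum>i\<in>?J. F i d)\<bar>) \<le> \<delta> + expectation (\<lambda>d. (1 / n * (\<Sum>i\<in>?J. F i d))\<^sup>2) / \<delta>"
  proof (rule expectation_abs_le_second_moment)
    show "integrable D (\<lambda>d. 1 / n * (\<Sum>i\<in>?J. F i d))"
      by (rule bounded_integrable[OF Gm G2])
    have "(1 / n * (\<Sum>i\<in>?J. F i d))\<^sup>2 \<le> 2\<^sup>2" for d
      using G2[of d] by (subst power2_le_iff_abs_le) auto
    then have "\<bar>(1 / n * (\<Sum>i\<in>?J. F i d))\<^sup>2\<bar> \<le> 2\<^sup>2" for d by simp
    then show "integrable D (\<lambda>d. (1 / n * (\<Sum>i\<in>?J. F i d))\<^sup>2)"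
      by (rule bounded_integrable[rotated]) (intro borel_measurable_power Gm)
  qed fact
  also have "\<dots> \<le> \<delta> + (4 / n + c) / \<delta>"
    using second \<delta> by (intro add_left_mono divide_right_mono) auto
  finally show ?thesis by (simp add: c_def add.assoc)
qed

end

section \<open>Empirical averages and their second moments\<close>

context cavity_space
begin

text \<open>Normalised by \<open>n\<close> rather than by the number of remaining indices: leaving
  out the summands of \<open>S\<close> then costs a bounded test function only order
  \<open>card S / n\<close>.\<close>

definition average :: "nat \<Rightarrow> ((nat \<Rightarrow> real) \<Rightarrow> real) \<Rightarrow> nat set \<Rightarrow> _ \<Rightarrow> real" where
  "average m \<psi> S d = 1 / n * (\<Sum>i\<in>{1..n} - S. \<psi> (\<lambda>a\<in>{..m}. cav a S i d))"

lemma average_measurable: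
  assumes "\<psi> \<in> borel_measurable (\<Pi>\<^sub>M a\<in>{..m}. borel)"
  shows "average m \<psi> S \<in> borel_measurable D"
  unfolding average_def[abs_def]
  by (intro borel_measurable_times borel_measurable_const borel_measurable_sum
      measurable_compose[OF measurable_restrict assms] cav_measurable) auto

lemma average_mono:
  assumes "\<And>x. x \<in> {..m} \<rightarrow>\<^sub>E UNIV \<Longrightarrow> \<phi> x \<le> \<psi> x"
  shows "average m \<phi> S d \<le> average m \<psi> S d"
  unfolding average_def by (intro mult_left_mono sum_mono assms) auto

lemma average_abs_le:
  assumes "\<And>x. x \<in> {..m} \<rightarrow>\<^sub>E UNIV \<Longrightarrow> \<bar>\<psi> x\<bar> \<le> C" and C: "C \<ge> 0"
  shows "\<bar>average m \<psi> S d\<bar> \<le> C"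
proof (cases "n = 0")
  case True
  then show ?thesis unfolding average_def using C by simp
next
  case False
  have "\<bar>\<Sum>i\<in>{1..n} - S. \<psi> (\<lambda>a\<in>{..m}. cav a S i d)\<bar> \<le> (\<Sum>i\<in>{1..n} - S. \<bar>\<psi> (\<lambda>a\<in>{..m}. cav a S i d)\<bar>)"
    by (rule sum_abs)
  also have "\<dots> \<le> real (card ({1..n} - S)) * C"
    by (intro sum_bounded_above assms) auto
  also have "\<dots> \<le> real n * C"
  proof (rule mult_right_mono)
    have "card ({1..n} - S) \<le> card {1..n}" by (intro card_mono) auto
    then show "real (card ({1..n} - S)) \<le> real n" by simp
  qed (rule C)
  finally show ?thesis using False by (simp add: average_def abs_mult field_simps)
qed

text \<open>Only the total second moment of the initial coordinates is controlled, through
  \<open>second_moment_mu\<close>; a single square is integrable because the total dominates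
  it.\<close>

lemma cav_0_second_moment:
  shows "i \<in> {1..n} \<Longrightarrow> integrable D (\<lambda>d. (cav 0 S i d)\<^sup>2)"
    and "(\<Sum>i\<in>{1..n} - S. expectation (\<lambda>d. (cav 0 S i d)\<^sup>2)) \<le> n"
proof -
  let ?f = "\<lambda>d. \<Sum>i=1..n. (cav 0 S i d)\<^sup>2"
  have m: "?f \<in> borel_measurable D"
    by (intro borel_measurable_sum borel_measurable_power cav_measurable)
  have le: "(\<integral>\<^sup>+d. ennreal (?f d) \<partial>D) \<le> ennreal (real n)"
    unfolding cav_0 using second_moment_mu coord_measurable_mu
    by (subst nn_integral_snd) auto
  have int: "integrable D ?f"
  proof (rule integrableI_nonneg[OF m])
    show "(\<integral>\<^sup>+d. ennreal (?f d) \<partial>D) < \<infinity>"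
      using le by (rule order_le_less_trans) simp
  qed (simp add: sum_nonneg)
  show int_i: "integrable D (\<lambda>d. (cav 0 S i d)\<^sup>2)" if "i \<in> {1..n}" for i
  proof (rule Bochner_Integration.integrable_bound[OF int])
    show "(\<lambda>d. (cav 0 S i d)\<^sup>2) \<in> borel_measurable D"
      using that by (intro borel_measurable_power cav_measurable)
    have "(cav 0 S i d)\<^sup>2 \<le> ?f d" for d
      using that by (intro member_le_sum[of i "{1..n}" "\<lambda>i. (cav 0 S i d)\<^sup>2"]) auto
    then show "AE d in D. norm ((cav 0 S i d)\<^sup>2) \<le> norm (?f d)"
      by (intro always_eventually allI) (simp add: sum_nonneg)
  qed
  have "(\<Sum>i\<in>{1..n} - S. expectation (\<lambda>d. (cav 0 S i d)\<^sup>2)) \<le> (\<Sum>i=1..n. expectation (\<lambda>d. (cav 0 S i d)\<^sup>2))"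
    by (intro sum_mono2) auto
  also have "\<dots> = expectation ?f"
    using int_i by (intro Bochner_Integration.integral_sum[symmetric])
  also have "\<dots> \<le> n"
  proof -
    have "ennreal (expectation ?f) = (\<integral>\<^sup>+d. ennreal (?f d) \<partial>D)"
      by (rule nn_integral_eq_integral[OF int, symmetric]) (simp add: sum_nonneg)
    then have "ennreal (expectation ?f) \<le> ennreal (real n)" using le by (rule ord_eq_le_trans)
    then show ?thesis by (rule ennreal_le_iff[THEN iffD1, rotated]) simp
  qed
  finally show "(\<Sum>i\<in>{1..n} - S. expectation (\<lambda>d. (cav 0 S i d)\<^sup>2)) \<le> n" .
qed

lemma cav_sq_integrable:
  assumes "i \<in> {1..n}"
  shows "integrable D (\<lambda>d. (cav a S i d)\<^sup>2)"
proof (cases a)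
  case 0
  then show ?thesis using cav_0_second_moment(1)[OF assms] by simp
next
  case (Suc b)
  show ?thesis unfolding Suc
    by (rule square_integrable_bound(1)[OF cav_measurable[OF assms] nn_integral_cav_sq_le[OF assms]]) simp
qed

text \<open>\<open>q\<close> is the weight of the trigonometric approximation. The 2 is 1 for the
  constant plus 1 for the initial coordinates, whose squares have mean at most 1 on average; level
  \<open>Suc a\<close> adds \<open>(B a)\<^sup>2\<close>.\<close>

lemma average_second_moment:
  fixes m :: nat
  defines "q \<equiv> \<lambda>x. 1 + (\<Sum>a\<le>m. (x a)\<^sup>2)"
  assumes n: "n > 0"
  shows "integrable D (average m q S)" "expectation (average m q S) \<le> 2 + (\<Sum>a<m. (B a)\<^sup>2)"
proof -
  let ?J = "{1..n} - S"
  have card: "real (card ?J) \<le> real n"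
  proof -
    have "card ?J \<le> card {1..n}" by (intro card_mono) auto
    then show ?thesis by simp
  qed
  have eq: "average m q S = (\<lambda>d. 1 / n * (\<Sum>i\<in>?J. 1 + (\<Sum>a\<le>m. (cav a S i d)\<^sup>2)))"
    by (simp add: average_def[abs_def] q_def)
  have int: "integrable D (\<lambda>d. 1 + (\<Sum>a\<le>m. (cav a S i d)\<^sup>2))" if "i \<in> ?J" for i
    using that by (intro Bochner_Integration.integrable_add Bochner_Integration.integrable_sum cav_sq_integrable integrable_const) auto
  show "integrable D (average m q S)"
    unfolding eq by (intro integrable_mult_right Bochner_Integration.integrable_sum int)
  have "expectation (average m q S) = 1 / n * (\<Sum>i\<in>?J. expectation (\<lambda>d. 1 + (\<Sum>a\<le>m. (cav a S i d)\<^sup>2)))"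
    unfolding eq using int by (simp add: Bochner_Integration.integral_sum del: Bochner_Integration.integral_add)
  also have "\<dots> = 1 / n * (\<Sum>i\<in>?J. 1 + (\<Sum>a\<le>m. expectation (\<lambda>d. (cav a S i d)\<^sup>2)))"
    using cav_sq_integrable prob_space
    by (intro arg_cong2[of _ _ _ _ "(*)"] sum.cong refl)
       (subst Bochner_Integration.integral_add; auto simp: Bochner_Integration.integral_sum intro!: Bochner_Integration.integrable_sum)
  also have "\<dots> = 1 / n * (real (card ?J) + (\<Sum>i\<in>?J. expectation (\<lambda>d. (cav 0 S i d)\<^sup>2)) + (\<Sum>i\<in>?J. \<Sum>a<m. expectation (\<lambda>d. (cav (Suc a) S i d)\<^sup>2)))"
    by (simp add: sum.distrib lessThan_Suc_atMost[symmetric] sum.lessThan_Suc_shift del: sum.lessThan_Suc)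
  also have "\<dots> \<le> 1 / n * (real n + real n + (\<Sum>i\<in>?J. \<Sum>a<m. (B a)\<^sup>2))"
  proof (intro mult_left_mono add_mono card cav_0_second_moment(2) sum_mono)
    fix i a assume "i \<in> ?J"
    then show "expectation (\<lambda>d. (cav (Suc a) S i d)\<^sup>2) \<le> (B a)\<^sup>2"
      by (intro square_integrable_bound(3)[OF cav_measurable nn_integral_cav_sq_le]) auto
  qed auto
  also have "\<dots> \<le> 1 / n * (real n + real n + real n * (\<Sum>a<m. (B a)\<^sup>2))"
    using card by (intro mult_left_mono add_left_mono) (auto intro!: mult_right_mono sum_nonneg)
  also have "\<dots> = 2 + (\<Sum>a<m. (B a)\<^sup>2)"
    using n by (simp add: field_simps)
  finally show "expectation (average m q S) \<le> 2 + (\<Sum>a<m. (B a)\<^sup>2)" .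
qed

end

section \<open>Convergence of averages\<close>

text \<open>The hypotheses in the form used by the induction. \<open>W_cos\<close> gives the
  characteristic function of the limit vector with the Gaussian variance already rewritten by the
  covariance recursion, which makes it comparable with \<open>row_var\<close>.\<close>

locale cavity_sequence = N: prob_space N for N :: "'b measure" +
  fixes \<mu> :: "nat \<Rightarrow> (nat \<Rightarrow> real) measure" and f :: "nat \<Rightarrow> real \<Rightarrow> real" and B L :: "nat \<Rightarrow> real"
    and W :: "nat \<Rightarrow> 'b \<Rightarrow> real" and k :: nat
  assumes cavity_space: "\<And>n. cavity_space n (\<mu> n) f B L"
    and initial_limit: "\<And>\<theta> t. (\<lambda>n. \<integral>d. \<bar>1 / n * (\<Sum>i=1..n. cos (\<theta> + t * snd d i)) -
        (\<integral>\<omega>. cos (\<theta> + t * W 0 \<omega>) \<partial>N)\<bar> \<partial>data_law n (\<mu> n)) \<longlonglongrightarrow> 0"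
    and W_measurable: "\<And>a. a \<le> k \<Longrightarrow> W a \<in> borel_measurable N"
    and W_sq_integrable: "\<And>a. a \<le> k \<Longrightarrow> integrable N (\<lambda>\<omega>. (W a \<omega>)\<^sup>2)"
    and W_cos: "\<And>m \<theta> t. m \<le> k \<Longrightarrow> (\<integral>\<omega>. cos (\<theta> + (\<Sum>a\<le>m. t a * W a \<omega>)) \<partial>N) =
        exp (- (\<integral>\<omega>. (\<Sum>a<m. t (Suc a) * f a (W a \<omega>))\<^sup>2 \<partial>N) / 2) * (\<integral>\<omega>. cos (\<theta> + t 0 * W 0 \<omega>) \<partial>N)"
begin

sublocale cs: cavity_space n "\<mu> n" f B L for n
  by (rule cavity_space)

definition W_mean :: "nat \<Rightarrow> ((nat \<Rightarrow> real) \<Rightarrow> real) \<Rightarrow> real" where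
  "W_mean m \<psi> = (\<integral>\<omega>. \<psi> (\<lambda>a\<in>{..m}. W a \<omega>) \<partial>N)"

text \<open>Since every size \<open>s\<close> is covered, level \<open>m + 1\<close> with
  \<open>s\<close> removed indices can call level \<open>m\<close> with \<open>s + 1\<close> of
  them.\<close>

definition converges :: "nat \<Rightarrow> ((nat \<Rightarrow> real) \<Rightarrow> real) \<Rightarrow> bool" where
  "converges m \<psi> \<longleftrightarrow> (\<forall>s \<epsilon>. \<epsilon> > 0 \<longrightarrow> (\<forall>\<^sub>F n in sequentially. \<forall>S. S \<subseteq> {1..n} \<and> card S \<le> s \<longrightarrow>
     (\<integral>d. \<bar>cs.average n m \<psi> S d - W_mean m \<psi>\<bar> \<partial>data_law n (\<mu> n)) \<le> \<epsilon>))"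

lemma convergesD:
  "converges m \<psi> \<Longrightarrow> \<epsilon> > 0 \<Longrightarrow> \<forall>\<^sub>F n in sequentially. \<forall>S. S \<subseteq> {1..n} \<and> card S \<le> s \<longrightarrow>
     (\<integral>d. \<bar>cs.average n m \<psi> S d - W_mean m \<psi>\<bar> \<partial>data_law n (\<mu> n)) \<le> \<epsilon>"
  by (auto simp: converges_def)

lemma vector_measurable: "m \<le> k \<Longrightarrow> (\<lambda>\<omega>. \<lambda>a\<in>{..m}. W a \<omega>) \<in> measurable N (\<Pi>\<^sub>M a\<in>{..m}. borel)"
  by (intro measurable_restrict W_measurable) auto

lemma vector_integrable:
  fixes C :: real
  assumes "m \<le> k" "\<psi> \<in> borel_measurable (\<Pi>\<^sub>M a\<in>{..m}. borel)" "\<And>x. x \<in> {..m} \<rightarrow>\<^sub>E UNIV \<Longrightarrow> \<bar>\<psi> x\<bar> \<le> C"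
  shows "integrable N (\<lambda>\<omega>. \<psi> (\<lambda>a\<in>{..m}. W a \<omega>))"
  using assms(3) by (intro N.integrable_const_bound[of _ C] measurable_compose[OF vector_measurable[OF assms(1)] assms(2)]) auto

lemma average_diff_integrable:
  assumes "\<psi> \<in> borel_measurable (\<Pi>\<^sub>M a\<in>{..m}. borel)" "\<And>x. x \<in> {..m} \<rightarrow>\<^sub>E UNIV \<Longrightarrow> \<bar>\<psi> x\<bar> \<le> C"
  shows "integrable (data_law n (\<mu> n)) (\<lambda>d. \<bar>cs.average n m \<psi> S d - c\<bar>)"
proof -
  have C: "C \<ge> 0" using assms(2)[of "\<lambda>a\<in>{..m}. 0"] by (auto intro: order_trans[OF abs_ge_zero])
  have "integrable (data_law n (\<mu> n)) (cs.average n m \<psi> S)"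
    by (rule cs.bounded_integrable[OF cs.average_measurable[OF assms(1)] cs.average_abs_le[OF assms(2) C]])
  then show ?thesis by (intro integrable_abs Bochner_Integration.integrable_diff cs.integrable_const)
qed

lemma converges_trig_sums:
  assumes m: "m \<le> k" and wave: "\<And>\<theta> t. converges m (\<lambda>x. cos (\<theta> + (\<Sum>a\<le>m. t a * x a)))"
    and p: "p \<in> trig_sums m"
  shows "converges m p"
  using p
proof induction
  case (wave \<theta> t)
  then show ?case by (rule assms(2))
next
  case (add p q)
  obtain C C' where C: "\<And>x. \<bar>p x\<bar> \<le> C" and C': "\<And>x. \<bar>q x\<bar> \<le> C'"
    using add.hyps trig_sums_bounded by metis
  have mp: "p \<in> borel_measurable (\<Pi>\<^sub>M a\<in>{..m}. borel)" and mq: "q \<in> borel_measurable (\<Pi>\<^sub>M a\<in>{..m}. borel)"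
    using add.hyps trig_sums_measurable by auto
  have W: "W_mean m (\<lambda>x. p x + q x) = W_mean m p + W_mean m q"
    unfolding W_mean_def by (intro Bochner_Integration.integral_add vector_integrable[OF m mp C] vector_integrable[OF m mq C'])
  have A: "cs.average n m (\<lambda>x. p x + q x) S d = cs.average n m p S d + cs.average n m q S d" for n S d
    by (simp add: cs.average_def sum.distrib distrib_left)
  show ?case unfolding converges_def
  proof (intro allI impI)
    fix s :: nat and \<epsilon> :: real assume e: "\<epsilon> > 0"
    then have e2: "\<epsilon> / 2 > 0" by simp
    show "\<forall>\<^sub>F n in sequentially. \<forall>S. S \<subseteq> {1..n} \<and> card S \<le> s \<longrightarrow>
     (\<integral>d. \<bar>cs.average n m (\<lambda>x. p x + q x) S d - W_mean m (\<lambda>x. p x + q x)\<bar> \<partial>data_law n (\<mu> n)) \<le> \<epsilon>"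
      using convergesD[OF add.IH(1) e2, of s] convergesD[OF add.IH(2) e2, of s]
    proof eventually_elim
      case (elim n)
      show ?case
      proof (intro allI impI)
        fix S assume S: "S \<subseteq> {1..n} \<and> card S \<le> s"
        have "(\<integral>d. \<bar>cs.average n m (\<lambda>x. p x + q x) S d - W_mean m (\<lambda>x. p x + q x)\<bar> \<partial>data_law n (\<mu> n)) \<le>
          (\<integral>d. \<bar>cs.average n m p S d - W_mean m p\<bar> + \<bar>cs.average n m q S d - W_mean m q\<bar> \<partial>data_law n (\<mu> n))"
        proof (rule integral_mono)
          have "integrable (data_law n (\<mu> n)) (\<lambda>d. \<bar>cs.average n m (\<lambda>x. p x + q x) S d - W_mean m (\<lambda>x. p x + q x)\<bar>)"
          proof (rule average_diff_integrable)
            show "\<bar>p x + q x\<bar> \<le> C + C'" for x using C[of x] C'[of x] by linarith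
          qed (intro borel_measurable_add mp mq)
          then show "integrable (data_law n (\<mu> n)) (\<lambda>d. \<bar>cs.average n m (\<lambda>x. p x + q x) S d - W_mean m (\<lambda>x. p x + q x)\<bar>)" .
          show "integrable (data_law n (\<mu> n)) (\<lambda>d. \<bar>cs.average n m p S d - W_mean m p\<bar> + \<bar>cs.average n m q S d - W_mean m q\<bar>)"
            by (intro Bochner_Integration.integrable_add average_diff_integrable[OF mp C] average_diff_integrable[OF mq C'])
        qed (simp add: A W)
        also have "\<dots> = (\<integral>d. \<bar>cs.average n m p S d - W_mean m p\<bar> \<partial>data_law n (\<mu> n)) + (\<integral>d. \<bar>cs.average n m q S d - W_mean m q\<bar> \<partial>data_law n (\<mu> n))"
          by (intro Bochner_Integration.integral_add average_diff_integrable[OF mp C] average_diff_integrable[OF mq C'])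
        also have "\<dots> \<le> \<epsilon> / 2 + \<epsilon> / 2" using elim S by (intro add_mono) auto
        finally show "(\<integral>d. \<bar>cs.average n m (\<lambda>x. p x + q x) S d - W_mean m (\<lambda>x. p x + q x)\<bar> \<partial>data_law n (\<mu> n)) \<le> \<epsilon>"
          by simp
      qed
    qed
  qed
next
  case (scale p c)
  have W: "W_mean m (\<lambda>x. c * p x) = c * W_mean m p"
    by (simp add: W_mean_def)
  have A: "cs.average n m (\<lambda>x. c * p x) S d = c * cs.average n m p S d" for n S d
    by (simp add: cs.average_def sum_distrib_left mult_ac)
  have eq: "(\<integral>d. \<bar>cs.average n m (\<lambda>x. c * p x) S d - W_mean m (\<lambda>x. c * p x)\<bar> \<partial>data_law n (\<mu> n)) =
     \<bar>c\<bar> * (\<integral>d. \<bar>cs.average n m p S d - W_mean m p\<bar> \<partial>data_law n (\<mu> n))" for n S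
    by (simp add: A W abs_mult flip: right_diff_distrib)
  show ?case unfolding converges_def eq
  proof (intro allI impI)
    fix s :: nat and \<epsilon> :: real assume e: "\<epsilon> > 0"
    then have e2: "\<epsilon> / (\<bar>c\<bar> + 1) > 0" by simp
    show "\<forall>\<^sub>F n in sequentially. \<forall>S. S \<subseteq> {1..n} \<and> card S \<le> s \<longrightarrow>
        \<bar>c\<bar> * (\<integral>d. \<bar>cs.average n m p S d - W_mean m p\<bar> \<partial>data_law n (\<mu> n)) \<le> \<epsilon>"
      using convergesD[OF scale.IH e2, of s]
    proof eventually_elim
      case (elim n)
      show ?case
      proof (intro allI impI)
        fix S assume S: "S \<subseteq> {1..n} \<and> card S \<le> s"
        have "\<bar>c\<bar> * (\<integral>d. \<bar>cs.average n m p S d - W_mean m p\<bar> \<partial>data_law n (\<mu> n)) \<le> (\<bar>c\<bar> + 1) * (\<epsilon> / (\<bar>c\<bar> + 1))"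
          using elim S by (intro mult_mono) auto
        then show "\<bar>c\<bar> * (\<integral>d. \<bar>cs.average n m p S d - W_mean m p\<bar> \<partial>data_law n (\<mu> n)) \<le> \<epsilon>"
          by simp
      qed
    qed
  qed
qed

text \<open>The approximation error is at most \<open>e\<close> times the average of
  \<open>q\<close>, whose mean is bounded uniformly in \<open>n > 0\<close> and \<open>S\<close>; in
  the limit it is at most \<open>e * W_mean m q\<close>.\<close>

lemma converges_bounded_Lipschitz:
  assumes m: "m \<le> k" and trig: "\<And>p. p \<in> trig_sums m \<Longrightarrow> converges m p"
    and psi: "bounded_Lipschitz m \<psi>"
  shows "converges m \<psi>"
  unfolding converges_def
proof (intro allI impI)
  fix s :: nat and \<epsilon> :: real assume \<epsilon>: "\<epsilon> > 0"
  define q where "q = (\<lambda>x :: nat \<Rightarrow> real. 1 + (\<Sum>a\<le>m. (x a)\<^sup>2))"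
  \<comment> \<open>The sum of both bounds for the weight. Half of \<open>\<epsilon>\<close> goes to
    \<open>e * K\<close>, the other half to the trigonometric sum.\<close>
  define K where "K = 2 + (\<Sum>a<m. (B a)\<^sup>2) + W_mean m q"
  have Wq_int: "integrable N (\<lambda>\<omega>. q (\<lambda>a\<in>{..m}. W a \<omega>))"
    unfolding q_def using m
    by (auto intro!: Bochner_Integration.integrable_add Bochner_Integration.integrable_sum W_sq_integrable)
  have "W_mean m q \<ge> 0" unfolding W_mean_def q_def by (intro Bochner_Integration.integral_nonneg) (simp add: sum_nonneg)
  then have K: "K > 0" unfolding K_def
    by (intro add_pos_nonneg) (auto simp: sum_nonneg)
  define e where "e = \<epsilon> / (2 * K)"
  have e: "e > 0" using \<epsilon> K by (simp add: e_def)
  obtain p where p: "p \<in> trig_sums m" and pe': "\<And>x. \<bar>\<psi> (restrict x {..m}) - p x\<bar> \<le> e * (1 + (\<Sum>a\<le>m. (x a)\<^sup>2))"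
    using bounded_Lipschitz_trig_approx[OF psi e] by metis
  have pe: "\<bar>\<psi> x - p x\<bar> \<le> e * q x" if "x \<in> {..m} \<rightarrow>\<^sub>E UNIV" for x
    using pe'[of x] that by (simp add: q_def PiE_restrict)
  obtain C where C: "\<And>x. x \<in> {..m} \<rightarrow>\<^sub>E UNIV \<Longrightarrow> \<bar>\<psi> x\<bar> \<le> C"
    using psi unfolding bounded_Lipschitz_def bounded_iff by auto
  obtain C' where C': "\<And>x. \<bar>p x\<bar> \<le> C'" using trig_sums_bounded[OF p] by auto
  note mpsi = bounded_Lipschitz_measurable[OF psi] and mp = trig_sums_measurable[OF p]
  have WW: "\<bar>W_mean m \<psi> - W_mean m p\<bar> \<le> e * W_mean m q"
  proof -
    have "\<bar>W_mean m \<psi> - W_mean m p\<bar> = \<bar>\<integral>\<omega>. \<psi> (\<lambda>a\<in>{..m}. W a \<omega>) - p (\<lambda>a\<in>{..m}. W a \<omega>) \<partial>N\<bar>"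
      unfolding W_mean_def
      by (subst Bochner_Integration.integral_diff[OF vector_integrable[OF m mpsi C] vector_integrable[OF m mp C']]) auto
    also have "\<dots> \<le> (\<integral>\<omega>. \<bar>\<psi> (\<lambda>a\<in>{..m}. W a \<omega>) - p (\<lambda>a\<in>{..m}. W a \<omega>)\<bar> \<partial>N)"
      by (rule integral_abs_bound)
    also have "\<dots> \<le> (\<integral>\<omega>. e * q (\<lambda>a\<in>{..m}. W a \<omega>) \<partial>N)"
      using vector_integrable[OF m mpsi C] vector_integrable[OF m mp C'] Wq_int
      by (intro integral_mono pe) auto
    finally show ?thesis by (simp add: W_mean_def)
  qed
  have \<epsilon>2: "\<epsilon> / 2 > 0" using \<epsilon> by simp
  show "\<forall>\<^sub>F n in sequentially. \<forall>S. S \<subseteq> {1..n} \<and> card S \<le> s \<longrightarrow>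
     (\<integral>d. \<bar>cs.average n m \<psi> S d - W_mean m \<psi>\<bar> \<partial>data_law n (\<mu> n)) \<le> \<epsilon>"
    using convergesD[OF trig[OF p] \<epsilon>2, of s] eventually_gt_at_top[of 0]
  proof eventually_elim
    case (elim n)
    show ?case
    proof (intro allI impI)
      fix S assume S: "S \<subseteq> {1..n} \<and> card S \<le> s"
      note qi = cs.average_second_moment[OF elim(2), of m S, folded q_def]
      have "(\<integral>d. \<bar>cs.average n m \<psi> S d - W_mean m \<psi>\<bar> \<partial>data_law n (\<mu> n)) \<le>
        (\<integral>d. \<bar>cs.average n m p S d - W_mean m p\<bar> + e * cs.average n m q S d + e * W_mean m q \<partial>data_law n (\<mu> n))"
      proof (rule integral_mono)
        show "integrable (data_law n (\<mu> n)) (\<lambda>d. \<bar>cs.average n m \<psi> S d - W_mean m \<psi>\<bar>)"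
          by (rule average_diff_integrable[OF mpsi C])
        show "integrable (data_law n (\<mu> n)) (\<lambda>d. \<bar>cs.average n m p S d - W_mean m p\<bar> + e * cs.average n m q S d + e * W_mean m q)"
          by (intro Bochner_Integration.integrable_add average_diff_integrable[OF mp C'] integrable_mult_right qi(1) cs.integrable_const)
        fix d
        have "cs.average n m (\<lambda>x. \<psi> x - p x) S d = cs.average n m \<psi> S d - cs.average n m p S d"
          by (simp add: cs.average_def sum_subtractf right_diff_distrib)
        moreover have "cs.average n m (\<lambda>x. \<psi> x - p x) S d \<le> cs.average n m (\<lambda>x. e * q x) S d"
          by (rule cs.average_mono) (use pe abs_le_D1 in blast)
        moreover have "cs.average n m (\<lambda>x. - (e * q x)) S d \<le> cs.average n m (\<lambda>x. \<psi> x - p x) S d"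
          by (rule cs.average_mono) (use pe abs_le_D2 in force)
        moreover have "cs.average n m (\<lambda>x. e * q x) S d = e * cs.average n m q S d"
          "cs.average n m (\<lambda>x. - (e * q x)) S d = - (e * cs.average n m q S d)"
          by (simp_all add: cs.average_def sum_distrib_left sum_negf mult_ac)
        ultimately show "\<bar>cs.average n m \<psi> S d - W_mean m \<psi>\<bar> \<le> \<bar>cs.average n m p S d - W_mean m p\<bar> + e * cs.average n m q S d + e * W_mean m q"
          using WW by linarith
      qed
      also have "\<dots> = (\<integral>d. \<bar>cs.average n m p S d - W_mean m p\<bar> \<partial>data_law n (\<mu> n)) + e * (\<integral>d. cs.average n m q S d \<partial>data_law n (\<mu> n)) + e * W_mean m q"
        using average_diff_integrable[OF mp C'] qi(1) cs.prob_space[of n]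
        by (subst Bochner_Integration.integral_add; (subst Bochner_Integration.integral_add)?) auto
      also have "\<dots> \<le> \<epsilon> / 2 + e * (2 + (\<Sum>a<m. (B a)\<^sup>2)) + e * W_mean m q"
        using elim S e qi(2) by (intro add_mono mult_left_mono) auto
      also have "\<dots> = \<epsilon> / 2 + e * K" by (simp add: K_def distrib_left)
      also have "\<dots> = \<epsilon>" using K by (simp add: e_def)
      finally show "(\<integral>d. \<bar>cs.average n m \<psi> S d - W_mean m \<psi>\<bar> \<partial>data_law n (\<mu> n)) \<le> \<epsilon>" .
    qed
  qed
qed

end

section \<open>Induction over the levels\<close>

context cavity_sequence
begin

lemma L_nonneg: "L a \<ge> 0"
  using order_trans[OF abs_ge_zero cs.f_Lipschitz[of a 1 0]] by simp

text \<open>The link between levels: the row variance at level \<open>m + 1\<close> averages a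
  function of this kind over the levels up to \<open>m\<close>. Squaring keeps the Lipschitz
  property because the sum is bounded.\<close>

lemma row_variance_bounded_Lipschitz:
  "bounded_Lipschitz m (\<lambda>x. (\<Sum>a\<le>m. c a * f a (x a))\<^sup>2)"
proof -
  define X where "X x = (\<Sum>a\<le>m. c a * f a (x a))" for x :: "nat \<Rightarrow> real"
  define K where "K = (\<Sum>a\<le>m. \<bar>c a\<bar> * B a)"
  define L' where "L' = (\<Sum>a\<le>m. \<bar>c a\<bar> * L a)"
  have XK: "\<bar>X x\<bar> \<le> K" for x
  proof -
    have "\<bar>X x\<bar> \<le> (\<Sum>a\<le>m. \<bar>c a * f a (x a)\<bar>)" unfolding X_def by (rule sum_abs)
    also have "\<dots> \<le> K" unfolding K_def abs_mult by (intro sum_mono mult_left_mono cs.f_bound) auto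
    finally show ?thesis .
  qed
  have XL: "\<bar>X x - X y\<bar> \<le> L' * L2_set (\<lambda>a. x a - y a) {..m}" for x y
  proof -
    have "\<bar>X x - X y\<bar> = \<bar>\<Sum>a\<le>m. c a * (f a (x a) - f a (y a))\<bar>"
      by (simp add: X_def right_diff_distrib sum_subtractf)
    also have "\<dots> \<le> (\<Sum>a\<le>m. \<bar>c a\<bar> * \<bar>f a (x a) - f a (y a)\<bar>)"
      unfolding abs_mult[symmetric] by (rule sum_abs)
    also have "\<dots> \<le> (\<Sum>a\<le>m. \<bar>c a\<bar> * (L a * L2_set (\<lambda>a. x a - y a) {..m}))"
    proof (intro sum_mono mult_left_mono)
      fix a assume a: "a \<in> {..m}"
      have "\<bar>f a (x a) - f a (y a)\<bar> \<le> L a * \<bar>x a - y a\<bar>" by (rule cs.f_Lipschitz)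
      also have "\<dots> \<le> L a * L2_set (\<lambda>a. x a - y a) {..m}"
      proof (rule mult_left_mono[OF _ L_nonneg])
        have "\<bar>x a - y a\<bar> \<le> L2_set (\<lambda>a. \<bar>x a - y a\<bar>) {..m}"
          using a by (intro member_le_L2_set) auto
        then show "\<bar>x a - y a\<bar> \<le> L2_set (\<lambda>a. x a - y a) {..m}"
          by (simp add: L2_set_def)
      qed
      finally show "\<bar>f a (x a) - f a (y a)\<bar> \<le> L a * L2_set (\<lambda>a. x a - y a) {..m}" .
    qed auto
    also have "\<dots> = L' * L2_set (\<lambda>a. x a - y a) {..m}"
      by (simp add: L'_def sum_distrib_right mult.assoc)
    finally show ?thesis .
  qed
  have K0: "K \<ge> 0" using XK[of "\<lambda>_. 0"] by linarith
  have "\<bar>(X x)\<^sup>2 - (X y)\<^sup>2\<bar> \<le> (2 * K * L') * L2_set (\<lambda>a. x a - y a) {..m}" for x y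
  proof -
    have "\<bar>(X x)\<^sup>2 - (X y)\<^sup>2\<bar> = \<bar>X x + X y\<bar> * \<bar>X x - X y\<bar>"
      unfolding abs_mult[symmetric] by (simp add: power2_eq_square algebra_simps)
    also have "\<dots> \<le> (2 * K) * (L' * L2_set (\<lambda>a. x a - y a) {..m})"
      using XK[of x] XK[of y] K0 by (intro mult_mono XL) auto
    finally show ?thesis by (simp add: mult.assoc)
  qed
  moreover have "bounded ((\<lambda>x. (X x)\<^sup>2) ` ({..m} \<rightarrow>\<^sub>E UNIV))"
    unfolding bounded_iff
  proof (intro exI ballI)
    fix y assume "y \<in> (\<lambda>x. (X x)\<^sup>2) ` ({..m} \<rightarrow>\<^sub>E UNIV)"
    then obtain x where "y = (X x)\<^sup>2" by auto
    then show "norm y \<le> K\<^sup>2" using XK[of x] K0 by (simp add: power2_le_iff_abs_le)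
  qed
  ultimately show ?thesis
    unfolding bounded_Lipschitz_def X_def[symmetric] by blast
qed

text \<open>For \<open>m = Suc m'\<close> the row variance is literally an average at level
  \<open>m'\<close>. For \<open>m = 0\<close> there is no Gaussian level and both variances vanish;
  hence the guard \<open>m = Suc m'\<close> on the induction hypothesis.\<close>

lemma row_var_limit:
  assumes m: "m \<le> k" and IH: "\<And>m' \<psi>. m = Suc m' \<Longrightarrow> bounded_Lipschitz m' \<psi> \<Longrightarrow> converges m' \<psi>"
    and \<eta>: "\<eta> > 0"
  shows "\<forall>\<^sub>F n in sequentially. \<forall>S. S \<subseteq> {1..n} \<and> card S \<le> s \<longrightarrow>
     (\<integral>d. \<bar>cs.row_var n t m S d - (\<integral>\<omega>. (\<Sum>a<m. t (Suc a) * f a (W a \<omega>))\<^sup>2 \<partial>N)\<bar> \<partial>data_law n (\<mu> n)) \<le> \<eta>"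
proof (cases m)
  case 0
  then show ?thesis using \<eta> by (simp add: cs.row_var_def)
next
  case (Suc m')
  let ?g = "\<lambda>x. (\<Sum>a\<le>m'. t (Suc a) * f a (x a))\<^sup>2"
  have "converges m' ?g" by (intro IH Suc row_variance_bounded_Lipschitz)
  note conv = convergesD[OF this \<eta>, of s]
  have row: "cs.row_var n t m S = cs.average n m' ?g S" for n S
    by (simp add: cs.row_var_def[abs_def] cs.average_def[abs_def] Suc lessThan_Suc_atMost)
  have W: "W_mean m' ?g = (\<integral>\<omega>. (\<Sum>a<m. t (Suc a) * f a (W a \<omega>))\<^sup>2 \<partial>N)"
    by (simp add: W_mean_def Suc lessThan_Suc_atMost)
  show ?thesis using conv unfolding row[symmetric] W .
qed

text \<open>Three errors are separated: the averaged \<open>F i\<close>, small by the second moment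
  bound; the full initial average, small by \<open>initial_limit\<close>; and the summands of
  \<open>S\<close> missing from it, at most \<open>s / n\<close>.\<close>

lemma converges_wave:
  assumes m: "m \<le> k" and IH: "\<And>m' \<psi>. m = Suc m' \<Longrightarrow> bounded_Lipschitz m' \<psi> \<Longrightarrow> converges m' \<psi>"
  shows "converges m (\<lambda>x. cos (\<theta> + (\<Sum>a\<le>m. t a * x a)))"
  unfolding converges_def
proof (intro allI impI)
  fix s :: nat and \<epsilon> :: real assume \<epsilon>: "\<epsilon> > 0"
  define v where "v = (\<integral>\<omega>. (\<Sum>a<m. t (Suc a) * f a (W a \<omega>))\<^sup>2 \<partial>N)"
  define \<kappa> where "\<kappa> = exp (- v / 2)"
  define c where "c = (\<integral>\<omega>. cos (\<theta> + t 0 * W 0 \<omega>) \<partial>N)"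
  define C where "C = 2 * (\<Sum>a\<le>m. \<bar>t a\<bar> * (1 + cavity_gap B L a))"
  \<comment> \<open>The averaged \<open>F i\<close> may cost 2\<delta>, the other two errors
    \<delta> each. The second moment gets divided by \<delta>, so its deterministic and its variance
    part are allowed \<open>\<delta>\<^sup>2 / 2\<close> each.\<close>
  define \<delta> where "\<delta> = \<epsilon> / 4"
  let ?\<phi> = "\<lambda>x :: nat \<Rightarrow> real. cos (\<theta> + (\<Sum>a\<le>m. t a * x a))"
  have \<delta>: "\<delta> > 0" and \<eta>: "\<delta>\<^sup>2 / 2 > 0" using \<epsilon> by (auto simp: \<delta>_def)
  have v: "v \<ge> 0" unfolding v_def by simp
  then have \<kappa>: "0 \<le> \<kappa>" "\<kappa> \<le> 1" by (auto simp: \<kappa>_def)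
  have Wm: "W_mean m ?\<phi> = \<kappa> * c"
    unfolding W_mean_def \<kappa>_def c_def v_def using W_cos[OF m, of \<theta> t] by simp
  have "(\<lambda>n. 4 / real n + C / sqrt (real n)) \<longlonglongrightarrow> 0 + 0"
    by (intro tendsto_add lim_const_over_n real_tendsto_divide_at_top[OF tendsto_const]
        filterlim_compose[OF sqrt_at_top filterlim_real_sequentially])
  then have ev1: "\<forall>\<^sub>F n in sequentially. 4 / real n + C / sqrt (real n) < \<delta>\<^sup>2 / 2"
    by (rule order_tendstoD(2)) (use \<eta> in simp)
  have "(\<lambda>n. real s / real n) \<longlonglongrightarrow> 0" by (rule lim_const_over_n)
  then have ev2: "\<forall>\<^sub>F n in sequentially. real s / real n < \<delta>"
    by (rule order_tendstoD(2)) (rule \<delta>)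
  have ev3: "\<forall>\<^sub>F n in sequentially. (\<integral>d. \<bar>1 / n * (\<Sum>i=1..n. cos (\<theta> + t 0 * snd d i)) - c\<bar> \<partial>data_law n (\<mu> n)) < \<delta>"
    unfolding c_def by (rule order_tendstoD(2)[OF initial_limit \<delta>])
  \<comment> \<open>\<open>Suc s\<close>, since the variance met at index \<open>i\<close> has
    \<open>insert i S\<close> removed.\<close>
  have ev4: "\<forall>\<^sub>F n in sequentially. \<forall>S. S \<subseteq> {1..n} \<and> card S \<le> Suc s \<longrightarrow>
     (\<integral>d. \<bar>cs.row_var n t m S d - v\<bar> \<partial>data_law n (\<mu> n)) \<le> \<delta>\<^sup>2 / 2"
    unfolding v_def by (rule row_var_limit[OF m IH \<eta>])
  show "\<forall>\<^sub>F n in sequentially. \<forall>S. S \<subseteq> {1..n} \<and> card S \<le> s \<longrightarrow>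
     (\<integral>d. \<bar>cs.average n m ?\<phi> S d - W_mean m ?\<phi>\<bar> \<partial>data_law n (\<mu> n)) \<le> \<epsilon>"
    using ev1 ev2 ev3 ev4 eventually_gt_at_top[of 0]
  proof eventually_elim
    case (elim n)
    note n = \<open>0 < n\<close>
    show ?case
    proof (intro allI impI)
      fix S assume S: "S \<subseteq> {1..n} \<and> card S \<le> s"
      then have fS: "finite S" by (auto intro: finite_subset)
      let ?J = "{1..n} - S"
      let ?F = "\<lambda>i d. cs.wave n \<theta> t m S i d - \<kappa> * cs.wave n \<theta> t 0 S i d"
      let ?U = "\<lambda>d. 1 / n * (\<Sum>i=1..n. cos (\<theta> + t 0 * snd d i)) - c"
      have "(\<integral>d. \<bar>1 / n * (\<Sum>i\<in>?J. ?F i d)\<bar> \<partial>data_law n (\<mu> n)) \<le>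
         \<delta> + (4 / n + 2 * (\<Sum>a\<le>m. \<bar>t a\<bar> * (1 + cavity_gap B L a)) / sqrt n + \<delta>\<^sup>2 / 2) / \<delta>"
        unfolding \<kappa>_def
      proof (rule cs.expectation_wave_average_le[OF v n \<delta>])
        fix i assume i: "i \<in> ?J"
        have "card (insert i S) \<le> Suc s" using S fS by (simp add: card_insert_if)
        then show "(\<integral>d. \<bar>cs.row_var n t m (insert i S) d - v\<bar> \<partial>data_law n (\<mu> n)) \<le> \<delta>\<^sup>2 / 2"
          using elim(4) S i by auto
      qed (use \<eta> in simp)
      also have "\<dots> \<le> \<delta> + \<delta>\<^sup>2 / \<delta>"
        using elim(1) \<delta> unfolding C_def by (intro add_left_mono divide_right_mono) auto
      also have "\<dots> = 2 * \<delta>" using \<delta> by (simp add: power2_eq_square)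
      finally have p1: "(\<integral>d. \<bar>1 / n * (\<Sum>i\<in>?J. ?F i d)\<bar> \<partial>data_law n (\<mu> n)) \<le> 2 * \<delta>" .
      have Fint: "integrable (data_law n (\<mu> n)) (\<lambda>d. \<bar>1 / n * (\<Sum>i\<in>?J. ?F i d)\<bar>)"
        by (intro integrable_abs integrable_mult_right Bochner_Integration.integrable_sum
            Bochner_Integration.integrable_diff cs.bounded_integrable[OF cs.wave_measurable cs.wave_abs_le]) auto
      have cos_int: "integrable (data_law n (\<mu> n)) (\<lambda>d. cos (\<theta> + t 0 * snd d i))" if "i \<in> {1..n}" for i
        using cs.bounded_integrable[OF cs.wave_measurable[OF that, of \<theta> t 0 "{}"] cs.wave_abs_le] by (simp add: cs.wave_0)
      have Uint: "integrable (data_law n (\<mu> n)) (\<lambda>d. \<bar>?U d\<bar>)"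
        by (intro integrable_abs Bochner_Integration.integrable_diff integrable_mult_right
            Bochner_Integration.integrable_sum cos_int cs.integrable_const)
      have le: "\<bar>cs.average n m ?\<phi> S d - W_mean m ?\<phi>\<bar> \<le> \<bar>1 / n * (\<Sum>i\<in>?J. ?F i d)\<bar> + \<bar>?U d\<bar> + \<delta>" for d
      proof -
        have av: "cs.average n m ?\<phi> S d = 1 / n * (\<Sum>i\<in>?J. cs.wave n \<theta> t m S i d)"
          by (simp add: cs.average_def cs.wave_def)
        have "(\<Sum>i=1..n. cos (\<theta> + t 0 * snd d i)) = (\<Sum>i\<in>?J. cos (\<theta> + t 0 * snd d i)) + (\<Sum>i\<in>S. cos (\<theta> + t 0 * snd d i))"
          using S by (intro sum.subset_diff) auto
        then have U: "1 / n * (\<Sum>i\<in>?J. cos (\<theta> + t 0 * snd d i)) - c = ?U d - 1 / n * (\<Sum>i\<in>S. cos (\<theta> + t 0 * snd d i))"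
          by (simp add: distrib_left add_divide_distrib)
        have "\<bar>\<Sum>i\<in>S. cos (\<theta> + t 0 * snd d i)\<bar> \<le> (\<Sum>i\<in>S. \<bar>cos (\<theta> + t 0 * snd d i)\<bar>)"
          by (rule sum_abs)
        also have "\<dots> \<le> real (card S) * 1" by (intro sum_bounded_above) auto
        also have "\<dots> \<le> real s" using S by simp
        finally have "\<bar>1 / n * (\<Sum>i\<in>S. cos (\<theta> + t 0 * snd d i))\<bar> \<le> real s / n"
          using n by (simp add: abs_mult divide_right_mono)
        then have "\<bar>1 / n * (\<Sum>i\<in>?J. cos (\<theta> + t 0 * snd d i)) - c\<bar> \<le> \<bar>?U d\<bar> + \<delta>"
          unfolding U using elim(2) by linarith
        then have "\<kappa> * \<bar>1 / n * (\<Sum>i\<in>?J. cos (\<theta> + t 0 * snd d i)) - c\<bar> \<le> 1 * (\<bar>?U d\<bar> + \<delta>)"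
          using \<kappa> by (intro mult_mono) auto
        \<comment> \<open>Two moves lead to the limit \<open>\<kappa> * c\<close>: from the waves to
          \<open>\<kappa>\<close> times the initial cosines, then from the average of those to
          \<open>c\<close>.\<close>
        moreover have "cs.average n m ?\<phi> S d - W_mean m ?\<phi> =
            1 / n * (\<Sum>i\<in>?J. ?F i d) + \<kappa> * (1 / n * (\<Sum>i\<in>?J. cos (\<theta> + t 0 * snd d i)) - c)"
          unfolding av Wm by (simp add: cs.wave_0 sum_subtractf sum_distrib_left right_diff_distrib diff_divide_distrib mult_ac sum_divide_distrib)
        ultimately show ?thesis
          using abs_triangle_ineq[of "1 / n * (\<Sum>i\<in>?J. ?F i d)" "\<kappa> * (1 / n * (\<Sum>i\<in>?J. cos (\<theta> + t 0 * snd d i)) - c)"] \<kappa>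
          by (simp add: abs_mult[of \<kappa>])
      qed
      have "(\<integral>d. \<bar>cs.average n m ?\<phi> S d - W_mean m ?\<phi>\<bar> \<partial>data_law n (\<mu> n)) \<le>
          (\<integral>d. \<bar>1 / n * (\<Sum>i\<in>?J. ?F i d)\<bar> + \<bar>?U d\<bar> + \<delta> \<partial>data_law n (\<mu> n))"
        by (intro integral_mono le Bochner_Integration.integrable_add Fint Uint cs.integrable_const
            average_diff_integrable[OF trig_sums_measurable[OF trig_sums.wave], of _ _ _ 1]) auto
      also have "\<dots> = (\<integral>d. \<bar>1 / n * (\<Sum>i\<in>?J. ?F i d)\<bar> \<partial>data_law n (\<mu> n)) + (\<integral>d. \<bar>?U d\<bar> \<partial>data_law n (\<mu> n)) + \<delta>"
        using Fint Uint cs.prob_space[of n]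
        by (simp add: Bochner_Integration.integral_add Bochner_Integration.integrable_add)
      also have "\<dots> \<le> 2 * \<delta> + \<delta> + \<delta>"
        using p1 elim(3) by (intro add_mono) auto
      also have "\<dots> = \<epsilon>" by (simp add: \<delta>_def)
      finally show "(\<integral>d. \<bar>cs.average n m ?\<phi> S d - W_mean m ?\<phi>\<bar> \<partial>data_law n (\<mu> n)) \<le> \<epsilon>" .
    qed
  qed
qed

lemma cavity_average_converges:
  assumes "m \<le> k" "bounded_Lipschitz m \<psi>"
  shows "converges m \<psi>"
  using assms
proof (induction m arbitrary: \<psi>)
  case 0
  \<comment> \<open>At level 0 the guard \<open>0 = Suc m'\<close> is never satisfied, so the
    induction hypothesis is vacuous.\<close>
  have "converges 0 (\<lambda>x. cos (\<theta> + (\<Sum>a\<le>0. t a * x a)))" for \<theta> t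
    by (rule converges_wave) auto
  then show ?case
    using 0 converges_bounded_Lipschitz[OF _ converges_trig_sums] by blast
next
  case (Suc m)
  have "converges (Suc m) (\<lambda>x. cos (\<theta> + (\<Sum>a\<le>Suc m. t a * x a)))" for \<theta> t
    using Suc by (intro converges_wave) auto
  then show ?case
    using Suc.prems converges_bounded_Lipschitz[OF _ converges_trig_sums] by blast
qed

end

section \<open>Transfer to the given random variables\<close>

lemma bounded_smooth_bounds:
  assumes "bounded_smooth g"
  shows "\<exists>B L. \<forall>x y. \<bar>g x\<bar> \<le> B \<and> \<bar>g x - g y\<bar> \<le> L * \<bar>x - y\<bar>"
proof -
  have d: "g differentiable at x" and b: "bounded (range g)" "bounded (range (deriv g))" for x
    using assms[unfolded bounded_smooth_def, rule_format, of 0] assms[unfolded bounded_smooth_def, rule_format, of 1]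
    by auto
  obtain B where B: "\<And>x. \<bar>g x\<bar> \<le> B" using b(1) by (auto simp: bounded_iff)
  obtain L where L: "\<And>x. \<bar>deriv g x\<bar> \<le> L" using b(2) by (auto simp: bounded_iff)
  have "norm (g x - g y) \<le> L * norm (x - y)" for x y
  proof (rule field_differentiable_bound[of UNIV])
    show "(g has_field_derivative deriv g z) (at z within UNIV)" for z
      using d[of z] by (simp add: DERIV_deriv_iff_real_differentiable)
  qed (use L in auto)
  then show ?thesis using B by (intro exI[of _ B] exI[of _ L]) auto
qed

lemma distr_independent_rvs:
  assumes P: "prob_space P" and ind: "independent_rvs P S X T Y"
  shows "distr P (S \<Otimes>\<^sub>M T) (\<lambda>\<omega>. (X \<omega>, Y \<omega>)) = distr P S X \<Otimes>\<^sub>M distr P T Y"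
proof -
  interpret P: prob_space P by fact
  have X [measurable]: "X \<in> measurable P S" and Y [measurable]: "Y \<in> measurable P T"
    using ind by (auto simp: independent_rvs_def)
  interpret DX: prob_space "distr P S X" by (rule P.prob_space_distr[OF X])
  interpret DY: prob_space "distr P T Y" by (rule P.prob_space_distr[OF Y])
  show ?thesis
  proof (rule pair_measure_eqI[symmetric])
    fix A B assume "A \<in> sets (distr P S X)" "B \<in> sets (distr P T Y)"
    then have A [measurable]: "A \<in> sets S" and B [measurable]: "B \<in> sets T" by auto
    have "measure P {\<omega> \<in> space P. X \<omega> \<in> A \<and> Y \<omega> \<in> B} =
        measure P {\<omega> \<in> space P. X \<omega> \<in> A} * measure P {\<omega> \<in> space P. Y \<omega> \<in> B}"
      using ind A B by (auto simp: independent_rvs_def)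
    then show "emeasure (distr P S X) A * emeasure (distr P T Y) B =
        emeasure (distr P (S \<Otimes>\<^sub>M T) (\<lambda>\<omega>. (X \<omega>, Y \<omega>))) (A \<times> B)"
      by (simp add: emeasure_distr P.emeasure_eq_measure vimage_def Int_def ennreal_mult[symmetric] conj_commute conj_left_commute)
  qed (simp_all add: DX.sigma_finite_measure_axioms DY.sigma_finite_measure_axioms)
qed

text \<open>Passes independence from the full matrix to its entries above the diagonal, the
  coordinates of the canonical space.\<close>

lemma independent_rvs_compose1:
  assumes "independent_rvs P S X T Y" and g: "g \<in> measurable S S'"
  shows "independent_rvs P S' (\<lambda>\<omega>. g (X \<omega>)) T Y"
  unfolding independent_rvs_def
proof (intro conjI ballI)
  have X: "X \<in> measurable P S" and Y: "Y \<in> measurable P T"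
    using assms(1) by (auto simp: independent_rvs_def)
  show "(\<lambda>\<omega>. g (X \<omega>)) \<in> measurable P S'" using measurable_compose[OF X g] .
  show "Y \<in> measurable P T" by fact
  fix A B assume A: "A \<in> sets S'" and B: "B \<in> sets T"
  define A' where "A' = g -` A \<inter> space S"
  have A': "A' \<in> sets S" unfolding A'_def using g A by (rule measurable_sets)
  have "g (X \<omega>) \<in> A \<longleftrightarrow> X \<omega> \<in> A'" if "\<omega> \<in> space P" for \<omega>
    using measurable_space[OF X that] by (simp add: A'_def)
  then have "{\<omega> \<in> space P. g (X \<omega>) \<in> A \<and> Y \<omega> \<in> B} = {\<omega> \<in> space P. X \<omega> \<in> A' \<and> Y \<omega> \<in> B}"
    "{\<omega> \<in> space P. g (X \<omega>) \<in> A} = {\<omega> \<in> space P. X \<omega> \<in> A'}"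
    by auto
  then show "measure P {\<omega> \<in> space P. g (X \<omega>) \<in> A \<and> Y \<omega> \<in> B} =
      measure P {\<omega> \<in> space P. g (X \<omega>) \<in> A} * measure P {\<omega> \<in> space P. Y \<omega> \<in> B}"
    using assms(1) A' B by (simp add: independent_rvs_def)
qed

text \<open>Both cases of the definition obey one formula, with variance 0 in the degenerate case;
  otherwise \<open>X\<close> is \<open>\<sigma>\<close> times a standard normal variable.\<close>

lemma (in prob_space) centered_gaussian_moments:
  assumes "centered_gaussian M X"
  shows "integrable M (\<lambda>\<omega>. (X \<omega>)\<^sup>2)"
    and "expectation (\<lambda>\<omega>. cos (\<alpha> + X \<omega>)) = cos \<alpha> * exp (- expectation (\<lambda>\<omega>. (X \<omega>)\<^sup>2) / 2)"
proof -
  have X [measurable]: "X \<in> borel_measurable M" using assms by (simp add: centered_gaussian_def)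
  have "integrable M (\<lambda>\<omega>. (X \<omega>)\<^sup>2) \<and>
      expectation (\<lambda>\<omega>. cos (\<alpha> + X \<omega>)) = cos \<alpha> * exp (- expectation (\<lambda>\<omega>. (X \<omega>)\<^sup>2) / 2)"
    using assms unfolding centered_gaussian_def
  proof (elim conjE disjE exE)
    assume ae: "AE \<omega> in M. X \<omega> = 0"
    have i: "integrable M (\<lambda>\<omega>. (X \<omega>)\<^sup>2) \<longleftrightarrow> integrable M (\<lambda>\<omega>. 0 :: real)"
      using ae by (intro integrable_cong_AE) auto
    have e: "expectation (\<lambda>\<omega>. (X \<omega>)\<^sup>2) = expectation (\<lambda>\<omega>. 0)"
      using ae by (intro integral_cong_AE) auto
    have c: "expectation (\<lambda>\<omega>. cos (\<alpha> + X \<omega>)) = expectation (\<lambda>\<omega>. cos \<alpha>)"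
      using ae by (intro integral_cong_AE) auto
    show ?thesis using i e c prob_space by simp
  next
    fix \<sigma> :: real assume \<sigma>: "\<sigma> > 0" and d: "distributed M lborel X (normal_density 0 \<sigma>)"
    let ?N = std_normal_distribution
    define Z where "Z \<omega> = X \<omega> / \<sigma>" for \<omega>
    have [measurable]: "Z \<in> borel_measurable M" unfolding Z_def by measurable
    have "distributed M lborel Z std_normal_density"
      using d normal_standard_normal_convert[OF \<sigma>, of X 0] by (simp add: Z_def[abs_def])
    then have "distr M lborel Z = ?N" by (rule distributed_distr_eq_density)
    then have Zl: "distr M borel Z = ?N" by (metis distr_cong sets_lborel)
    have X_eq: "X \<omega> = Z \<omega> * \<sigma>" for \<omega> using \<sigma> by (simp add: Z_def)
    have "(\<integral>\<^sup>+\<omega>. ennreal ((X \<omega>)\<^sup>2) \<partial>M) = (\<integral>\<^sup>+r. ennreal ((0 + r * \<sigma>)\<^sup>2) \<partial>distr M borel Z)"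
      by (subst nn_integral_distr) (auto simp: X_eq)
    also have "\<dots> = ennreal (\<sigma>\<^sup>2)"
      unfolding Zl nn_integral_affine_sq_std_normal by simp
    finally have nn: "(\<integral>\<^sup>+\<omega>. ennreal ((X \<omega>)\<^sup>2) \<partial>M) = ennreal (\<sigma>\<^sup>2)" .
    then have int: "integrable M (\<lambda>\<omega>. (X \<omega>)\<^sup>2)"
      by (intro integrableI_nonneg) auto
    have v: "expectation (\<lambda>\<omega>. (X \<omega>)\<^sup>2) = \<sigma>\<^sup>2"
      by (subst integral_eq_nn_integral) (auto simp: nn)
    have "expectation (\<lambda>\<omega>. cos (\<alpha> + X \<omega>)) = (\<integral>r. cos (\<alpha> + r * \<sigma>) \<partial>distr M borel Z)"
      by (subst integral_distr) (auto simp: X_eq)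
    also have "\<dots> = cos \<alpha> * exp (- (\<sigma>\<^sup>2 / 2))"
      unfolding Zl by (rule integral_cos_std_normal)
    finally show ?thesis using int v by simp
  qed
  then show "integrable M (\<lambda>\<omega>. (X \<omega>)\<^sup>2)"
    "expectation (\<lambda>\<omega>. cos (\<alpha> + X \<omega>)) = cos \<alpha> * exp (- expectation (\<lambda>\<omega>. (X \<omega>)\<^sup>2) / 2)"
    by auto
qed

lemma integrable_mult_of_squares:
  fixes X Y :: "'a \<Rightarrow> real"
  assumes "X \<in> borel_measurable M" "Y \<in> borel_measurable M"
    and "integrable M (\<lambda>x. (X x)\<^sup>2)" "integrable M (\<lambda>x. (Y x)\<^sup>2)"
  shows "integrable M (\<lambda>x. X x * Y x)"
proof (rule Bochner_Integration.integrable_bound[OF Bochner_Integration.integrable_add[OF assms(3,4)]])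
  have "\<bar>x * y\<bar> \<le> x\<^sup>2 + y\<^sup>2" for x y :: real
  proof -
    have "2 * \<bar>x * y\<bar> \<le> x\<^sup>2 + y\<^sup>2"
      using sum_squares_bound[of "\<bar>x\<bar>" "\<bar>y\<bar>"] by (simp add: abs_mult mult.assoc)
    then show ?thesis using abs_ge_zero[of "x * y"] by linarith
  qed
  then show "AE x in M. norm (X x * Y x) \<le> norm ((X x)\<^sup>2 + (Y x)\<^sup>2)"
    by (intro always_eventually) auto
qed (use assms in measurable)

text \<open>Expanding the square leaves only pairwise mixed moments, so the covariance recursion, an
  identity for pairs, extends to all linear combinations.\<close>

lemma expectation_sum_square_eq:
  fixes X Y :: "'i \<Rightarrow> 'b \<Rightarrow> real"
  assumes X: "\<And>a b. a \<in> I \<Longrightarrow> b \<in> I \<Longrightarrow> integrable N (\<lambda>\<omega>. X a \<omega> * X b \<omega>)"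
    and Y: "\<And>a b. a \<in> I \<Longrightarrow> b \<in> I \<Longrightarrow> integrable N (\<lambda>\<omega>. Y a \<omega> * Y b \<omega>)"
    and eq: "\<And>a b. a \<in> I \<Longrightarrow> b \<in> I \<Longrightarrow> (\<integral>\<omega>. X a \<omega> * X b \<omega> \<partial>N) = (\<integral>\<omega>. Y a \<omega> * Y b \<omega> \<partial>N)"
  shows "(\<integral>\<omega>. (\<Sum>a\<in>I. c a * X a \<omega>)\<^sup>2 \<partial>N) = (\<integral>\<omega>. (\<Sum>a\<in>I. c a * Y a \<omega>)\<^sup>2 \<partial>N)"
proof -
  have expand: "(\<integral>\<omega>. (\<Sum>a\<in>I. c a * Z a \<omega>)\<^sup>2 \<partial>N) = (\<Sum>a\<in>I. \<Sum>b\<in>I. c a * c b * (\<integral>\<omega>. Z a \<omega> * Z b \<omega> \<partial>N))"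
    if Z: "\<And>a b. a \<in> I \<Longrightarrow> b \<in> I \<Longrightarrow> integrable N (\<lambda>\<omega>. Z a \<omega> * Z b \<omega>)" for Z :: "'i \<Rightarrow> 'b \<Rightarrow> real"
  proof -
    have "(\<integral>\<omega>. (\<Sum>a\<in>I. c a * Z a \<omega>)\<^sup>2 \<partial>N) = (\<integral>\<omega>. (\<Sum>a\<in>I. \<Sum>b\<in>I. c a * c b * (Z a \<omega> * Z b \<omega>)) \<partial>N)"
      by (simp add: power2_eq_square sum_product mult_ac)
    also have "\<dots> = (\<Sum>a\<in>I. (\<integral>\<omega>. (\<Sum>b\<in>I. c a * c b * (Z a \<omega> * Z b \<omega>)) \<partial>N))"
      by (intro Bochner_Integration.integral_sum Bochner_Integration.integrable_sum integrable_mult_right Z)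
    also have "\<dots> = (\<Sum>a\<in>I. \<Sum>b\<in>I. (\<integral>\<omega>. c a * c b * (Z a \<omega> * Z b \<omega>) \<partial>N))"
      by (intro sum.cong refl Bochner_Integration.integral_sum integrable_mult_right Z)
    finally show ?thesis by simp
  qed
  show ?thesis
    by (simp add: expand[OF X] expand[OF Y] eq)
qed

text \<open>Off the event of a deviation above \<open>e\<close> the integrand is at most
  \<open>e\<close>, on it at most \<open>C\<close>, and the probability of the event
  vanishes.\<close>

lemma tendsto_in_prob_imp_mean:
  fixes X :: "nat \<Rightarrow> 'a \<Rightarrow> real"
  assumes prob: "\<And>n. prob_space (M n)" and lim: "tendsto_in_prob M X c"
    and meas: "\<And>n. X n \<in> borel_measurable (M n)" and bd: "\<And>n \<omega>. \<bar>X n \<omega> - c\<bar> \<le> C"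
  shows "(\<lambda>n. \<integral>\<omega>. \<bar>X n \<omega> - c\<bar> \<partial>M n) \<longlonglongrightarrow> 0"
proof (rule LIMSEQ_I)
  fix r :: real assume r: "r > 0"
  define e where "e = r / 2"
  have e: "e > 0" using r by (simp add: e_def)
  have C: "C \<ge> 0" using bd[of 0 undefined] by linarith
  let ?A = "\<lambda>n. {\<omega> \<in> space (M n). \<bar>X n \<omega> - c\<bar> > e}"
  have "(\<lambda>n. measure (M n) (?A n)) \<longlonglongrightarrow> 0"
    using lim e by (simp add: tendsto_in_prob_def)
  then have "(\<lambda>n. e + C * measure (M n) (?A n)) \<longlonglongrightarrow> e + C * 0"
    by (intro tendsto_intros)
  then have "\<forall>\<^sub>F n in sequentially. e + C * measure (M n) (?A n) < r"
    by (rule order_tendstoD(2)) (use r in \<open>simp add: e_def\<close>)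
  then obtain n0 where n0: "\<And>n. n \<ge> n0 \<Longrightarrow> e + C * measure (M n) (?A n) < r"
    by (auto simp: eventually_sequentially)
  show "\<exists>n0. \<forall>n\<ge>n0. norm ((\<integral>\<omega>. \<bar>X n \<omega> - c\<bar> \<partial>M n) - 0) < r"
  proof (intro exI allI impI)
    fix n assume n: "n0 \<le> n"
    interpret prob_space "M n" by (rule prob)
    note [measurable] = meas[of n]
    have A: "?A n \<in> sets (M n)" by measurable
    have "(\<integral>\<omega>. \<bar>X n \<omega> - c\<bar> \<partial>M n) \<le> (\<integral>\<omega>. e + C * indicator (?A n) \<omega> \<partial>M n)"
    proof (rule integral_mono)
      show "integrable (M n) (\<lambda>\<omega>. \<bar>X n \<omega> - c\<bar>)"
        by (rule integrable_const_bound[of _ C]) (use bd in auto)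
      show "integrable (M n) (\<lambda>\<omega>. e + C * indicator (?A n) \<omega>)"
        using A by (intro Bochner_Integration.integrable_add integrable_const integrable_mult_right)
           (simp add: emeasure_eq_measure)
      fix \<omega> assume "\<omega> \<in> space (M n)"
      then show "\<bar>X n \<omega> - c\<bar> \<le> e + C * indicator (?A n) \<omega>"
        using bd[of n \<omega>] e C by (auto simp: indicator_def)
    qed
    also have "\<dots> = e + C * measure (M n) (?A n)"
      using A prob_space by (subst Bochner_Integration.integral_add) (auto simp: emeasure_eq_measure)
    finally show "norm ((\<integral>\<omega>. \<bar>X n \<omega> - c\<bar> \<partial>M n) - 0) < r"
      using n0[OF n] by simp
  qed
qed

lemma cavity_cong:
  assumes "\<And>p q. p \<in> {1..n} \<Longrightarrow> q \<in> {1..n} \<Longrightarrow> a p q = a' p q"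
    and "\<And>p. p \<in> {1..n} \<Longrightarrow> x p = x' p" and "i \<in> {1..n}"
  shows "cavity f n a x k S i = cavity f n a' x' k S i"
  using assms(3)
proof (induction k arbitrary: S i)
  case 0
  then show ?case using assms(2) by simp
next
  case (Suc k)
  have "(\<Sum>j\<in>{1..n} - (S \<union> {i}). a i j * f k (cavity f n a x k (S \<union> {i}) j)) =
      (\<Sum>j\<in>{1..n} - (S \<union> {i}). a' i j * f k (cavity f n a' x' k (S \<union> {i}) j))"
    using Suc assms(1) by (intro sum.cong refl arg_cong2[of _ _ _ _ "(*)"] arg_cong[of _ _ "f k"]) auto
  then show ?case by simp
qed

lemma distr_data:
  assumes M: "prob_space M" and n: "2 \<le> n"
    and indep: "prob_space.indep_vars M (\<lambda>_. borel) (\<lambda>(i, j). A i j) {(i, j). 1 \<le> i \<and> i < j \<and> j \<le> n}"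
    and gauss: "\<And>i j. 1 \<le> i \<Longrightarrow> i < j \<Longrightarrow> j \<le> n \<Longrightarrow> distributed M lborel (A i j) std_normal_density"
    and ind: "independent_rvs M
        (\<Pi>\<^sub>M p\<in>{1..n} \<times> {1..n}. borel) (\<lambda>\<omega>. \<lambda>p\<in>{1..n} \<times> {1..n}. A (fst p) (snd p) \<omega>)
        (\<Pi>\<^sub>M i\<in>{1..n}. borel) (\<lambda>\<omega>. \<lambda>i\<in>{1..n}. u i \<omega>)"
  shows "distr M ((\<Pi>\<^sub>M p\<in>edges n. borel) \<Otimes>\<^sub>M (\<Pi>\<^sub>M i\<in>{1..n}. borel))
      (\<lambda>\<omega>. (\<lambda>p\<in>edges n. A (fst p) (snd p) \<omega>, \<lambda>i\<in>{1..n}. u i \<omega>)) =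
    data_law n (distr M (\<Pi>\<^sub>M i\<in>{1..n}. borel) (\<lambda>\<omega>. \<lambda>i\<in>{1..n}. u i \<omega>))"
proof -
  interpret prob_space M by (rule M)
  have sub: "edges n \<subseteq> {1..n} \<times> {1..n}" by (auto simp: edges_def)
  have "(\<lambda>a. restrict a (edges n)) \<in> measurable (\<Pi>\<^sub>M p\<in>{1..n} \<times> {1..n}. borel) (\<Pi>\<^sub>M p\<in>edges n. borel)"
    using sub by (rule measurable_restrict_subset)
  from independent_rvs_compose1[OF ind this]
  have "independent_rvs M (\<Pi>\<^sub>M p\<in>edges n. borel) (\<lambda>\<omega>. \<lambda>p\<in>edges n. A (fst p) (snd p) \<omega>)
        (\<Pi>\<^sub>M i\<in>{1..n}. borel) (\<lambda>\<omega>. \<lambda>i\<in>{1..n}. u i \<omega>)"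
    using sub by (simp add: Int_absorb1)
  from distr_independent_rvs[OF M this]
  have "distr M ((\<Pi>\<^sub>M p\<in>edges n. borel) \<Otimes>\<^sub>M (\<Pi>\<^sub>M i\<in>{1..n}. borel))
      (\<lambda>\<omega>. (\<lambda>p\<in>edges n. A (fst p) (snd p) \<omega>, \<lambda>i\<in>{1..n}. u i \<omega>)) =
    distr M (\<Pi>\<^sub>M p\<in>edges n. borel) (\<lambda>\<omega>. \<lambda>p\<in>edges n. A (fst p) (snd p) \<omega>) \<Otimes>\<^sub>M
    distr M (\<Pi>\<^sub>M i\<in>{1..n}. borel) (\<lambda>\<omega>. \<lambda>i\<in>{1..n}. u i \<omega>)" .
  moreover have "distr M (\<Pi>\<^sub>M p\<in>edges n. borel) (\<lambda>\<omega>. \<lambda>p\<in>edges n. A (fst p) (snd p) \<omega>) =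
      (\<Pi>\<^sub>M p\<in>edges n. std_normal_distribution)"
  proof -
    have eq: "(\<lambda>(i, j). A i j) = (\<lambda>p. A (fst p) (snd p))" by (auto simp: split_beta')
    have ix: "indep_vars (\<lambda>_. borel) (\<lambda>p. A (fst p) (snd p)) (edges n)"
      using indep by (simp add: eq edges_def)
    \<comment> \<open>This is where \<open>2 \<le> n\<close> enters: the product description of the
      joint law is applied to a nonempty index set.\<close>
    have "(1, 2) \<in> edges n" using n by (simp add: edges_def)
    then have ne: "edges n \<noteq> {}" by blast
    have rv: "random_variable borel (A (fst p) (snd p))" if "p \<in> edges n" for p
      using ix that by (auto simp: indep_vars_def)
    have "distr M (\<Pi>\<^sub>M p\<in>edges n. borel) (\<lambda>\<omega>. \<lambda>p\<in>edges n. A (fst p) (snd p) \<omega>) =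
        (\<Pi>\<^sub>M p\<in>edges n. distr M borel (A (fst p) (snd p)))"
      using indep_vars_iff_distr_eq_PiM'[OF ne, where M' = "\<lambda>_. borel" and X = "\<lambda>p. A (fst p) (snd p)"] rv ix
      by simp
    also have "\<dots> = (\<Pi>\<^sub>M p\<in>edges n. std_normal_distribution)"
    proof (rule PiM_cong[OF refl])
      fix p assume "p \<in> edges n"
      then have "distributed M lborel (A (fst p) (snd p)) std_normal_density"
        by (intro gauss) (auto simp: edges_def)
      then have "distr M lborel (A (fst p) (snd p)) = std_normal_distribution"
        by (rule distributed_distr_eq_density)
      then show "distr M borel (A (fst p) (snd p)) = std_normal_distribution"
        by (metis distr_cong sets_lborel)
    qed
    finally show ?thesis .
  qed
  ultimately show ?thesis by (simp add: data_law_def)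
qed

text \<open>\<open>V\<close> is known only as a weak limit, so its second moment comes from
  truncation: the averages of \<open>min (x\<^sup>2) K\<close> are almost surely at most 1, hence so
  is their limit, and monotone convergence sends \<open>K\<close> to infinity. The bound is what
  allows the weight of the trigonometric approximation to be integrated in the limit.\<close>

lemma initial_second_moment:
  fixes u :: "nat \<Rightarrow> nat \<Rightarrow> 'a \<Rightarrow> real"
  assumes prob_M: "\<And>n. prob_space (M n)" and prob_N: "prob_space N"
    and meas: "\<And>n i. i \<in> {1..n} \<Longrightarrow> u n i \<in> borel_measurable (M n)"
    and u_norm: "\<And>n. AE \<omega> in M n. (\<Sum>i=1..n. (u n i \<omega>)\<^sup>2) \<le> real n"
    and V: "V \<in> borel_measurable N"
    and lim: "\<And>\<phi> :: real \<Rightarrow> real. continuous_on UNIV \<phi> \<Longrightarrow> bounded (range \<phi>) \<Longrightarrow>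
        tendsto_in_prob M (\<lambda>n \<omega>. 1 / real n * (\<Sum>i=1..n. \<phi> (u n i \<omega>))) (\<integral>\<omega>. \<phi> (V \<omega>) \<partial>N)"
  shows "integrable N (\<lambda>\<omega>. (V \<omega>)\<^sup>2)"
proof -
  interpret N: prob_space N by (rule prob_N)
  note [measurable] = V
  have le1: "(\<integral>\<omega>. min ((V \<omega>)\<^sup>2) (real K) \<partial>N) \<le> 1" for K :: nat
  proof (rule ccontr)
    assume neg: "\<not> (\<integral>\<omega>. min ((V \<omega>)\<^sup>2) (real K) \<partial>N) \<le> 1"
    define c where "c = (\<integral>\<omega>. min ((V \<omega>)\<^sup>2) (real K) \<partial>N)"
    \<comment> \<open>Half of the excess over 1: an average that is at most 1 stays more than
      \<open>e\<close> below \<open>c\<close>.\<close>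
    define e where "e = (c - 1) / 2"
    have e: "e > 0" "c - e > 1" using neg by (auto simp: e_def c_def field_simps)
    let ?X = "\<lambda>n \<omega>. 1 / real n * (\<Sum>i=1..n. min ((u n i \<omega>)\<^sup>2) (real K))"
    have "tendsto_in_prob M ?X c"
      unfolding c_def
    proof (rule lim)
      show "continuous_on UNIV (\<lambda>x :: real. min (x\<^sup>2) (real K))" by (intro continuous_intros)
      show "bounded (range (\<lambda>x :: real. min (x\<^sup>2) (real K)))"
        by (auto simp: bounded_iff intro!: exI[of _ "real K"])
    qed
    then have lim0: "(\<lambda>n. measure (M n) {\<omega> \<in> space (M n). \<bar>?X n \<omega> - c\<bar> > e}) \<longlonglongrightarrow> 0"
      using e by (simp add: tendsto_in_prob_def)
    have one: "measure (M n) {\<omega> \<in> space (M n). \<bar>?X n \<omega> - c\<bar> > e} = 1" for n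
    proof -
      interpret M: prob_space "M n" by (rule prob_M)
      have [measurable]: "?X n \<in> borel_measurable (M n)"
        using meas[of _ n] by (intro borel_measurable_times borel_measurable_const borel_measurable_sum
            borel_measurable_min borel_measurable_power) auto
      have "AE \<omega> in M n. \<bar>?X n \<omega> - c\<bar> > e"
        using u_norm[of n]
      proof eventually_elim
        case (elim \<omega>)
        have "(\<Sum>i=1..n. min ((u n i \<omega>)\<^sup>2) (real K)) \<le> (\<Sum>i=1..n. (u n i \<omega>)\<^sup>2)"
          by (intro sum_mono) auto
        then have "?X n \<omega> \<le> 1 / real n * real n"
          using elim by (intro mult_left_mono) auto
        \<comment> \<open>Strict only at \<open>n = 0\<close>, where \<open>1 / real n\<close> is
          0.\<close>
        also have "\<dots> \<le> 1" by simp
        finally show ?case using e by linarith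
      qed
      moreover have "{\<omega> \<in> space (M n). \<bar>?X n \<omega> - c\<bar> > e} \<in> sets (M n)" by measurable
      ultimately show ?thesis by (rule M.prob_Collect_eq_1[THEN iffD2, rotated])
    qed
    show False using lim0 unfolding one by (simp add: LIMSEQ_const_iff)
  qed
  have "(\<integral>\<^sup>+\<omega>. ennreal ((V \<omega>)\<^sup>2) \<partial>N) \<le> (\<integral>\<^sup>+\<omega>. (SUP K. ennreal (min ((V \<omega>)\<^sup>2) (real K))) \<partial>N)"
  proof (rule nn_integral_mono)
    fix \<omega>
    obtain K :: nat where "(V \<omega>)\<^sup>2 \<le> real K" using real_arch_simple by blast
    then show "ennreal ((V \<omega>)\<^sup>2) \<le> (SUP K. ennreal (min ((V \<omega>)\<^sup>2) (real K)))"
      by (intro SUP_upper2[of K]) auto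
  qed
  also have "\<dots> = (SUP K. \<integral>\<^sup>+\<omega>. ennreal (min ((V \<omega>)\<^sup>2) (real K)) \<partial>N)"
  proof (rule nn_integral_monotone_convergence_SUP)
    show "incseq (\<lambda>K \<omega>. ennreal (min ((V \<omega>)\<^sup>2) (real K)))"
      by (auto simp: incseq_def le_fun_def intro!: ennreal_leI min.mono)
  qed measurable
  also have "\<dots> \<le> 1"
  proof (rule SUP_least)
    fix K :: nat
    have int: "integrable N (\<lambda>\<omega>. min ((V \<omega>)\<^sup>2) (real K))"
      by (rule N.integrable_const_bound[of _ "real K"]) auto
    show "(\<integral>\<^sup>+\<omega>. ennreal (min ((V \<omega>)\<^sup>2) (real K)) \<partial>N) \<le> 1"
      using le1[of K] by (subst nn_integral_eq_integral[OF int]) (auto simp flip: ennreal_1 intro: ennreal_leI)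
  qed
  finally have le: "(\<integral>\<^sup>+\<omega>. ennreal ((V \<omega>)\<^sup>2) \<partial>N) \<le> 1" .
  show ?thesis
  proof (rule integrableI_nonneg)
    show "(\<integral>\<^sup>+\<omega>. ennreal ((V \<omega>)\<^sup>2) \<partial>N) < \<infinity>"
      using le by (rule order_le_less_trans) simp
  qed auto
qed

text \<open>Independence makes the joint law a product, so the Gaussian part is integrated out for a
  fixed value \<open>w\<close> of \<open>W 0\<close>, which sits in the phase.\<close>

lemma expectation_cos_gaussian_shift:
  fixes W :: "nat \<Rightarrow> 'b \<Rightarrow> real"
  assumes prob_N: "prob_space N"
    and gauss: "jointly_centered_gaussian N {1..k} W"
    and indep: "independent_rvs N borel (W 0) (\<Pi>\<^sub>M a\<in>{1..k}. borel) (\<lambda>\<omega>. \<lambda>a\<in>{1..k}. W a \<omega>)"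
    and m: "m \<le> k"
  shows "(\<integral>\<omega>. cos (\<theta> + (\<Sum>a\<le>m. t a * W a \<omega>)) \<partial>N) =
     exp (- (\<integral>\<omega>. (\<Sum>a<m. t (Suc a) * W (Suc a) \<omega>)\<^sup>2 \<partial>N) / 2) * (\<integral>\<omega>. cos (\<theta> + t 0 * W 0 \<omega>) \<partial>N)"
proof -
  interpret N: prob_space N by (rule prob_N)
  let ?P = "\<Pi>\<^sub>M a\<in>{1..k}. (borel :: real measure)"
  let ?Y = "\<lambda>\<omega>. \<lambda>a\<in>{1..k}. W a \<omega>"
  have [measurable]: "W 0 \<in> borel_measurable N" "?Y \<in> measurable N ?P"
    using indep by (auto simp: independent_rvs_def)
  interpret D0: prob_space "distr N borel (W 0)" by (rule N.prob_space_distr) measurable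
  interpret DY: prob_space "distr N ?P ?Y" by (rule N.prob_space_distr) measurable
  interpret DD: pair_prob_space "distr N borel (W 0)" "distr N ?P ?Y" ..
  \<comment> \<open>Coefficients are padded with 0 above \<open>m\<close>, because Gaussianity and
    independence are given for the whole vector over \<open>{1..k}\<close>.\<close>
  define G where "G y = (\<Sum>a\<in>{1..k}. (if a \<le> m then t a else 0) * y a)" for y :: "nat \<Rightarrow> real"
  have Gm [measurable]: "G \<in> borel_measurable ?P"
    unfolding G_def by (intro borel_measurable_sum borel_measurable_times borel_measurable_const measurable_component_singleton)
  have G: "G (?Y \<omega>) = (\<Sum>a<m. t (Suc a) * W (Suc a) \<omega>)" for \<omega>
  proof -
    have "G (?Y \<omega>) = (\<Sum>a\<in>{1..m}. t a * W a \<omega>)"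
      unfolding G_def using m by (intro sum.mono_neutral_cong_right) auto
    also have "\<dots> = (\<Sum>a<m. t (Suc a) * W (Suc a) \<omega>)"
      by (rule sum.reindex_bij_witness[of _ Suc "\<lambda>a. a - 1"]) auto
    finally show ?thesis .
  qed
  have "centered_gaussian N (\<lambda>\<omega>. \<Sum>a\<in>{1..k}. (if a \<le> m then t a else 0) * W a \<omega>)"
    using gauss by (simp add: jointly_centered_gaussian_def)
  also have "(\<lambda>\<omega>. \<Sum>a\<in>{1..k}. (if a \<le> m then t a else 0) * W a \<omega>) = (\<lambda>\<omega>. G (?Y \<omega>))"
    by (auto simp: G_def intro!: sum.cong)
  finally have cg: "centered_gaussian N (\<lambda>\<omega>. G (?Y \<omega>))" .
  define v where "v = (\<integral>\<omega>. (G (?Y \<omega>))\<^sup>2 \<partial>N)"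
  let ?h = "\<lambda>p. cos ((\<theta> + t 0 * fst p) + G (snd p))"
  have [measurable]: "?h \<in> borel_measurable (borel \<Otimes>\<^sub>M ?P)" by measurable
  have int: "integrable (distr N borel (W 0) \<Otimes>\<^sub>M distr N ?P ?Y) ?h"
  proof (rule DD.integrable_const_bound[of _ 1])
    show "?h \<in> borel_measurable (distr N borel (W 0) \<Otimes>\<^sub>M distr N ?P ?Y)"
      unfolding measurable_cong_sets[OF sets_pair_measure_cong[OF sets_distr sets_distr] refl] by fact
  qed auto
  have "(\<integral>\<omega>. cos (\<theta> + (\<Sum>a\<le>m. t a * W a \<omega>)) \<partial>N) = (\<integral>\<omega>. ?h (W 0 \<omega>, ?Y \<omega>) \<partial>N)"
    unfolding fst_conv snd_conv G
    by (simp add: lessThan_Suc_atMost[symmetric] sum.lessThan_Suc_shift add.assoc del: sum.lessThan_Suc)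
  also have "\<dots> = (\<integral>p. ?h p \<partial>distr N (borel \<Otimes>\<^sub>M ?P) (\<lambda>\<omega>. (W 0 \<omega>, ?Y \<omega>)))"
    by (rule integral_distr[symmetric]) measurable
  also have "\<dots> = (\<integral>p. ?h p \<partial>(distr N borel (W 0) \<Otimes>\<^sub>M distr N ?P ?Y))"
    by (simp only: distr_independent_rvs[OF prob_N indep])
  also have "\<dots> = (\<integral>w. (\<integral>y. ?h (w, y) \<partial>distr N ?P ?Y) \<partial>distr N borel (W 0))"
    by (rule DD.integral_fst'[OF int, symmetric])
  also have "\<dots> = (\<integral>w. cos (\<theta> + t 0 * w) * exp (- v / 2) \<partial>distr N borel (W 0))"
  proof (intro Bochner_Integration.integral_cong refl)
    fix w
    have "(\<integral>y. ?h (w, y) \<partial>distr N ?P ?Y) = (\<integral>\<omega>. cos ((\<theta> + t 0 * w) + G (?Y \<omega>)) \<partial>N)"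
      unfolding fst_conv snd_conv by (rule integral_distr) measurable
    also have "\<dots> = cos (\<theta> + t 0 * w) * exp (- v / 2)"
      unfolding v_def by (rule N.centered_gaussian_moments(2)[OF cg])
    finally show "(\<integral>y. ?h (w, y) \<partial>distr N ?P ?Y) = cos (\<theta> + t 0 * w) * exp (- v / 2)" .
  qed
  also have "\<dots> = (\<integral>\<omega>. cos (\<theta> + t 0 * W 0 \<omega>) * exp (- v / 2) \<partial>N)"
    by (subst integral_distr) auto
  also have "\<dots> = exp (- v / 2) * (\<integral>\<omega>. cos (\<theta> + t 0 * W 0 \<omega>) \<partial>N)"
    by simp
  finally show ?thesis by (simp only: v_def G)
qed

theorem theorem1:
  fixes M :: "nat \<Rightarrow> 'a measure"
    and A :: "nat \<Rightarrow> nat \<Rightarrow> nat \<Rightarrow> 'a \<Rightarrow> real"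
    and u :: "nat \<Rightarrow> nat \<Rightarrow> 'a \<Rightarrow> real"
    and f :: "nat \<Rightarrow> real \<Rightarrow> real"
    and N :: "'b measure"
    and W :: "nat \<Rightarrow> 'b \<Rightarrow> real"
    and k :: nat
    and \<psi> :: "(nat \<Rightarrow> real) \<Rightarrow> real"
  assumes prob_M: "\<And>n. prob_space (M n)"
    and A_sym: "\<And>n i j \<omega>. i \<in> {1..n} \<Longrightarrow> j \<in> {1..n} \<Longrightarrow> \<omega> \<in> space (M n) \<Longrightarrow> A n i j \<omega> = A n j i \<omega>"
    and A_diag: "\<And>n i \<omega>. i \<in> {1..n} \<Longrightarrow> \<omega> \<in> space (M n) \<Longrightarrow> A n i i \<omega> = 0"
    and A_indep: "\<And>n. prob_space.indep_vars (M n) (\<lambda>_. borel) (\<lambda>(i, j). A n i j)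
                    {(i, j). 1 \<le> i \<and> i < j \<and> j \<le> n}"
    and A_gaussian: "\<And>n i j. 1 \<le> i \<Longrightarrow> i < j \<Longrightarrow> j \<le> n \<Longrightarrow>
                    distributed (M n) lborel (A n i j) std_normal_density"
    and A_u_indep: "\<And>n. independent_rvs (M n)
                    (\<Pi>\<^sub>M p\<in>{1..n} \<times> {1..n}. borel) (\<lambda>\<omega>. \<lambda>p\<in>{1..n} \<times> {1..n}. A n (fst p) (snd p) \<omega>)
                    (\<Pi>\<^sub>M i\<in>{1..n}. borel) (\<lambda>\<omega>. \<lambda>i\<in>{1..n}. u n i \<omega>)"
    and u_norm: "\<And>n. AE \<omega> in M n. sqrt (1 / real n * (\<Sum>i=1..n. (u n i \<omega>)\<^sup>2)) \<le> 1"
    and f_smooth: "\<And>l. bounded_smooth (f l)"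
    and prob_N: "prob_space N"
    and u_limit: "\<And>\<phi> :: real \<Rightarrow> real. continuous_on UNIV \<phi> \<Longrightarrow> bounded (range \<phi>) \<Longrightarrow>
                    tendsto_in_prob M (\<lambda>n \<omega>. 1 / real n * (\<Sum>i=1..n. \<phi> (u n i \<omega>)))
                      (prob_space.expectation N (\<lambda>\<omega>. \<phi> (W 0 \<omega>)))"
    and W_gaussian: "jointly_centered_gaussian N {1..k} W"
    and W_indep: "independent_rvs N
                    borel (W 0)
                    (\<Pi>\<^sub>M a\<in>{1..k}. borel) (\<lambda>\<omega>. \<lambda>a\<in>{1..k}. W a \<omega>)"
    and W_cov: "\<And>a b. a < k \<Longrightarrow> b < k \<Longrightarrow>
                    prob_space.expectation N (\<lambda>\<omega>. W (Suc a) \<omega> * W (Suc b) \<omega>) =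
                    prob_space.expectation N (\<lambda>\<omega>. f a (W a \<omega>) * f b (W b \<omega>))"
    and psi: "bounded_Lipschitz k \<psi>"
  shows "tendsto_in_prob M
           (\<lambda>n \<omega>. 1 / real n *
              (\<Sum>i=1..n. \<psi> (\<lambda>a\<in>{..k}. cavity f n (\<lambda>i j. A n i j \<omega>) (\<lambda>i. u n i \<omega>) a {} i)))
           (prob_space.expectation N (\<lambda>\<omega>. \<psi> (\<lambda>a\<in>{..k}. W a \<omega>)))"

proof -
  \<comment> \<open>Deviation probabilities from a constant depend only on the joint law of matrix
    and vector, so the given spaces can be exchanged for the canonical one.\<close>
  define \<mu> where "\<mu> n = distr (M n) (\<Pi>\<^sub>M i\<in>{1..n}. borel) (\<lambda>\<omega>. \<lambda>i\<in>{1..n}. u n i \<omega>)" for n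
  have u_vec: "(\<lambda>\<omega>. \<lambda>i\<in>{1..n}. u n i \<omega>) \<in> measurable (M n) (\<Pi>\<^sub>M i\<in>{1..n}. borel)" for n
    using A_u_indep[of n] by (auto simp: independent_rvs_def)
  have u_meas: "u n i \<in> borel_measurable (M n)" if "i \<in> {1..n}" for n i
    using measurable_compose[OF u_vec[of n] measurable_component_singleton[OF that]] that by simp
  have u_sq: "AE \<omega> in M n. (\<Sum>i=1..n. (u n i \<omega>)\<^sup>2) \<le> real n" for n
    using u_norm[of n]
  proof eventually_elim
    case (elim \<omega>)
    then show ?case by (cases "n = 0") (auto simp: field_simps)
  qed
  have "\<forall>l. \<exists>B L. \<forall>x y. \<bar>f l x\<bar> \<le> B \<and> \<bar>f l x - f l y\<bar> \<le> L * \<bar>x - y\<bar>"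
    using bounded_smooth_bounds[OF f_smooth] by blast
  then obtain B L where fB: "\<And>l x. \<bar>f l x\<bar> \<le> B l" and fL: "\<And>l x y. \<bar>f l x - f l y\<bar> \<le> L l * \<bar>x - y\<bar>"
    by metis
  have cavity_space: "cavity_space n (\<mu> n) f B L" for n
  proof (intro cavity_space.intro data_space.intro cavity_space_axioms.intro)
    interpret prob_space "M n" by (rule prob_M)
    show "prob_space (\<mu> n)" unfolding \<mu>_def by (rule prob_space_distr[OF u_vec])
    show "sets (\<mu> n) = sets (\<Pi>\<^sub>M i\<in>{1..n}. borel)" by (simp add: \<mu>_def)
    have "(\<integral>\<^sup>+x. ennreal (\<Sum>i=1..n. (x i)\<^sup>2) \<partial>\<mu> n) = (\<integral>\<^sup>+\<omega>. ennreal (\<Sum>i=1..n. (u n i \<omega>)\<^sup>2) \<partial>M n)"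
      unfolding \<mu>_def
      by (subst nn_integral_distr[OF u_vec]) (auto intro!: measurable_compose[OF _ measurable_ennreal]
          borel_measurable_sum borel_measurable_power measurable_component_singleton)
    also have "\<dots> \<le> (\<integral>\<^sup>+\<omega>. ennreal (real n) \<partial>M n)"
      using u_sq[of n] by (intro nn_integral_mono_AE) (auto intro: ennreal_leI)
    also have "\<dots> = ennreal (real n)" by (simp add: emeasure_space_1)
    finally show "(\<integral>\<^sup>+x. ennreal (\<Sum>i=1..n. (x i)\<^sup>2) \<partial>\<mu> n) \<le> ennreal (real n)" .
  qed (rule fB fL)+
  interpret N: prob_space N by (rule prob_N)
  have W0: "W 0 \<in> borel_measurable N" using W_indep by (simp add: independent_rvs_def)
  have W_cg: "centered_gaussian N (W a)" if "a \<in> {1..k}" for a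
  proof -
    have "(\<Sum>b=1..k. (if b = a then 1 else 0) * W b \<omega>) = W a \<omega>" for \<omega>
      using that by (simp add: if_distrib[of "\<lambda>z. z * _"] cong: if_cong)
    then show ?thesis
      using W_gaussian[unfolded jointly_centered_gaussian_def, rule_format, of "\<lambda>b. if b = a then 1 else 0"] by simp
  qed
  have W_meas: "W a \<in> borel_measurable N" if "a \<le> k" for a
    using W0 W_cg[of a] that by (cases "a = 0") (auto simp: centered_gaussian_def)
  have W_sq: "integrable N (\<lambda>\<omega>. (W a \<omega>)\<^sup>2)" if "a \<le> k" for a
  proof (cases "a = 0")
    case True
    show ?thesis unfolding True
    proof (rule initial_second_moment[where M = M and u = u])
      show "tendsto_in_prob M (\<lambda>n \<omega>. 1 / real n * (\<Sum>i=1..n. \<phi> (u n i \<omega>))) (\<integral>\<omega>. \<phi> (W 0 \<omega>) \<partial>N)"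
        if "continuous_on UNIV \<phi>" "bounded (range \<phi>)" for \<phi> :: "real \<Rightarrow> real"
        using that by (rule u_limit)
    qed (fact prob_M prob_N u_meas u_sq W0)+
  next
    case False
    then show ?thesis using N.centered_gaussian_moments(1)[OF W_cg[of a]] that by simp
  qed
  have f_meas: "f l \<in> borel_measurable borel" for l
    by (rule cavity_space.f_measurable[OF cavity_space])
  \<comment> \<open>The covariance recursion enters here: the variance of the Gaussian part becomes
    the second moment of a combination of the \<open>f a (W a)\<close>, which is the limit of the
    row variances.\<close>
  have W_var: "(\<integral>\<omega>. (\<Sum>a<m. t (Suc a) * W (Suc a) \<omega>)\<^sup>2 \<partial>N) = (\<integral>\<omega>. (\<Sum>a<m. t (Suc a) * f a (W a \<omega>))\<^sup>2 \<partial>N)"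
    if m: "m \<le> k" for m and t :: "nat \<Rightarrow> real"
  proof (rule expectation_sum_square_eq[where c = "\<lambda>a. t (Suc a)"])
    fix a b assume ab: "a \<in> {..<m}" "b \<in> {..<m}"
    show "integrable N (\<lambda>\<omega>. W (Suc a) \<omega> * W (Suc b) \<omega>)"
      using ab m by (intro integrable_mult_of_squares W_meas W_sq) auto
    have fm: "(\<lambda>\<omega>. f c (W c \<omega>)) \<in> borel_measurable N" if "c < m" for c
      using that m by (intro measurable_compose[OF W_meas f_meas]) auto
    have "\<bar>f a x * f b y\<bar> \<le> B a * B b" for x y
      unfolding abs_mult using cavity_space.B_nonneg[OF cavity_space] by (intro mult_mono fB) auto
    then show "integrable N (\<lambda>\<omega>. f a (W a \<omega>) * f b (W b \<omega>))"
      using ab by (intro N.integrable_const_bound[of _ "B a * B b"] borel_measurable_times fm) auto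
    show "N.expectation (\<lambda>\<omega>. W (Suc a) \<omega> * W (Suc b) \<omega>) = N.expectation (\<lambda>\<omega>. f a (W a \<omega>) * f b (W b \<omega>))"
      using ab m by (intro W_cov) auto
  qed
  interpret cavity_sequence N \<mu> f B L W k
  proof (intro cavity_sequence.intro cavity_sequence_axioms.intro prob_N)
    show "cavity_space n (\<mu> n) f B L" for n by (rule cavity_space)
    show "W a \<in> borel_measurable N" "integrable N (\<lambda>\<omega>. (W a \<omega>)\<^sup>2)" if "a \<le> k" for a
      using that by (rule W_meas, rule W_sq)
    show "(\<integral>\<omega>. cos (\<theta> + (\<Sum>a\<le>m. t a * W a \<omega>)) \<partial>N) =
        exp (- (\<integral>\<omega>. (\<Sum>a<m. t (Suc a) * f a (W a \<omega>))\<^sup>2 \<partial>N) / 2) * (\<integral>\<omega>. cos (\<theta> + t 0 * W 0 \<omega>) \<partial>N)"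
      if "m \<le> k" for m \<theta> t
      using expectation_cos_gaussian_shift[OF prob_N W_gaussian W_indep that, of \<theta> t] W_var[OF that, of t] by simp
    fix \<theta> t :: real
    define c where "c = (\<integral>\<omega>. cos (\<theta> + t * W 0 \<omega>) \<partial>N)"
    let ?X = "\<lambda>n \<omega>. 1 / real n * (\<Sum>i=1..n. cos (\<theta> + t * u n i \<omega>))"
    have X1: "\<bar>1 / real n * (\<Sum>i=1..n. cos (y i))\<bar> \<le> 1" for n and y :: "nat \<Rightarrow> real"
    proof (cases "n = 0")
      case False
      have "\<bar>\<Sum>i=1..n. cos (y i)\<bar> \<le> (\<Sum>i=1..n. \<bar>cos (y i)\<bar>)" by (rule sum_abs)
      also have "\<dots> \<le> real (card {1..n}) * 1" by (intro sum_bounded_above) auto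
      finally show ?thesis using False by (simp add: abs_mult field_simps)
    qed simp
    have "\<bar>c\<bar> \<le> 1"
    proof -
      have "\<bar>c\<bar> \<le> (\<integral>\<omega>. \<bar>cos (\<theta> + t * W 0 \<omega>)\<bar> \<partial>N)" unfolding c_def by (rule integral_abs_bound)
      also have "\<dots> \<le> (\<integral>\<omega>. 1 \<partial>N)"
        using W0 by (intro integral_mono N.integrable_const_bound[of _ 1]) auto
      finally show ?thesis using N.prob_space by simp
    qed
    then have Xc: "\<bar>?X n \<omega> - c\<bar> \<le> 2" for n \<omega>
      using X1[of n "\<lambda>i. \<theta> + t * u n i \<omega>"] by linarith
    have "(\<lambda>n. \<integral>\<omega>. \<bar>?X n \<omega> - c\<bar> \<partial>M n) \<longlonglongrightarrow> 0"
    proof (rule tendsto_in_prob_imp_mean[OF prob_M _ _ Xc])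
      show "tendsto_in_prob M ?X c" unfolding c_def
        by (rule u_limit) (auto intro!: continuous_intros simp: bounded_iff intro: exI[of _ 1])
      show "?X n \<in> borel_measurable (M n)" for n
        using u_meas[of _ n] by (intro borel_measurable_times borel_measurable_const borel_measurable_sum
            measurable_compose[OF _ borel_measurable_cos] borel_measurable_add) auto
    qed
    \<comment> \<open>The initial average is a function of the vector alone, so the matrix
      coordinates integrate out and only \<open>\<mu> n\<close> remains.\<close>
    moreover have "(\<integral>d. \<bar>1 / real n * (\<Sum>i=1..n. cos (\<theta> + t * snd d i)) - c\<bar> \<partial>data_law n (\<mu> n)) =
        (\<integral>\<omega>. \<bar>?X n \<omega> - c\<bar> \<partial>M n)" for n
    proof -
      define h where "h x = \<bar>1 / real n * (\<Sum>i=1..n. cos (\<theta> + t * x i)) - c\<bar>" for x :: "nat \<Rightarrow> real"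
      have h: "h \<in> borel_measurable (\<Pi>\<^sub>M i\<in>{1..n}. borel)"
        unfolding h_def[abs_def] by (intro borel_measurable_abs borel_measurable_diff borel_measurable_times
            borel_measurable_const borel_measurable_sum measurable_compose[OF _ borel_measurable_cos]
            borel_measurable_add measurable_component_singleton)
      then have h\<mu>: "h \<in> borel_measurable (\<mu> n)" by (simp add: \<mu>_def)
      have "(\<integral>d. h (snd d) \<partial>data_law n (\<mu> n)) = (\<integral>x. h x \<partial>\<mu> n)"
        by (rule data_space.expectation_snd[OF cavity_space.axioms(1)[OF cavity_space] h\<mu>]) (simp add: h_def)
      also have "\<dots> = (\<integral>\<omega>. h (\<lambda>i\<in>{1..n}. u n i \<omega>) \<partial>M n)"
        unfolding \<mu>_def by (rule integral_distr[OF u_vec h])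
      finally show ?thesis by (simp add: h_def)
    qed
    ultimately show "(\<lambda>n. \<integral>d. \<bar>1 / real n * (\<Sum>i=1..n. cos (\<theta> + t * snd d i)) -
        (\<integral>\<omega>. cos (\<theta> + t * W 0 \<omega>) \<partial>N)\<bar> \<partial>data_law n (\<mu> n)) \<longlonglongrightarrow> 0"
      unfolding c_def by simp
  qed
  have conv: "converges k \<psi>" by (rule cavity_average_converges[OF order_refl psi])
  let ?X = "\<lambda>n \<omega>. 1 / real n *
      (\<Sum>i=1..n. \<psi> (\<lambda>a\<in>{..k}. cavity f n (\<lambda>i j. A n i j \<omega>) (\<lambda>i. u n i \<omega>) a {} i))"
  obtain C where C: "\<And>x. x \<in> {..k} \<rightarrow>\<^sub>E UNIV \<Longrightarrow> \<bar>\<psi> x\<bar> \<le> C"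
    using psi unfolding bounded_Lipschitz_def bounded_iff by auto
  \<comment> \<open>Markov's inequality is applied on the canonical space; equality of the data laws
    brings the bound to \<open>M n\<close>.\<close>
  have Markov: "measure (M n) {\<omega> \<in> space (M n). \<bar>?X n \<omega> - W_mean k \<psi>\<bar> > \<epsilon>} \<le>
      (\<integral>d. \<bar>cs.average n k \<psi> {} d - W_mean k \<psi>\<bar> \<partial>data_law n (\<mu> n)) / \<epsilon>"
    if n: "2 \<le> n" and \<epsilon>: "\<epsilon> > 0" for n and \<epsilon> :: real
  proof -
    interpret M: prob_space "M n" by (rule prob_M)
    let ?data = "\<lambda>\<omega>. (\<lambda>p\<in>edges n. A n (fst p) (snd p) \<omega>, \<lambda>i\<in>{1..n}. u n i \<omega>)"
    let ?S = "(\<Pi>\<^sub>M p\<in>edges n. borel) \<Otimes>\<^sub>M (\<Pi>\<^sub>M i\<in>{1..n}. borel) :: ((nat \<times> nat \<Rightarrow> real) \<times> (nat \<Rightarrow> real)) measure"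
    let ?av = "cs.average n k \<psi> {}"
    have law: "distr (M n) ?S ?data = data_law n (\<mu> n)"
      unfolding \<mu>_def by (rule distr_data[OF prob_M n A_indep A_gaussian A_u_indep])
    have data: "?data \<in> measurable (M n) ?S"
    proof (intro measurable_Pair u_vec measurable_restrict)
      fix p assume "p \<in> edges n"
      then have "distributed (M n) lborel (A n (fst p) (snd p)) std_normal_density"
        by (intro A_gaussian) (auto simp: edges_def)
      then show "A n (fst p) (snd p) \<in> borel_measurable (M n)"
        using distributed_measurable by fastforce
    qed
    \<comment> \<open>Symmetry and the zero diagonal recover the matrix from its entries above the
      diagonal at every point of the space.\<close>
    have X: "?X n \<omega> = ?av (?data \<omega>)" if \<omega>: "\<omega> \<in> space (M n)" for \<omega>
    proof -
      have "cavity f n (\<lambda>i j. A n i j \<omega>) (\<lambda>i. u n i \<omega>) a {} i = cs.cav n a {} i (?data \<omega>)" if "i \<in> {1..n}" for a i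
        unfolding cs.cav_def
      proof (rule cavity_cong[OF _ _ that])
        fix p q assume pq: "p \<in> {1..n}" "q \<in> {1..n}"
        show "A n p q \<omega> = sym_mat (fst (?data \<omega>)) p q"
          using A_diag[OF pq(1) \<omega>] A_sym[OF pq \<omega>] edge_in_edges[OF pq]
          by (auto simp: sym_mat_def edge_def min_def max_def)
      qed simp
      then show ?thesis unfolding cs.average_def
        by (intro arg_cong2[of _ _ _ _ "(*)"] sum.cong refl arg_cong[of _ _ \<psi>]) (auto intro!: restrict_ext)
    qed
    have av: "?av \<in> borel_measurable (data_law n (\<mu> n))"
      by (rule cs.average_measurable[OF bounded_Lipschitz_measurable[OF psi]])
    have int: "integrable (data_law n (\<mu> n)) (\<lambda>d. \<bar>?av d - W_mean k \<psi>\<bar>)"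
      by (rule average_diff_integrable[OF bounded_Lipschitz_measurable[OF psi] C])
    have E: "{d \<in> space (data_law n (\<mu> n)). \<bar>?av d - W_mean k \<psi>\<bar> > \<epsilon>} \<in> sets (data_law n (\<mu> n))"
      using av by measurable
    have E': "{d \<in> space (data_law n (\<mu> n)). \<bar>?av d - W_mean k \<psi>\<bar> \<ge> \<epsilon>} \<in> sets (data_law n (\<mu> n))"
      using av by measurable
    have "{\<omega> \<in> space (M n). \<bar>?X n \<omega> - W_mean k \<psi>\<bar> > \<epsilon>} =
        ?data -` {d \<in> space (data_law n (\<mu> n)). \<bar>?av d - W_mean k \<psi>\<bar> > \<epsilon>} \<inter> space (M n)"
    proof -
      have "?data \<omega> \<in> space (data_law n (\<mu> n))" if "\<omega> \<in> space (M n)" for \<omega>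
        using measurable_space[OF data that] unfolding law[symmetric] by simp
      moreover have "{\<omega> \<in> space (M n). \<bar>?X n \<omega> - W_mean k \<psi>\<bar> > \<epsilon>} =
          {\<omega> \<in> space (M n). \<bar>?av (?data \<omega>) - W_mean k \<psi>\<bar> > \<epsilon>}"
        by (intro Collect_cong conj_cong refl) (simp only: X)
      ultimately show ?thesis by auto
    qed
    then have "measure (M n) {\<omega> \<in> space (M n). \<bar>?X n \<omega> - W_mean k \<psi>\<bar> > \<epsilon>} =
        measure (data_law n (\<mu> n)) {d \<in> space (data_law n (\<mu> n)). \<bar>?av d - W_mean k \<psi>\<bar> > \<epsilon>}"
      using measure_distr[OF data, of "{d \<in> space (data_law n (\<mu> n)). \<bar>?av d - W_mean k \<psi>\<bar> > \<epsilon>}"] E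
      unfolding law by (simp add: cs.sets_D)
    also have "\<dots> \<le> measure (data_law n (\<mu> n)) {d \<in> space (data_law n (\<mu> n)). \<bar>?av d - W_mean k \<psi>\<bar> \<ge> \<epsilon>}"
      using E' by (intro cs.finite_measure_mono) auto
    also have "\<dots> \<le> (\<integral>d. \<bar>?av d - W_mean k \<psi>\<bar> \<partial>data_law n (\<mu> n)) / \<epsilon>"
      using \<epsilon> by (intro integral_Markov_inequality_measure[OF int]) auto
    finally show ?thesis .
  qed
  show ?thesis
    unfolding tendsto_in_prob_def W_mean_def[symmetric]
  proof (intro allI impI)
    fix \<epsilon> :: real assume \<epsilon>: "\<epsilon> > 0"
    show "(\<lambda>n. measure (M n) {\<omega> \<in> space (M n). \<bar>?X n \<omega> - W_mean k \<psi>\<bar> > \<epsilon>}) \<longlonglongrightarrow> 0"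
    proof (rule LIMSEQ_I)
      fix r :: real assume r: "r > 0"
      \<comment> \<open>Division by \<epsilon> in Markov's inequality then leaves
        \<open>r / 2\<close>. The size bound 0 below admits only the empty removed set.\<close>
      then have "\<epsilon> * (r / 2) > 0" using \<epsilon> by simp
      from convergesD[OF conv this, of 0]
      have "\<forall>\<^sub>F n in sequentially. norm (measure (M n) {\<omega> \<in> space (M n). \<bar>?X n \<omega> - W_mean k \<psi>\<bar> > \<epsilon>} - 0) < r"
        using eventually_ge_at_top[of 2]
      proof eventually_elim
        case (elim n)
        note Markov[OF elim(2) \<epsilon>]
        also have "(\<integral>d. \<bar>cs.average n k \<psi> {} d - W_mean k \<psi>\<bar> \<partial>data_law n (\<mu> n)) / \<epsilon> \<le> \<epsilon> * (r / 2) / \<epsilon>"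
          using elim(1) \<epsilon> by (intro divide_right_mono) auto
        also have "\<dots> = r / 2" using \<epsilon> by simp
        finally have "measure (M n) {\<omega> \<in> space (M n). \<bar>?X n \<omega> - W_mean k \<psi>\<bar> > \<epsilon>} \<le> r / 2" .
        then show ?case using r measure_nonneg[of "M n"] by simp
      qed
      then show "\<exists>n0. \<forall>n\<ge>n0. norm (measure (M n) {\<omega> \<in> space (M n). \<bar>?X n \<omega> - W_mean k \<psi>\<bar> > \<epsilon>} - 0) < r"
        by (simp only: eventually_sequentially)
    qed
  qed
qed

end
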